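(* Let $A$ be a local ring with residue field $k$. Assume that $\mathcal{P}$ is a $( * )$-property. Let $$f : \bigoplus_{n \in \Lambda} \left( \Omega_n^A(k) \right)^{j_n} \longrightarrow L \qquad (j_n \ge 1 \text{ for each } n \in \Lambda)$$ be a surjective $A$-module homomorphism, where $\Lambda$ is a finite collection of non-negative integers and $L$ is a non-zero $A$-module satisfying $\mathcal{P}$. Then $A$ is regular.
   Context: All rings are commutative Noetherian with identity. For $n\ge0$, $\Omega_n^A(k)$ denotes the $n$th syzygy module of $k$ in a minimal free resolution of $k$ over $A$, with $\Omega_0^A(k)=k$. Let $\mathcal{P}$ be a property of modules over local rings. $\mathcal{P}$ is called a $( * )$-property if the following hold for every local ring $(B,\mathfrak{n})$ and every $B$-module $M$: (i) if the $B$-module $M$ satisfies $\mathcal{P}$ and $x\in\mathfrak{n}$ is a $B$-regular element, then the $B/(x)$-module $M/xM$ satisfies $\mathcal{P}$; (ii) if the $B$-module $M$ satisfies $\mathcal{P}$ and $\mathrm{depth}(B)=0$, then $\mathrm{Ann}_B(M)=0$. *)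

theory Defs
  imports "HOL-Library.Extended_Nat" "HOL-Algebra.Algebra"
begin

section \<open>Local rings, depth, regularity\<close>

definition local_ring :: "('a, 'm) ring_scheme \<Rightarrow> bool" where
  "local_ring R \<longleftrightarrow> cring R \<and> noetherian_ring R \<and> (\<exists>!I. maximalideal I R)"

definition max_ideal :: "('a, 'm) ring_scheme \<Rightarrow> 'a set" where
  "max_ideal R = (THE I. maximalideal I R)"

definition regular_element :: "('a, 'm) ring_scheme \<Rightarrow> 'a \<Rightarrow> bool" where
  "regular_element R x \<longleftrightarrow>
     x \<in> carrier R \<and> (\<forall>y \<in> carrier R. x \<otimes>\<^bsub>R\<^esub> y = \<zero>\<^bsub>R\<^esub> \<longrightarrow> y = \<zero>\<^bsub>R\<^esub>)"

text \<open>
  Each entry is a nonzerodivisor modulo the ideal generated by the preceding ones. The extra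
  requirement that the quotient by the whole sequence be nonzero is automatic where this notion is
  used, namely for sequences in the maximal ideal of a local ring.
\<close>
definition regular_sequence :: "('a, 'm) ring_scheme \<Rightarrow> 'a list \<Rightarrow> bool" where
  "regular_sequence R xs \<longleftrightarrow> set xs \<subseteq> carrier R \<and>
     (\<forall>i < length xs. \<forall>y \<in> carrier R.
        (xs ! i) \<otimes>\<^bsub>R\<^esub> y \<in> Idl\<^bsub>R\<^esub> (set (take i xs)) \<longrightarrow> y \<in> Idl\<^bsub>R\<^esub> (set (take i xs)))"

definition depth :: "('a, 'm) ring_scheme \<Rightarrow> enat" where
  "depth R = Sup {enat (length xs) | xs. set xs \<subseteq> max_ideal R \<and> regular_sequence R xs}"

definition krull_dim :: "('a, 'm) ring_scheme \<Rightarrow> enat" where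
  "krull_dim R = Sup {enat n | n. \<exists>p :: nat \<Rightarrow> 'a set.
     (\<forall>i \<le> n. primeideal (p i) R) \<and> (\<forall>i < n. p i \<subset> p (Suc i))}"

definition embedding_dim :: "('a, 'm) ring_scheme \<Rightarrow> nat" where
  "embedding_dim R =
     (LEAST n. \<exists>S. finite S \<and> card S = n \<and> S \<subseteq> carrier R \<and> Idl\<^bsub>R\<^esub> S = max_ideal R)"

definition regular_local_ring :: "('a, 'm) ring_scheme \<Rightarrow> bool" where
  "regular_local_ring R \<longleftrightarrow> local_ring R \<and> krull_dim R = enat (embedding_dim R)"


section \<open>Modules\<close>

text \<open>
  Module records extend ring records, so they carry fields \<^const>\<open>monoid.mult\<close> and \<^const>\<open>monoid.one\<close> that have no
  meaning for a module; they are left undefined below and ignored by all notions.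
\<close>

definition module_Hom ::
    "('a, 'm) ring_scheme \<Rightarrow> ('a, 'b) module \<Rightarrow> ('a, 'c) module \<Rightarrow> ('b \<Rightarrow> 'c) set" where
  "module_Hom R M N = {f. f \<in> carrier M \<rightarrow> carrier N \<and>
     (\<forall>u \<in> carrier M. \<forall>v \<in> carrier M. f (u \<oplus>\<^bsub>M\<^esub> v) = f u \<oplus>\<^bsub>N\<^esub> f v) \<and>
     (\<forall>r \<in> carrier R. \<forall>u \<in> carrier M. f (r \<odot>\<^bsub>M\<^esub> u) = r \<odot>\<^bsub>N\<^esub> f u)}"

definition module_isomorphic ::
    "('a, 'm) ring_scheme \<Rightarrow> ('a, 'b) module \<Rightarrow> ('a, 'c) module \<Rightarrow> bool" where
  "module_isomorphic R M N \<longleftrightarrow> (\<exists>f \<in> module_Hom R M N. bij_betw f (carrier M) (carrier N))"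

text \<open>
  Isomorphism of a pair (ring, module over it) with another such pair: a ring isomorphism together
  with an additive bijection that is semilinear along it.
\<close>
definition ring_module_isomorphic ::
    "'a ring \<Rightarrow> ('a, 'b) module \<Rightarrow> 'c ring \<Rightarrow> ('c, 'd) module \<Rightarrow> bool" where
  "ring_module_isomorphic R M S N \<longleftrightarrow>
     (\<exists>\<phi> \<in> ring_iso R S. \<exists>\<psi>. bij_betw \<psi> (carrier M) (carrier N) \<and>
        (\<forall>u \<in> carrier M. \<forall>v \<in> carrier M. \<psi> (u \<oplus>\<^bsub>M\<^esub> v) = \<psi> u \<oplus>\<^bsub>N\<^esub> \<psi> v) \<and>
        (\<forall>r \<in> carrier R. \<forall>u \<in> carrier M. \<psi> (r \<odot>\<^bsub>M\<^esub> u) = \<phi> r \<odot>\<^bsub>N\<^esub> \<psi> u))"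

definition annihilator :: "('a, 'm) ring_scheme \<Rightarrow> ('a, 'b) module \<Rightarrow> 'a set" where
  "annihilator R M = {r \<in> carrier R. \<forall>u \<in> carrier M. r \<odot>\<^bsub>M\<^esub> u = \<zero>\<^bsub>M\<^esub>}"

text \<open>
  \<open>M/xM\<close> as a module over \<open>R/(x)\<close>, the latter being \<^term>\<open>R Quot (PIdl\<^bsub>R\<^esub> x)\<close>. As for
  \<^const>\<open>rcoset_mult\<close>, the product of a coset of scalars and a coset of vectors is written as a union
  over all representatives, all of which give the same coset.
\<close>
definition quotient_module ::
    "('a, 'm) ring_scheme \<Rightarrow> ('a, 'b) module \<Rightarrow> 'a \<Rightarrow> ('a set, 'b set) module" where
  "quotient_module R M x =
     (let N = (\<lambda>u. x \<odot>\<^bsub>M\<^esub> u) ` carrier M in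
      \<lparr>carrier = a_rcosets\<^bsub>M\<^esub> N, monoid.mult = undefined, monoid.one = undefined,
       ring.zero = N, ring.add = set_add M,
       smult = (\<lambda>A U. \<Union>a \<in> A. \<Union>u \<in> U. N +>\<^bsub>M\<^esub> (a \<odot>\<^bsub>M\<^esub> u))\<rparr>)"

text \<open>\<open>R\<close> as a module over itself, and the residue field of \<open>R\<close> as a module over \<open>R\<close>.\<close>

definition self_module :: "('a, 'm) ring_scheme \<Rightarrow> ('a, 'a) module" where
  "self_module R =
     \<lparr>carrier = carrier R, monoid.mult = undefined, monoid.one = undefined,
      ring.zero = \<zero>\<^bsub>R\<^esub>, ring.add = ring.add R, smult = monoid.mult R\<rparr>"

definition residue_module :: "('a, 'm) ring_scheme \<Rightarrow> ('a, 'a set) module" where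
  "residue_module R =
     (let k = R Quot (max_ideal R) in
      \<lparr>carrier = carrier k, monoid.mult = undefined, monoid.one = undefined,
       ring.zero = \<zero>\<^bsub>k\<^esub>, ring.add = ring.add k,
       smult = (\<lambda>r c. (max_ideal R +>\<^bsub>R\<^esub> r) \<otimes>\<^bsub>k\<^esub> c)\<rparr>)"

definition direct_sum :: "'i set \<Rightarrow> ('i \<Rightarrow> ('a, 'b) module) \<Rightarrow> ('a, 'i \<Rightarrow> 'b) module" where
  "direct_sum I M =
     \<lparr>carrier = {u \<in> (\<Pi>\<^sub>E i \<in> I. carrier (M i)). finite {i \<in> I. u i \<noteq> \<zero>\<^bsub>M i\<^esub>}},
      monoid.mult = undefined, monoid.one = undefined,
      ring.zero = (\<lambda>i \<in> I. \<zero>\<^bsub>M i\<^esub>),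
      ring.add = (\<lambda>u v. \<lambda>i \<in> I. u i \<oplus>\<^bsub>M i\<^esub> v i),
      smult = (\<lambda>r u. \<lambda>i \<in> I. r \<odot>\<^bsub>M i\<^esub> u i)\<rparr>"

definition finite_free_module :: "('a, 'm) ring_scheme \<Rightarrow> ('a, 'b) module \<Rightarrow> bool" where
  "finite_free_module R M \<longleftrightarrow> module R M \<and>
     (\<exists>n :: nat. module_isomorphic R (direct_sum {..<n} (\<lambda>_. self_module R)) M)"

text \<open>The submodule \<open>I M\<close> of finite sums of products.\<close>
definition ideal_times_module :: "'a set \<Rightarrow> ('a, 'b) module \<Rightarrow> 'b set" where
  "ideal_times_module I M =
     {(\<Oplus>\<^bsub>M\<^esub> i \<in> {..<n}. r i \<odot>\<^bsub>M\<^esub> u i) | (n :: nat) r u.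
        r \<in> {..<n} \<rightarrow> I \<and> u \<in> {..<n} \<rightarrow> carrier M}"


section \<open>Minimal free resolutions and syzygies\<close>

text \<open>
  The complex \<open>\<dots> \<rightarrow> F 1 \<rightarrow> F 0 \<rightarrow> M \<rightarrow> 0\<close>, where \<open>d 0\<close> is the augmentation \<open>F 0 \<rightarrow> M\<close> and
  \<open>d (Suc n)\<close> is the differential \<open>F (Suc n) \<rightarrow> F n\<close>.
\<close>
definition minimal_free_resolution ::
    "('a, 'm) ring_scheme \<Rightarrow> ('a, 'c) module \<Rightarrow> (nat \<Rightarrow> ('a, 'c) module) \<Rightarrow>
     (nat \<Rightarrow> 'c \<Rightarrow> 'c) \<Rightarrow> bool" where
  "minimal_free_resolution R M F d \<longleftrightarrow> module R M \<and>
     (\<forall>n. finite_free_module R (F n)) \<and>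
     d 0 \<in> module_Hom R (F 0) M \<and>
     (\<forall>n. d (Suc n) \<in> module_Hom R (F (Suc n)) (F n)) \<and>
     d 0 ` carrier (F 0) = carrier M \<and>
     d 1 ` carrier (F 1) = {u \<in> carrier (F 0). d 0 u = \<zero>\<^bsub>M\<^esub>} \<and>
     (\<forall>n. d (Suc (Suc n)) ` carrier (F (Suc (Suc n))) =
            {u \<in> carrier (F (Suc n)). d (Suc n) u = \<zero>\<^bsub>F n\<^esub>}) \<and>
     (\<forall>n. d (Suc n) ` carrier (F (Suc n)) \<subseteq> ideal_times_module (max_ideal R) (F n))"

fun syzygy :: "('a, 'c) module \<Rightarrow> (nat \<Rightarrow> ('a, 'c) module) \<Rightarrow> (nat \<Rightarrow> 'c \<Rightarrow> 'c) \<Rightarrow> nat \<Rightarrow>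
     ('a, 'c) module" where
  "syzygy M F d 0 = M"
| "syzygy M F d (Suc n) = (F n)\<lparr>carrier := d (Suc n) ` carrier (F (Suc n))\<rparr>"


section \<open>Properties of modules over local rings\<close>

text \<open>
  A property of modules over local rings is a predicate on pairs (ring, module) with carriers in
  fixed but arbitrary types. The quotients \<open>B/(x)\<close> and \<open>M/xM\<close> live in other types, so closure under
  passing to them is stated for every pair \<open>(B', M')\<close> over the given types that is isomorphic to
  \<open>(B/(x), M/xM)\<close>. Such a pair always exists: choose a representative of each coset.
\<close>
definition star_property :: "('a ring \<Rightarrow> ('a, 'b) module \<Rightarrow> bool) \<Rightarrow> bool" where
  "star_property P \<longleftrightarrow>
     (\<forall>B M. local_ring B \<and> module B M \<and> P B M \<longrightarrow>
        (\<forall>x \<in> max_ideal B. regular_element B x \<longrightarrow>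
           (\<forall>B' M'. local_ring B' \<and> module B' M' \<and>
              ring_module_isomorphic (B Quot (PIdl\<^bsub>B\<^esub> x)) (quotient_module B M x) B' M' \<longrightarrow>
              P B' M')) \<and>
        (depth B = 0 \<longrightarrow> annihilator B M = {\<zero>\<^bsub>B\<^esub>}))"

end

theory Submission
  imports Defs
begin

text \<open>
  Write \<open>\<mm>\<close> for the maximal ideal of \<open>A\<close>. Consider the ideals \<open>I = (x\<^sub>1, \<dots>, x\<^sub>t)\<close> generated by
  regular sequences in \<open>\<mm>\<close> whose terms are linearly independent modulo \<open>\<mm>\<^sup>2\<close>; by property (i), \<open>L/IL\<close>
  satisfies the property over \<open>A/I\<close> for each of them. Such an \<open>I \<noteq> \<mm>\<close> can be enlarged unless \<open>A/I\<close> has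
  a socle element \<open>s \<in> \<mm>\<close>, \<open>s \<notin> I\<close>, \<open>\<mm>s \<subseteq> I\<close>. The key point is that such an \<open>s\<close> satisfies
  \<open>s \<Omega>\<^sub>n \<subseteq> I \<Omega>\<^sub>n\<close> for every \<open>n\<close>: with \<open>\<Omega>\<^sub>n \<subseteq> \<mm>F\<^sub>n\<^sub>-\<^sub>1\<close> one gets \<open>s \<Omega>\<^sub>n \<subseteq> \<mm>\<Omega>\<^sub>n \<inter> IF\<^sub>n\<^sub>-\<^sub>1\<close>, and the
  latter is \<open>I \<Omega>\<^sub>n\<close>, which amounts to the injectivity of \<open>Tor\<^sub>n(A/I, k) \<rightarrow> Tor\<^sub>n(k, k)\<close> and has an
  elementary proof by induction on \<open>t\<close>. Hence \<open>s\<close> annihilates \<open>L/IL\<close>, and property (ii) gives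
  \<open>s \<in> I\<close>, a contradiction. So a maximal \<open>I\<close> equals \<open>\<mm>\<close>, and \<open>A\<close> is regular.
\<close>

section \<open>Ideals in commutative Noetherian rings\<close>

text \<open>Independence modulo \<mm>^2 is what makes the Tor map injective. If z in \<mm>^2 F is
  written as x u + v with v in I F, then all coordinates of u lie in \<mm>, since a unit coordinate
  would put x into I + \<mm>^2. For I generated by one regular element of \<mm>^2 the map already
  fails to be injective in degree one. So an enlarging element must avoid the non-prime ideal I +
  \<mm>^2 together with the associated primes of I. Once I = \<mm>, with t generators, primality
  passes down from \<mm> to every ideal of the tower. This gives a prime chain of length t, which is
  at least the embedding dimension, while Krull's height theorem bounds every chain by the embedding
  dimension. The obstacle that shapes the text is that A/I lives in another type, whereas the
  property is a predicate over fixed types. Therefore all homological arguments stay over A and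
  speak of I, and only the pair (A/I, L/IL) is realized, through coset representatives, on the
  original types. Localizations are avoided in the same spirit.\<close>

definition adjoin :: "('a, 'm) ring_scheme \<Rightarrow> 'a set \<Rightarrow> 'a \<Rightarrow> 'a set" where
  "adjoin R I x = {i \<oplus>\<^bsub>R\<^esub> a \<otimes>\<^bsub>R\<^esub> x | i a. i \<in> I \<and> a \<in> carrier R}"

definition colon :: "('a, 'm) ring_scheme \<Rightarrow> 'a set \<Rightarrow> 'a \<Rightarrow> 'a set" where
  "colon R I y = {r \<in> carrier R. r \<otimes>\<^bsub>R\<^esub> y \<in> I}"

context cring
begin

lemma ideal_iff:
  "ideal I R \<longleftrightarrow> I \<subseteq> carrier R \<and> \<zero> \<in> I \<and> (\<forall>a\<in>I. \<forall>b\<in>I. a \<oplus> b \<in> I) \<and>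
    (\<forall>a\<in>I. \<forall>x\<in>carrier R. x \<otimes> a \<in> I)"
proof
  assume "ideal I R"
  then interpret ideal I R .
  show "I \<subseteq> carrier R \<and> \<zero> \<in> I \<and> (\<forall>a\<in>I. \<forall>b\<in>I. a \<oplus> b \<in> I) \<and> (\<forall>a\<in>I. \<forall>x\<in>carrier R. x \<otimes> a \<in> I)"
    using a_subset I_l_closed by auto
next
  assume *: "I \<subseteq> carrier R \<and> \<zero> \<in> I \<and> (\<forall>a\<in>I. \<forall>b\<in>I. a \<oplus> b \<in> I) \<and> (\<forall>a\<in>I. \<forall>x\<in>carrier R. x \<otimes> a \<in> I)"
  have inv: "\<ominus> a \<in> I" if "a \<in> I" for a
  proof -
    have "(\<ominus> \<one>) \<otimes> a \<in> I" using * that by blast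
    moreover have "(\<ominus> \<one>) \<otimes> a = \<ominus> a" using * that by (auto simp: l_minus)
    ultimately show ?thesis by simp
  qed
  show "ideal I R"
  proof (rule idealI)
    show "subgroup I (add_monoid R)"
      using * inv by (intro add.subgroupI) auto
    show "a \<otimes> x \<in> I" if "a \<in> I" "x \<in> carrier R" for a x
      using * that m_comm[of a x] by auto
  qed (use * ring_axioms in auto)
qed

lemma idealD:
  assumes "ideal I R"
  shows "I \<subseteq> carrier R" "\<zero> \<in> I" "\<And>a b. a \<in> I \<Longrightarrow> b \<in> I \<Longrightarrow> a \<oplus> b \<in> I"
    "\<And>a x. a \<in> I \<Longrightarrow> x \<in> carrier R \<Longrightarrow> x \<otimes> a \<in> I" "\<And>a x. a \<in> I \<Longrightarrow> x \<in> carrier R \<Longrightarrow> a \<otimes> x \<in> I"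
    "\<And>a. a \<in> I \<Longrightarrow> a \<in> carrier R" "\<And>a. a \<in> I \<Longrightarrow> \<ominus> a \<in> I"
    "\<And>a b. a \<in> I \<Longrightarrow> b \<in> I \<Longrightarrow> a \<ominus> b \<in> I"
proof -
  interpret ideal I R by fact
  show "I \<subseteq> carrier R" "\<zero> \<in> I" "\<And>a b. a \<in> I \<Longrightarrow> b \<in> I \<Longrightarrow> a \<oplus> b \<in> I"
    "\<And>a x. a \<in> I \<Longrightarrow> x \<in> carrier R \<Longrightarrow> x \<otimes> a \<in> I" "\<And>a x. a \<in> I \<Longrightarrow> x \<in> carrier R \<Longrightarrow> a \<otimes> x \<in> I"
    "\<And>a. a \<in> I \<Longrightarrow> a \<in> carrier R" "\<And>a. a \<in> I \<Longrightarrow> \<ominus> a \<in> I"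
    "\<And>a b. a \<in> I \<Longrightarrow> b \<in> I \<Longrightarrow> a \<ominus> b \<in> I"
    using a_subset I_l_closed I_r_closed by (auto simp: a_minus_def)
qed

lemma genideal_empty: "Idl {} = {\<zero>}"
  using genideal_minimal[OF zeroideal, of "{}"] idealD(2)[OF genideal_ideal[of "{}"]] by auto

lemma ideal_add_cancel:
  assumes "ideal I R" "a \<in> carrier R" "i \<in> I" "i \<oplus> a \<in> I \<or> a \<oplus> i \<in> I"
  shows "a \<in> I"
proof -
  note I = idealD[OF assms(1)]
  have ic: "i \<in> carrier R" using I(6) assms by blast
  have "(i \<oplus> a) \<ominus> i = a" "(a \<oplus> i) \<ominus> i = a"
    using ic assms(2) by algebra+
  then show ?thesis using I(8)[of "i \<oplus> a" i] I(8)[of "a \<oplus> i" i] assms by metis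
qed

lemma adjoin_ideal:
  assumes "ideal I R" "x \<in> carrier R"
  shows "ideal (adjoin R I x) R"
proof -
  note I = idealD[OF assms(1)]
  have "i \<oplus> a \<otimes> x \<oplus> (j \<oplus> b \<otimes> x) \<in> adjoin R I x"
    if "i \<in> I" "j \<in> I" "a \<in> carrier R" "b \<in> carrier R" for i j a b
  proof -
    have "i \<oplus> a \<otimes> x \<oplus> (j \<oplus> b \<otimes> x) = (i \<oplus> j) \<oplus> (a \<oplus> b) \<otimes> x"
      using that I(6) assms(2) by algebra
    then show ?thesis unfolding adjoin_def using that I(3) by blast
  qed
  moreover have "y \<otimes> (i \<oplus> a \<otimes> x) \<in> adjoin R I x"
    if "i \<in> I" "a \<in> carrier R" "y \<in> carrier R" for i a y
  proof -
    have "y \<otimes> (i \<oplus> a \<otimes> x) = y \<otimes> i \<oplus> (y \<otimes> a) \<otimes> x"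
      using that I(6) assms(2) by algebra
    then show ?thesis unfolding adjoin_def using that I(4) by blast
  qed
  moreover have "\<zero> \<oplus> \<zero> \<otimes> x \<in> adjoin R I x"
    unfolding adjoin_def using I(2) by blast
  ultimately show ?thesis
    using I(6) assms(2) unfolding ideal_iff by (auto simp: adjoin_def)
qed

lemma adjoin_superset:
  assumes "ideal I R" "x \<in> carrier R"
  shows "I \<subseteq> adjoin R I x" "x \<in> adjoin R I x"
proof -
  note I = idealD[OF assms(1)]
  show "I \<subseteq> adjoin R I x"
  proof
    fix i assume "i \<in> I"
    moreover have "i = i \<oplus> \<zero> \<otimes> x" using I(6) \<open>i \<in> I\<close> assms(2) by simp
    ultimately show "i \<in> adjoin R I x" unfolding adjoin_def by blast
  qed
  have "x = \<zero> \<oplus> \<one> \<otimes> x" using assms(2) by simp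
  then show "x \<in> adjoin R I x" unfolding adjoin_def using I(2) by blast
qed

lemma adjoin_minimal:
  assumes "ideal J R" "I \<subseteq> J" "x \<in> J"
  shows "adjoin R I x \<subseteq> J"
  using assms idealD[OF assms(1)] unfolding adjoin_def by blast

lemma colon_ideal:
  assumes "ideal I R" "y \<in> carrier R"
  shows "ideal (colon R I y) R"
  using idealD[OF assms(1)] assms(2) unfolding ideal_iff colon_def
  by (auto simp: l_distr m_assoc)

lemma colon_superset:
  assumes "ideal I R" "y \<in> carrier R"
  shows "I \<subseteq> colon R I y"
  using idealD[OF assms(1)] assms(2) unfolding colon_def by auto

lemma colon_mono_mult:
  assumes "ideal I R" "y \<in> carrier R" "b \<in> carrier R"
  shows "colon R I y \<subseteq> colon R I (b \<otimes> y)"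
proof -
  have "r \<otimes> (b \<otimes> y) = b \<otimes> (r \<otimes> y)" if "r \<in> carrier R" for r
    using that assms by algebra
  then show ?thesis unfolding colon_def using idealD(4)[OF assms(1)] assms(3) by auto
qed

text \<open>If \<open>a \<otimes> b\<close> kills \<open>y\<close> modulo \<open>I\<close> and
  \<open>b\<close> does not, then \<open>b \<otimes> y\<close> competes with \<open>y\<close>: its
  colon ideal is at least as large, hence equal, and it contains \<open>a\<close>. These maximal
  colons play the part of the associated primes of \<open>R/I\<close>.\<close>

lemma colon_maximal_prime:
  assumes "ideal I R" "y \<in> carrier R" "y \<notin> I"
    and max: "\<And>z. z \<in> carrier R \<Longrightarrow> z \<notin> I \<Longrightarrow> colon R I y \<subseteq> colon R I z \<Longrightarrow> colon R I z = colon R I y"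
  shows "primeideal (colon R I y) R"
proof (rule primeidealI)
  show "ideal (colon R I y) R" using assms colon_ideal by blast
  show "carrier R \<noteq> colon R I y"
  proof
    assume "carrier R = colon R I y"
    then have "\<one> \<in> colon R I y" by auto
    then show False using assms by (simp add: colon_def)
  qed
  fix a b assume ab: "a \<in> carrier R" "b \<in> carrier R" "a \<otimes> b \<in> colon R I y"
  show "a \<in> colon R I y \<or> b \<in> colon R I y"
  proof (cases "b \<in> colon R I y")
    case False
    then have "b \<otimes> y \<notin> I" using ab by (auto simp: colon_def)
    then have "colon R I (b \<otimes> y) = colon R I y"
      using max[of "b \<otimes> y"] colon_mono_mult assms ab by auto
    moreover have "a \<in> colon R I (b \<otimes> y)"
      using ab assms by (auto simp: colon_def m_assoc)
    ultimately show ?thesis by simp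
  qed simp
qed (rule is_cring)

lemma primeD:
  assumes "primeideal P R"
  shows "ideal P R" "carrier R \<noteq> P" "\<one> \<notin> P"
    "\<And>a b. a \<in> carrier R \<Longrightarrow> b \<in> carrier R \<Longrightarrow> a \<otimes> b \<in> P \<Longrightarrow> a \<in> P \<or> b \<in> P"
proof -
  interpret primeideal P R by fact
  show "ideal P R" "carrier R \<noteq> P" 
    "\<And>a b. a \<in> carrier R \<Longrightarrow> b \<in> carrier R \<Longrightarrow> a \<otimes> b \<in> P \<Longrightarrow> a \<in> P \<or> b \<in> P"
    using I_notcarr I_prime is_ideal by auto
  show "\<one> \<notin> P" using one_imp_carrier I_notcarr by auto
qed

text \<open>One factor outside \<open>P\<close> is taken from each \<open>J y\<close>; the product
  lies in all of them and stays outside \<open>P\<close> by primality.\<close>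

lemma prime_common_element:
  assumes "primeideal P R" "finite Y" "\<And>y. y \<in> Y \<Longrightarrow> ideal (J y) R" "\<And>y. y \<in> Y \<Longrightarrow> \<not> J y \<subseteq> P"
  shows "\<exists>w \<in> carrier R - P. \<forall>y\<in>Y. w \<in> J y"
  using assms(2-4)
proof (induction Y)
  case empty
  then show ?case using primeD[OF assms(1)] by auto
next
  case (insert y Y)
  then obtain w where w: "w \<in> carrier R - P" "\<forall>y\<in>Y. w \<in> J y" by auto
  have "\<not> J y \<subseteq> P" using insert(5) by simp
  then obtain v where v: "v \<in> J y" "v \<notin> P" by blast
  have vc: "v \<in> carrier R" using idealD(6) insert v by blast
  have "v \<otimes> w \<in> carrier R - P" using primeD(4)[OF assms(1)] w v vc by auto
  moreover have "v \<otimes> w \<in> J z" if "z \<in> insert y Y" for z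
    using that w v vc insert idealD(4,5) by (cases "z = y") auto
  ultimately show ?case by blast
qed

text \<open>Besides the primes, the proper subideal \<open>J\<close> of \<open>M\<close> is avoided,
  although it need not be prime. This works because no member of \<open>\<P>\<close> contains
  \<open>J\<close>: the correcting summands can be taken from \<open>J\<close> itself and leave the
  class modulo \<open>J\<close> unchanged.\<close>

lemma prime_avoidance:
  assumes "ideal J R" "ideal M R" "J \<subseteq> M" "J \<noteq> M" "finite \<P>"
    and "\<And>P. P \<in> \<P> \<Longrightarrow> primeideal P R" "\<And>P. P \<in> \<P> \<Longrightarrow> \<not> J \<subseteq> P"
    and "\<And>P Q. P \<in> \<P> \<Longrightarrow> Q \<in> \<P> \<Longrightarrow> P \<subseteq> Q \<Longrightarrow> P = Q"
  shows "\<exists>x \<in> M - J. \<forall>P\<in>\<P>. x \<notin> P"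
  using assms(5-8)
proof (induction \<P>)
  case empty
  then show ?case using assms by auto
next
  case (insert P \<P>)
  obtain x where x: "x \<in> M - J" "\<forall>P\<in>\<P>. x \<notin> P" using insert by auto
  show ?case
  proof (cases "x \<in> P")
    case False
    then show ?thesis using x by auto
  next
    case True
    have P: "primeideal P R" using insert by auto
    have "\<exists>w \<in> carrier R - P. \<forall>Q\<in>\<P>. w \<in> Q"
    proof (rule prime_common_element[OF P])
      show "ideal Q R" if "Q \<in> \<P>" for Q using insert primeD(1) that by auto
      show "\<not> Q \<subseteq> P" if "Q \<in> \<P>" for Q using insert(2,6) that by auto
    qed (rule insert(1))
    then obtain w where w: "w \<in> carrier R" "w \<notin> P" "\<forall>Q\<in>\<P>. w \<in> Q" by auto
    \<comment> \<open>Now \<open>x\<close> lies in \<open>P\<close>. The summand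
      \<open>v \<otimes> w\<close> lies in \<open>J\<close> and in every other prime but not in
      \<open>P\<close>, so adding it moves \<open>x\<close> out of \<open>P\<close> and disturbs no
      other non-membership.\<close>
    have "\<not> J \<subseteq> P" using insert(5) by simp
    then obtain v where v: "v \<in> J" "v \<notin> P" by blast
    have vc: "v \<in> carrier R" using v idealD(6)[OF assms(1)] by auto
    have vw: "v \<otimes> w \<in> J" "v \<otimes> w \<in> M" using v w idealD(5)[OF assms(1)] assms(3) by auto
    have xc: "x \<in> carrier R" using x idealD(6)[OF assms(2)] by auto
    have "x \<oplus> v \<otimes> w \<in> M" using idealD(3)[OF assms(2)] x vw by auto
    moreover have "x \<oplus> v \<otimes> w \<notin> J" 
      using ideal_add_cancel[OF assms(1) xc vw(1)] x by auto
    moreover have "x \<oplus> v \<otimes> w \<notin> P"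
      using ideal_add_cancel[OF primeD(1)[OF P] _ True, of "v \<otimes> w"] primeD(4)[OF P vc w(1)] w v vc by auto
    moreover have "x \<oplus> v \<otimes> w \<notin> Q" if "Q \<in> \<P>" for Q
    proof -
      have Q: "ideal Q R" using insert primeD(1) that by auto
      then have "v \<otimes> w \<in> Q" using w vc that idealD(4) by auto
      then show ?thesis using ideal_add_cancel[OF Q xc] x that by auto
    qed
    ultimately show ?thesis by blast
  qed
qed

end

section \<open>Associated primes of \<open>R/I\<close> as maximal colon ideals\<close>

locale noetherian_cring = cring R + noetherian_ring R for R (structure)
begin

text \<open>Noetherian inductions are run through this form: the union of a nonempty chain of ideals
  belongs to the chain, which is the upper bound that Zorn's lemma asks for.\<close>

lemma ideal_maximal_element:
  assumes "Fam \<noteq> {}" "\<And>I. I \<in> Fam \<Longrightarrow> ideal I R"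
  shows "\<exists>M\<in>Fam. \<forall>Z\<in>Fam. M \<subseteq> Z \<longrightarrow> Z = M"
proof (rule subset_Zorn)
    fix C assume C: "subset.chain Fam C"
    show "\<exists>U\<in>Fam. \<forall>Z\<in>C. Z \<subseteq> U"
    proof (cases "C = {}")
      case True
      then show ?thesis using assms by auto
    next
      case False
      have "subset.chain {I. ideal I R} C"
        using C assms(2) unfolding pred_on.chain_def by auto
      then have "\<Union>C \<in> C" by (rule ideal_chain_is_trivial[OF False])
      moreover have "C \<subseteq> Fam" using C unfolding pred_on.chain_def by auto
      ultimately show ?thesis by (intro bexI[of _ "\<Union>C"]) auto
    qed
  qed

text \<open>A witness \<open>y\<close> of a zerodivisor modulo \<open>I\<close> can thus be traded
  for one whose colon is an associated prime, so an element that avoids these primes is regular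
  modulo \<open>I\<close>.\<close>

lemma exists_colon_maximal:
  assumes "ideal I R" "y \<in> carrier R" "y \<notin> I"
  obtains z where "z \<in> carrier R" "z \<notin> I" "colon R I y \<subseteq> colon R I z"
    "\<And>w. w \<in> carrier R \<Longrightarrow> w \<notin> I \<Longrightarrow> colon R I z \<subseteq> colon R I w \<Longrightarrow> colon R I w = colon R I z"
proof -
  define S where "S = colon R I ` {z. z \<in> carrier R \<and> z \<notin> I \<and> colon R I y \<subseteq> colon R I z}"
  have "colon R I y \<in> S" using assms unfolding S_def by blast
  moreover have "ideal J R" if "J \<in> S" for J using that assms colon_ideal unfolding S_def by blast
  ultimately have "\<exists>M\<in>S. \<forall>Z\<in>S. M \<subseteq> Z \<longrightarrow> Z = M"
    by (intro ideal_maximal_element) auto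
  then obtain M where M: "M \<in> S" "\<And>J. J \<in> S \<Longrightarrow> M \<subseteq> J \<Longrightarrow> J = M"
    by blast
  then obtain z where z: "z \<in> carrier R" "z \<notin> I" "colon R I y \<subseteq> colon R I z" "M = colon R I z" unfolding S_def by blast
  show ?thesis
  proof (rule that[OF z(1-3)])
    fix w assume w: "w \<in> carrier R" "w \<notin> I" "colon R I z \<subseteq> colon R I w"
    then have "colon R I w \<in> S" using z unfolding S_def by blast
    then show "colon R I w = colon R I z" using M(2)[of "colon R I w"] w z by blast
  qed
qed

text \<open>The generators must come from \<open>Y\<close> itself, not merely from the ideal it
  generates. A maximal ideal among those generated by finite subsets of \<open>Y\<close> absorbs
  every further element of \<open>Y\<close>.\<close>

lemma finite_generating_subset:
  assumes "Y \<subseteq> carrier R"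
  obtains Y0 where "finite Y0" "Y0 \<subseteq> Y" "Idl Y0 = Idl Y"
proof -
  define S where "S = genideal R ` {T. finite T \<and> T \<subseteq> Y}"
  have "Idl {} \<in> S" unfolding S_def by (intro imageI) auto
  moreover have "ideal J R" if "J \<in> S" for J using that assms genideal_ideal unfolding S_def by auto
  ultimately have "\<exists>M\<in>S. \<forall>Z\<in>S. M \<subseteq> Z \<longrightarrow> Z = M"
    by (intro ideal_maximal_element) auto
  then obtain M where M: "M \<in> S" "\<And>J. J \<in> S \<Longrightarrow> M \<subseteq> J \<Longrightarrow> J = M"
    by blast
  then obtain Y0 where Y0: "finite Y0" "Y0 \<subseteq> Y" "M = Idl Y0" unfolding S_def by blast
  have "y \<in> M" if "y \<in> Y" for y
  proof -
    have "Idl (insert y Y0) \<in> S"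
      unfolding S_def using Y0 that by (intro imageI CollectI conjI) auto
    moreover have c: "insert y Y0 \<subseteq> carrier R" using Y0 that assms by auto
    then have "M \<subseteq> Idl (insert y Y0)" using Y0 subset_Idl_subset[of "insert y Y0" Y0] by auto
    ultimately have "Idl (insert y Y0) = M" using M(2) by auto
    then show ?thesis using genideal_self[OF c] by auto
  qed
  then have "Idl Y \<subseteq> M" using genideal_minimal[of M Y] Y0 genideal_ideal[of Y0] assms by auto
  moreover have "Idl Y0 \<subseteq> Idl Y" using subset_Idl_subset[of Y Y0] Y0 assms by auto
  ultimately show ?thesis using Y0 by (intro that[of Y0]) auto
qed

text \<open>
  If \<open>Y0\<close> generates the same ideal as \<open>Y\<close>, then \<open>\<Inter>y\<in>Y0. (I : y)\<close> annihilates \<open>Y\<close> modulo \<open>I\<close>, so every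
  \<open>(I : y)\<close> contains, hence equals, one of the \<open>(I : y)\<close> with \<open>y \<in> Y0\<close>.
\<close>

lemma finite_maximal_colons:
  assumes "ideal I R"
  defines "Y \<equiv> {y \<in> carrier R - I. \<forall>z \<in> carrier R - I. colon R I y \<subseteq> colon R I z \<longrightarrow> colon R I z = colon R I y}"
  shows "finite (colon R I ` Y)"
proof -
  have Yc: "Y \<subseteq> carrier R" unfolding Y_def by auto
  obtain Y0 where Y0: "finite Y0" "Y0 \<subseteq> Y" "Idl Y0 = Idl Y" using finite_generating_subset[OF Yc] .
  have "colon R I y \<in> colon R I ` Y0" if y: "y \<in> Y" for y
  proof (rule ccontr)
    assume neg: "colon R I y \<notin> colon R I ` Y0"
    have P: "primeideal (colon R I y) R" 
      by (rule colon_maximal_prime[OF assms(1)]) (use y Y_def in auto)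
    have "\<exists>w \<in> carrier R - colon R I y. \<forall>z\<in>Y0. w \<in> colon R I z"
    proof (rule prime_common_element[OF P Y0(1)])
      show "ideal (colon R I z) R" if "z \<in> Y0" for z using colon_ideal assms Y0 Yc that by auto
      show "\<not> colon R I z \<subseteq> colon R I y" if "z \<in> Y0" for z
      proof
        assume "colon R I z \<subseteq> colon R I y"
        then have "colon R I y = colon R I z" using that Y0 y unfolding Y_def by blast
        then show False using neg that by auto
      qed
    qed
    then obtain w where w: "w \<in> carrier R" "w \<notin> colon R I y" "\<forall>z\<in>Y0. w \<in> colon R I z" by auto
    have "Idl Y0 \<subseteq> colon R I w"
    proof (rule genideal_minimal)
      show "ideal (colon R I w) R" using colon_ideal assms w by auto
      show "Y0 \<subseteq> colon R I w"
      proof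
        fix z assume "z \<in> Y0"
        then have "z \<in> carrier R" "w \<otimes> z \<in> I" using w Y0 Yc by (auto simp: colon_def)
        then show "z \<in> colon R I w" using w m_comm[of w z] by (simp add: colon_def)
      qed
    qed
    then have "y \<in> colon R I w" using genideal_self[OF Yc] Y0(3) y by auto
    then have "w \<otimes> y \<in> I" using w m_comm[of w y] by (simp add: colon_def)
    then show False using w by (simp add: colon_def)
  qed
  then have "colon R I ` Y \<subseteq> colon R I ` Y0" by auto
  then show ?thesis by (rule finite_subset) (use Y0(1) in auto)
qed

end

section \<open>Krull's principal ideal theorem\<close>

text \<open>The contraction to \<open>R\<close> of the extension of \<open>I\<close> to the
  localization at \<open>q\<close>.\<close>

definition sat :: "('a, 'm) ring_scheme \<Rightarrow> 'a set \<Rightarrow> 'a set \<Rightarrow> 'a set" where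
  "sat R q I = {z \<in> carrier R. \<exists>u \<in> carrier R - q. u \<otimes>\<^bsub>R\<^esub> z \<in> I}"

definition prime_chain :: "('a, 'm) ring_scheme \<Rightarrow> nat \<Rightarrow> (nat \<Rightarrow> 'a set) \<Rightarrow> bool" where
  "prime_chain R n p \<longleftrightarrow> (\<forall>i \<le> n. primeideal (p i) R) \<and> (\<forall>i < n. p i \<subset> p (Suc i))"

context cring
begin

lemma satI: "z \<in> carrier R \<Longrightarrow> u \<in> carrier R \<Longrightarrow> u \<notin> q \<Longrightarrow> u \<otimes> z \<in> I \<Longrightarrow> z \<in> sat R q I"
  by (auto simp: sat_def)

lemma sat_superset:
  assumes "primeideal q R" "ideal I R"
  shows "I \<subseteq> sat R q I"
proof
  fix z assume "z \<in> I"
  then show "z \<in> sat R q I"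
    using idealD(6)[OF assms(2)] primeD(3)[OF assms(1)] by (intro satI[of z \<one>]) auto
qed

lemma set_add_superset:
  assumes "ideal I R" "ideal J R"
  shows "I \<subseteq> set_add R I J" "J \<subseteq> set_add R I J"
proof -
  show "I \<subseteq> set_add R I J"
  proof
    fix z assume z: "z \<in> I"
    then have "z = z \<oplus> \<zero>" using idealD(6)[OF assms(1)] by auto
    then show "z \<in> set_add R I J" using z idealD(2)[OF assms(2)] unfolding set_add_def' by blast
  qed
  show "J \<subseteq> set_add R I J"
  proof
    fix z assume z: "z \<in> J"
    then have "z = \<zero> \<oplus> z" using idealD(6)[OF assms(2)] by auto
    then show "z \<in> set_add R I J" using z idealD(2)[OF assms(1)] unfolding set_add_def' by blast
  qed
qed

lemma sat_mono: "I \<subseteq> J \<Longrightarrow> sat R q I \<subseteq> sat R q J"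
  by (auto simp: sat_def)

lemma prime_mult_notin:
  assumes "primeideal q R" "u \<in> carrier R - q" "v \<in> carrier R - q"
  shows "u \<otimes> v \<in> carrier R - q"
  using primeD(4)[OF assms(1)] assms(2,3) by auto

text \<open>Elements outside \<open>q\<close> are also outside \<open>p\<close>, so the two
  denominators can be merged into one; the case \<open>p = q\<close> is idempotence.\<close>

lemma sat_sat:
  assumes "primeideal p R" "ideal I R" "p \<subseteq> q"
  shows "sat R q (sat R p I) \<subseteq> sat R p I"
proof
  fix z assume "z \<in> sat R q (sat R p I)"
  then obtain u v where uv: "z \<in> carrier R" "u \<in> carrier R - q" "v \<in> carrier R - p" "v \<otimes> (u \<otimes> z) \<in> I"
    by (auto simp: sat_def)
  then have "v \<otimes> u \<in> carrier R - p" using prime_mult_notin assms by auto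
  moreover have "v \<otimes> u \<otimes> z \<in> I" using uv by (auto simp: m_assoc)
  ultimately show "z \<in> sat R p I" using uv by (auto simp: sat_def)
qed

lemma sat_ideal:
  assumes "primeideal q R" "ideal I R"
  shows "ideal (sat R q I) R"
proof -
  note I = idealD[OF assms(2)]
  have "a \<oplus> b \<in> sat R q I" if ab: "a \<in> sat R q I" "b \<in> sat R q I" for a b
  proof -
    obtain u v where uv: "u \<in> carrier R - q" "u \<otimes> a \<in> I" "v \<in> carrier R - q" "v \<otimes> b \<in> I"
      and c: "a \<in> carrier R" "b \<in> carrier R"
      using ab by (auto simp: sat_def)
    then have uc: "u \<in> carrier R" "v \<in> carrier R" by auto
    have "u \<otimes> v \<otimes> (a \<oplus> b) = v \<otimes> (u \<otimes> a) \<oplus> u \<otimes> (v \<otimes> b)"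
      using uc c by algebra
    moreover have "\<dots> \<in> I" using I uv by auto
    ultimately show ?thesis using prime_mult_notin[OF assms(1), of u v] uv c
      by (intro satI[of _ "u \<otimes> v"]) auto
  qed
  moreover have "x \<otimes> a \<in> sat R q I" if ax: "a \<in> sat R q I" "x \<in> carrier R" for a x
  proof -
    obtain u where u: "u \<in> carrier R - q" "u \<otimes> a \<in> I" "a \<in> carrier R"
      using ax by (auto simp: sat_def)
    then have "u \<otimes> (x \<otimes> a) = x \<otimes> (u \<otimes> a)" using ax(2) m_lcomm[of u x a] by simp
    then show ?thesis using u ax I by (intro satI[of _ u]) auto
  qed
  ultimately show ?thesis
    unfolding ideal_iff using sat_superset[OF assms] I by (auto simp: sat_def)
qed

lemma prime_pow_notin:
  assumes "primeideal p R" "y \<in> carrier R" "y \<notin> p"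
  shows "y [^] (n::nat) \<notin> p"
proof (induction n)
  case (Suc n)
  then show ?case using primeD(4)[OF assms(1) nat_pow_closed assms(2)] assms(2,3) by auto
qed (use primeD(3)[OF assms(1)] in simp)

lemma prime_chain_mono:
  assumes "prime_chain R n p" "i \<le> j" "j \<le> n"
  shows "p i \<subseteq> p j"
  using assms(2,3)
proof (induction j)
  case (Suc j)
  then show ?case using assms(1) unfolding prime_chain_def
    by (cases "i = Suc j") (auto dest!: spec[of _ j])
qed simp

end

context noetherian_cring
begin

text \<open>
  Ideals \<open>I\<close> with \<open>sat R q I \<subseteq> I\<close> stand in for the ideals of the localization at \<open>q\<close>.
\<close>

lemma saturated_nakayama:
  assumes q: "primeideal q R" and W: "ideal W R" and I: "ideal I R" "I \<subseteq> W" "sat R q I \<subseteq> I"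
    and gen: "\<And>z. z \<in> W \<Longrightarrow> \<exists>u \<in> carrier R - q. \<exists>i \<in> I. \<exists>p \<in> q \<cdot> W. u \<otimes> z = i \<oplus> p"
  shows "W \<subseteq> I"
proof (rule ccontr)
  assume "\<not> W \<subseteq> I"
  \<comment> \<open>A maximal member \<open>M\<close> leaves \<open>W\<close> cyclic over
    \<open>M\<close> after localization at \<open>q\<close>: any \<open>z\<close> in
    \<open>W\<close> outside \<open>M\<close> generates. Then every element of
    \<open>q \<cdot> W\<close> is, locally, an element of \<open>M\<close> plus a
    \<open>q\<close>-multiple of \<open>z\<close>, and no determinant enters.\<close>
  define S where "S = {V. ideal V R \<and> I \<subseteq> V \<and> V \<subseteq> W \<and> V \<noteq> W \<and> sat R q V \<inter> W \<subseteq> V}"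
  have "I \<in> S" using I \<open>\<not> W \<subseteq> I\<close> by (auto simp: S_def)
  then have "\<exists>M\<in>S. \<forall>Z\<in>S. M \<subseteq> Z \<longrightarrow> Z = M"
    by (intro ideal_maximal_element) (auto simp: S_def)
  then obtain M where M: "M \<in> S" "\<And>Z. Z \<in> S \<Longrightarrow> M \<subseteq> Z \<Longrightarrow> Z = M" by blast
  then have Mi: "ideal M R" and IM: "I \<subseteq> M" and MW: "M \<subseteq> W" "M \<noteq> W" and Ms: "sat R q M \<inter> W \<subseteq> M"
    by (auto simp: S_def)
  then obtain z where z: "z \<in> W" "z \<notin> M" by auto
  have zc: "z \<in> carrier R" using z idealD(6)[OF W] by auto
  define V where "V = sat R q (adjoin R M z) \<inter> W"
  have Ai: "ideal (adjoin R M z) R" using adjoin_ideal Mi zc by auto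
  have Vi: "ideal V R" unfolding V_def using i_intersect sat_ideal[OF q Ai] W by auto
  have MV: "M \<subseteq> V" and zV: "z \<in> V" 
    using sat_superset[OF q Ai] adjoin_superset[OF Mi zc] MW z unfolding V_def by auto
  have "sat R q V \<subseteq> sat R q (adjoin R M z)"
    using sat_mono[of V] sat_sat[OF q Ai, of q] unfolding V_def by auto
  then have Vs: "sat R q V \<inter> W \<subseteq> V" unfolding V_def by auto
  have VW: "V = W"
  proof (rule ccontr)
    assume "V \<noteq> W"
    then have "V \<in> S" using Vi IM MV Vs unfolding S_def V_def by auto
    then show False using M(2)[OF _ MV] z zV by auto
  qed
  note Mr = idealD[OF Mi] and qr = idealD[OF primeD(1)[OF q]] and Wr = idealD[OF W]
  have prod: "\<exists>u \<in> carrier R - q. \<exists>w \<in> M. \<exists>c \<in> q. u \<otimes> p = w \<oplus> c \<otimes> z" if "p \<in> q \<cdot> W" for p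
    using that
  proof induction
    case (prod a b)
    then have "b \<in> V" using VW by simp
    then obtain u w c where u: "u \<in> carrier R - q" "w \<in> M" "c \<in> carrier R" "u \<otimes> b = w \<oplus> c \<otimes> z"
      unfolding V_def sat_def adjoin_def by auto
    have c: "a \<in> carrier R" "b \<in> carrier R" "w \<in> carrier R" using prod qr(6) Wr(6) Mr(6) u by auto
    have uc: "u \<in> carrier R" using u(1) by auto
    have "u \<otimes> (a \<otimes> b) = a \<otimes> (u \<otimes> b)" using uc c by algebra
    also have "\<dots> = a \<otimes> w \<oplus> (a \<otimes> c) \<otimes> z" unfolding u(4) using u(3) c zc by algebra
    finally show ?case using u(1) Mr(4)[OF u(2) c(1)] qr(5)[OF prod(1) u(3)] by auto
  next
    case (sum s t)
    then obtain u w c u' w' c' where u: "u \<in> carrier R - q" "w \<in> M" "c \<in> q" "u \<otimes> s = w \<oplus> c \<otimes> z"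
      and u': "u' \<in> carrier R - q" "w' \<in> M" "c' \<in> q" "u' \<otimes> t = w' \<oplus> c' \<otimes> z" by blast
    have st: "s \<in> carrier R" "t \<in> carrier R" using sum ideal_prod_in_carrier[OF primeD(1)[OF q] W] by auto
    have c: "w \<in> carrier R" "w' \<in> carrier R" "c \<in> carrier R" "c' \<in> carrier R" "u \<in> carrier R" "u' \<in> carrier R"
      using u u' Mr(6) qr(6) by auto
    have "u \<otimes> u' \<otimes> (s \<oplus> t) = u' \<otimes> (u \<otimes> s) \<oplus> u \<otimes> (u' \<otimes> t)" using c st by algebra
    also have "\<dots> = (u' \<otimes> w \<oplus> u \<otimes> w') \<oplus> (u' \<otimes> c \<oplus> u \<otimes> c') \<otimes> z"
      unfolding u(4) u'(4) using c zc by algebra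
    finally have "u \<otimes> u' \<otimes> (s \<oplus> t) = (u' \<otimes> w \<oplus> u \<otimes> w') \<oplus> (u' \<otimes> c \<oplus> u \<otimes> c') \<otimes> z" .
    moreover have "u' \<otimes> w \<oplus> u \<otimes> w' \<in> M" "u' \<otimes> c \<oplus> u \<otimes> c' \<in> q" using u u' c Mr qr by auto
    moreover have "u \<otimes> u' \<in> carrier R - q" using prime_mult_notin[OF q] u u' by auto
    ultimately show ?case by blast
  qed
  obtain u i p where u: "u \<in> carrier R - q" "i \<in> I" "p \<in> q \<cdot> W" "u \<otimes> z = i \<oplus> p" using gen[OF z(1)] by blast
  obtain v w c where v: "v \<in> carrier R - q" "w \<in> M" "c \<in> q" "v \<otimes> p = w \<oplus> c \<otimes> z" using prod[OF u(3)] by blast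
  have c: "i \<in> carrier R" "p \<in> carrier R" "w \<in> carrier R" "c \<in> carrier R" "u \<in> carrier R" "v \<in> carrier R"
    using u v Mr(6) qr(6) idealD(6)[OF I(1)] ideal_prod_in_carrier[OF primeD(1)[OF q] W] by auto
  \<comment> \<open>The coefficient becomes a unit after localization: \<open>v \<otimes> u\<close>
    is outside \<open>q\<close> and \<open>c\<close> inside. Hence \<open>z\<close> lies in the
    saturation of \<open>M\<close>, against its choice.\<close>
  have "(v \<otimes> u \<ominus> c) \<otimes> z = v \<otimes> (u \<otimes> z) \<ominus> c \<otimes> z" using c zc by algebra
  also have "\<dots> = v \<otimes> i \<oplus> v \<otimes> p \<ominus> c \<otimes> z" unfolding u(4) using c zc by algebra
  also have "\<dots> = v \<otimes> i \<oplus> w" unfolding v(4) using c zc by algebra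
  finally have "(v \<otimes> u \<ominus> c) \<otimes> z \<in> M" using u(2) IM Mr v(2) c by auto
  moreover have "v \<otimes> u \<ominus> c \<notin> q"
  proof
    assume "v \<otimes> u \<ominus> c \<in> q"
    then have "v \<otimes> u \<ominus> c \<oplus> c \<in> q" using qr v by auto
    moreover have "v \<otimes> u \<ominus> c \<oplus> c = v \<otimes> u" using c by algebra
    ultimately show False using prime_mult_notin[OF q v(1) u(1)] by auto
  qed
  ultimately have "z \<in> sat R q M" using c zc by (intro satI[of z "v \<otimes> u \<ominus> c"]) auto
  then show False using Ms z by auto
qed

text \<open>
  The localization of \<open>R/I0\<close> at \<open>q\<close> is Artinian. Noetherian induction: if \<open>J\<close> is maximal among the
  saturated ideals for which the chain condition fails, a maximal annihilator \<open>(J : s)\<close> is a prime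
  between \<open>I0\<close> and \<open>q\<close>, so \<open>s\<close> spans a simple module modulo \<open>J\<close>.
\<close>

lemma saturated_dcc:
  assumes q: "primeideal q R" and min: "\<And>p. primeideal p R \<Longrightarrow> I0 \<subseteq> p \<Longrightarrow> p \<subseteq> q \<Longrightarrow> p = q"
    and C: "\<And>n::nat. ideal (C n) R" "\<And>n. sat R q (C n) \<subseteq> C n" "\<And>n. I0 \<subseteq> C n" "\<And>n. C (Suc n) \<subseteq> C n"
    and J0: "ideal J0 R" "sat R q J0 \<subseteq> J0" "I0 \<subseteq> J0" "\<And>n. J0 \<subseteq> C n"
  shows "\<exists>N. \<forall>n\<ge>N. C n = C N"
proof -
  define seqs where "seqs J = {C :: nat \<Rightarrow> 'a set. \<forall>n. ideal (C n) R \<and> sat R q (C n) \<subseteq> C n \<and> J \<subseteq> C n \<and> C (Suc n) \<subseteq> C n}" for J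
  define dcc where "dcc J \<longleftrightarrow> (\<forall>C \<in> seqs J. \<exists>N. \<forall>n\<ge>N. C n = C N)" for J
  have "dcc J0"
  proof (rule ccontr)
    assume nd: "\<not> dcc J0"
    define S where "S = {J. ideal J R \<and> sat R q J \<subseteq> J \<and> I0 \<subseteq> J \<and> \<not> dcc J}"
    have "J0 \<in> S" using J0 nd by (auto simp: S_def)
    then have "\<exists>M\<in>S. \<forall>Z\<in>S. M \<subseteq> Z \<longrightarrow> Z = M"
      by (intro ideal_maximal_element) (auto simp: S_def)
    then obtain J where J: "J \<in> S" "\<And>Z. Z \<in> S \<Longrightarrow> J \<subseteq> Z \<Longrightarrow> Z = J" by blast
    then have Ji: "ideal J R" and Js: "sat R q J \<subseteq> J" and IJ: "I0 \<subseteq> J" and Jd: "\<not> dcc J" by (auto simp: S_def)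
    obtain C where C: "C \<in> seqs J" and Cn: "\<not> (\<exists>N. \<forall>n\<ge>N. C n = C N)" using Jd unfolding dcc_def by blast
    have Ci: "ideal (C n) R" and Cs: "sat R q (C n) \<subseteq> C n" and JC: "J \<subseteq> C n" and Cd: "C (Suc n) \<subseteq> C n" for n
      using C unfolding seqs_def by auto
    have Cmono: "C n \<subseteq> C k" if "k \<le> n" for k n using lift_Suc_antimono_le[of C k n] Cd that by auto
    have "\<one> \<notin> J"
    proof
      assume "\<one> \<in> J"
      then have "carrier R \<subseteq> J" using idealD(5)[OF Ji, of \<one>] by auto
      then have "C n = carrier R" for n using JC[of n] idealD(1)[OF Ci[of n]] by auto
      then show False using Cn by auto
    qed
    then obtain s where s: "s \<in> carrier R" "s \<notin> J"
      and smax: "\<And>w. w \<in> carrier R \<Longrightarrow> w \<notin> J \<Longrightarrow> colon R J s \<subseteq> colon R J w \<Longrightarrow> colon R J w = colon R J s"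
      using exists_colon_maximal[OF Ji one_closed] by metis
    have "colon R J s = q"
    proof (rule min)
      show "primeideal (colon R J s) R" using colon_maximal_prime[OF Ji s smax] .
      show "I0 \<subseteq> colon R J s" using IJ colon_superset[OF Ji s(1)] by auto
      show "colon R J s \<subseteq> q" using Js s by (auto simp: colon_def sat_def)
    qed
    then have qs: "r \<otimes> s \<in> J \<longleftrightarrow> r \<in> q" if "r \<in> carrier R" for r using that by (auto simp: colon_def)
    have Ai: "ideal (adjoin R J s) R" using adjoin_ideal Ji s by auto
    define J' where "J' = sat R q (adjoin R J s)"
    have J'i: "ideal J' R" and J's: "sat R q J' \<subseteq> J'" and JJ': "J \<subseteq> J'" and sJ': "s \<in> J'"
      unfolding J'_def using sat_ideal[OF q Ai] sat_sat[OF q Ai, of q] sat_superset[OF q Ai] adjoin_superset[OF Ji s(1)] by auto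
    have J'd: "dcc J'" using J(2)[of J'] J'i J's JJ' sJ' s IJ by (auto simp: S_def)
    \<comment> \<open>After localization \<open>J'/J\<close> is a simple module, since
      \<open>s\<close> generates it and its annihilator is \<open>q\<close>: an ideal over
      \<open>J\<close> with a single element of \<open>J'\<close> outside \<open>J\<close> already
      contains all of \<open>J'\<close>.\<close>
    have simple: "J' \<subseteq> sat R q K" if K: "ideal K R" "J \<subseteq> K" "z \<in> K" "z \<in> J'" "z \<notin> J" for K z
    proof -
      obtain u j a where u: "u \<in> carrier R - q" "j \<in> J" "a \<in> carrier R" "u \<otimes> z = j \<oplus> a \<otimes> s" "z \<in> carrier R"
        using K(4) unfolding J'_def sat_def adjoin_def by auto
      have "a \<notin> q"
      proof
        assume "a \<in> q"
        then have "u \<otimes> z \<in> J" using qs u(2-4) idealD(3)[OF Ji] by simp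
        then show False using Js K(5) satI[of z u q J] u(1,5) by blast
      qed
      moreover have "a \<otimes> s \<in> K" 
      proof -
        have "u \<otimes> z \<in> K" using idealD(4)[OF K(1) K(3)] u(1) by auto
        then show ?thesis using ideal_add_cancel[OF K(1), of "a \<otimes> s" j] u(2-4) s(1) K(2) by auto
      qed
      ultimately have "s \<in> sat R q K" using u s by (auto simp: sat_def)
      moreover have Ki: "ideal (sat R q K) R" and "K \<subseteq> sat R q K"
        using sat_ideal[OF q K(1)] sat_superset[OF q K(1)] by auto
      ultimately have "adjoin R J s \<subseteq> sat R q K" using adjoin_minimal[OF Ki] K(2) by auto
      then show ?thesis unfolding J'_def using sat_mono sat_sat[OF q K(1), of q] by blast
    qed
    show False
    proof (cases "\<forall>n. J' \<subseteq> C n")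
      case True
      then have "C \<in> seqs J'" using C unfolding seqs_def by auto
      then show False using J'd Cn unfolding dcc_def by auto
    next
      case False
      then obtain k where k: "\<not> J' \<subseteq> C k" by auto
      have inter: "C n \<inter> J' \<subseteq> J" if "n \<ge> k" for n
        using simple[OF Ci[of k] JC[of k]] Cs[of k] k Cmono[OF that] by blast
      \<comment> \<open>From \<open>k\<close> on, the ideals \<open>C n\<close> meet
        \<open>J'\<close> only in \<open>J\<close>, so a stationary sum \<open>C n + J'\<close>
        forces \<open>C n\<close> itself to be stationary (modular law). The saturated sums form a
        chain above \<open>J'\<close>, where the chain condition holds by maximality of
        \<open>J\<close>.\<close>
      define E where "E n = sat R q (set_add R (C n) J')" for n
      have Si: "ideal (set_add R (C n) J') R" for n using add_ideals Ci J'i by auto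
      have CE: "C n \<subseteq> set_add R (C n) J'" "J' \<subseteq> set_add R (C n) J'" for n
        using set_add_superset[OF Ci J'i] by auto
      have "E \<in> seqs J'"
      proof -
        have "set_add R (C (Suc n)) J' \<subseteq> set_add R (C n) J'" for n using Cd[of n] unfolding set_add_def' by blast
        then show ?thesis 
          unfolding seqs_def E_def using sat_ideal[OF q Si] sat_sat[OF q Si, of q] sat_superset[OF q Si] CE sat_mono
          by blast
      qed
      then obtain N where N: "\<And>n. n \<ge> N \<Longrightarrow> E n = E N" using J'd unfolding dcc_def by blast
      have "C n = C (max N k)" if n: "n \<ge> max N k" for n
      proof
        show "C n \<subseteq> C (max N k)" using Cmono n by auto
        show "C (max N k) \<subseteq> C n"
        proof
          fix z assume z: "z \<in> C (max N k)"
          then have "z \<in> E (max N k)" using sat_superset[OF q Si] CE unfolding E_def by blast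
          then have "z \<in> E n" using N[of n] N[of "max N k"] n by auto
          then obtain u i w where u: "u \<in> carrier R - q" "i \<in> C n" "w \<in> J'" "u \<otimes> z = i \<oplus> w" "z \<in> carrier R"
            unfolding E_def sat_def set_add_def' by auto
          have c: "i \<in> carrier R" "w \<in> carrier R" using u idealD(6) Ci J'i by blast+
          have "i \<oplus> w \<in> C (max N k)" using idealD(4)[OF Ci z, of u] u by auto
          moreover have "i \<in> C (max N k)" using u(2) Cmono[OF n] by blast
          ultimately have "w \<in> C (max N k)" using ideal_add_cancel[OF Ci c(2)] by auto
          then have "w \<in> J" using inter[of "max N k"] u by auto
          then have "w \<in> C n" using JC by auto
          then have "u \<otimes> z \<in> C n" using u(2,4) idealD(3)[OF Ci] by simp
          then have "z \<in> sat R q (C n)" using u(1,5) by (intro satI[of z u]) auto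
          then show "z \<in> C n" using Cs[of n] by auto
        qed
      qed
      then show False using Cn by blast
    qed
  qed
  then show ?thesis using C J0(4) unfolding dcc_def seqs_def by auto
qed

text \<open>If no such \<open>p'\<close> existed, \<open>q\<close> would be minimal over
  \<open>p0 + (x)\<close>, and localized at \<open>q\<close> the quotient by that ideal would be
  Artinian. The ideals \<open>p0 + (y^n)\<close>, contracted from the localization at
  \<open>p\<close>, would then be stationary modulo \<open>x\<close>. Nakayama removes
  \<open>x\<close>, and a stationary power of \<open>y\<close> contradicts \<open>y \<in> p\<close>
  and \<open>y \<notin> p0\<close>. These ideals replace the symbolic powers of
  \<open>p\<close>.\<close>

lemma principal_ideal_theorem:
  assumes p0: "primeideal p0 R" and p: "primeideal p R" and q: "primeideal q R"
    and sub: "p0 \<subset> p" "p \<subseteq> q" and x: "x \<in> q" "x \<notin> p"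
  shows "\<exists>p'. primeideal p' R \<and> p0 \<subseteq> p' \<and> x \<in> p' \<and> p' \<subset> q"
proof (rule ccontr)
  assume neg: "\<not> ?thesis"
  obtain y where y: "y \<in> p" "y \<notin> p0" using sub by auto
  note p0i = primeD(1)[OF p0] and pi = primeD(1)[OF p] and qi = primeD(1)[OF q]
  have yc: "y \<in> carrier R" and xc: "x \<in> carrier R" using idealD(6) pi qi y x by auto
  define A where "A n = adjoin R p0 (y [^] n)" for n :: nat
  define W where "W n = sat R p (A n)" for n :: nat
  define C where "C n = sat R q (adjoin R (W n) x)" for n :: nat
  have Ai: "ideal (A n) R" for n unfolding A_def using adjoin_ideal[OF p0i] yc by auto
  have A_dec: "A (Suc n) \<subseteq> A n" for n
    unfolding A_def
  proof (rule adjoin_minimal)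
    show "ideal (adjoin R p0 (y [^] n)) R" "p0 \<subseteq> adjoin R p0 (y [^] n)"
      using adjoin_ideal[OF p0i] adjoin_superset[OF p0i] yc by auto
    then show "y [^] Suc n \<in> adjoin R p0 (y [^] n)"
      using idealD(5) adjoin_superset(2)[OF p0i, of "y [^] n"] yc by auto
  qed
  have Wi: "ideal (W n) R" for n unfolding W_def using sat_ideal[OF p Ai] .
  have AW: "A n \<subseteq> W n" for n unfolding W_def using sat_superset[OF p Ai] .
  have W_dec: "W (Suc n) \<subseteq> W n" for n unfolding W_def using sat_mono[OF A_dec] .
  have p0A: "p0 \<subseteq> A n" for n unfolding A_def using adjoin_superset[OF p0i] yc by auto
  have Bi: "ideal (adjoin R (W n) x) R" for n using adjoin_ideal[OF Wi xc] .
  define I0 where "I0 = adjoin R p0 x"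
  have I0i: "ideal I0 R" unfolding I0_def using adjoin_ideal[OF p0i xc] .
  have I0B: "I0 \<subseteq> adjoin R (W n) x" for n unfolding I0_def
    using adjoin_minimal[OF Bi] p0A[of n] AW[of n] adjoin_superset[OF Wi xc, of n] by auto
  have "\<exists>N. \<forall>n\<ge>N. C n = C N"
  proof (rule saturated_dcc[OF q, of I0 C "sat R q I0"])
    show "p' = q" if "primeideal p' R" "I0 \<subseteq> p'" "p' \<subseteq> q" for p'
      using that neg adjoin_superset[OF p0i xc] unfolding I0_def by blast
    show "ideal (C n) R" for n unfolding C_def using sat_ideal[OF q Bi] .
    show "sat R q (C n) \<subseteq> C n" for n unfolding C_def using sat_sat[OF q Bi] by auto
    show "I0 \<subseteq> C n" for n using I0B sat_superset[OF q Bi] unfolding C_def by blast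
    show "C (Suc n) \<subseteq> C n" for n unfolding C_def
      using sat_mono adjoin_minimal[OF Bi, of "W (Suc n)" n x] W_dec adjoin_superset[OF Wi xc, of n] by blast
    show "ideal (sat R q I0) R" "sat R q (sat R q I0) \<subseteq> sat R q I0" "I0 \<subseteq> sat R q I0"
      using sat_ideal[OF q I0i] sat_sat[OF q I0i] sat_superset[OF q I0i] by auto
    show "sat R q I0 \<subseteq> C n" for n unfolding C_def using sat_mono[OF I0B] .
  qed
  then obtain N where N: "C N = C (Suc N)" using le_Suc_eq by (metis le_refl)
  have "W N \<subseteq> W (Suc N)"
  proof (rule saturated_nakayama[OF q Wi Wi W_dec])
    show "sat R q (W (Suc N)) \<subseteq> W (Suc N)" unfolding W_def using sat_sat[OF p Ai sub(2)] .
    fix z assume z: "z \<in> W N"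
    then have "z \<in> C N" unfolding C_def using adjoin_superset(1)[OF Wi xc, of N] sat_superset[OF q Bi, of N] by auto
    then have "z \<in> C (Suc N)" using N by simp
    then obtain u w a where u: "u \<in> carrier R - q" "w \<in> W (Suc N)" "a \<in> carrier R" "u \<otimes> z = w \<oplus> a \<otimes> x"
      unfolding C_def sat_def adjoin_def by auto
    have "u \<otimes> z \<in> W N" using z idealD(4)[OF Wi] u(1) by auto
    then have "w \<oplus> a \<otimes> x \<in> W N" using u(4) by simp
    moreover have "w \<in> W N" using W_dec u by auto
    ultimately have ax: "a \<otimes> x \<in> W N" using ideal_add_cancel[OF Wi, of "a \<otimes> x" w] u(3) xc by auto
    \<comment> \<open>\<open>x\<close> lies outside \<open>p\<close> and \<open>W N\<close> is
      saturated at \<open>p\<close>, so \<open>x\<close> can be cancelled. The remainder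
      \<open>a \<otimes> x\<close> then lies in \<open>q \<cdot> W N\<close>, as Nakayama
      requires.\<close>
    have "x \<otimes> a \<in> W N" using ax m_comm u(3) xc by simp
    then have "a \<in> sat R p (W N)" using u(3) xc x by (intro satI[of a x]) auto
    then have "a \<in> W N" using sat_sat[OF p Ai, of p] unfolding W_def by auto
    then have "x \<otimes> a \<in> q \<cdot> W N" using x ideal_prod.prod by metis
    then show "\<exists>u\<in>carrier R - q. \<exists>i\<in>W (Suc N). \<exists>p\<in>q \<cdot> W N. u \<otimes> z = i \<oplus> p"
      using u m_comm[of a x] xc by metis
  qed
  moreover have "y [^] N \<in> W N" using AW[of N] adjoin_superset(2)[OF p0i, of "y [^] N"] yc unfolding A_def by auto
  ultimately have "y [^] N \<in> W (Suc N)" by auto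
  then obtain u e a where u: "u \<in> carrier R - p" "e \<in> p0" "a \<in> carrier R"
    "u \<otimes> y [^] N = e \<oplus> a \<otimes> y [^] Suc N"
    unfolding W_def A_def sat_def adjoin_def by auto
  have uc: "u \<in> carrier R" "e \<in> carrier R" "y [^] N \<in> carrier R" using u idealD(6)[OF p0i] yc by auto
  have "(u \<ominus> a \<otimes> y) \<otimes> y [^] N = u \<otimes> y [^] N \<ominus> a \<otimes> (y [^] N \<otimes> y)" using uc u(3) yc by algebra
  also have "\<dots> = e" using u(4) uc u(3) yc by (simp add: a_minus_def a_assoc r_neg)
  finally have "(u \<ominus> a \<otimes> y) \<otimes> y [^] N \<in> p0" using u by simp
  \<comment> \<open>\<open>p0\<close> is prime and contains no power of \<open>y\<close>, so
    \<open>y [^] N\<close> cancels. Then \<open>u\<close> would lie in \<open>p\<close>, because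
    \<open>a \<otimes> y\<close> does.\<close>
  then have "u \<ominus> a \<otimes> y \<in> p0"
    using primeD(4)[OF p0, of "u \<ominus> a \<otimes> y" "y [^] N"] prime_pow_notin[OF p0 yc y(2)] uc u(3) yc by auto
  then have "u \<ominus> a \<otimes> y \<in> p" using sub by auto
  then have "u \<ominus> a \<otimes> y \<oplus> a \<otimes> y \<in> p" using idealD(3,4)[OF pi] y u(3) by auto
  moreover have "u \<ominus> a \<otimes> y \<oplus> a \<otimes> y = u" using uc u(3) yc by algebra
  ultimately show False using u by auto
qed

text \<open>The principal ideal theorem replaces the second prime from the top by one containing
  \<open>x\<close>, and the induction hypothesis carries \<open>x\<close> down the rest of the
  chain. Length and both ends survive.\<close>

lemma prime_chain_through:
  assumes "prime_chain R (Suc n) p" "x \<in> p (Suc n)"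
  shows "\<exists>p'. prime_chain R (Suc n) p' \<and> p' 0 = p 0 \<and> p' (Suc n) = p (Suc n) \<and> x \<in> p' 1"
  using assms
proof (induction n arbitrary: p)
  case 0
  then show ?case by auto
next
  case (Suc n)
  have "\<exists>q. primeideal q R \<and> p n \<subset> q \<and> q \<subset> p (Suc (Suc n)) \<and> x \<in> q"
  proof (cases "x \<in> p (Suc n)")
    case True
    then show ?thesis using Suc(2) unfolding prime_chain_def by (intro exI[of _ "p (Suc n)"]) auto
  next
    case False
    have "primeideal (p n) R" "primeideal (p (Suc n)) R" "primeideal (p (Suc (Suc n))) R"
      "p n \<subset> p (Suc n)" "p (Suc n) \<subset> p (Suc (Suc n))"
      using Suc(2) unfolding prime_chain_def by auto
    then show ?thesis using principal_ideal_theorem[of "p n" "p (Suc n)" "p (Suc (Suc n))" x] False Suc(3) by blast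
  qed
  then obtain q where q: "primeideal q R" "p n \<subset> q" "q \<subset> p (Suc (Suc n))" "x \<in> q" by blast
  have "prime_chain R (Suc n) (p(Suc n := q))"
    using Suc(2) q unfolding prime_chain_def by auto
  then obtain p' where p': "prime_chain R (Suc n) p'" "p' 0 = p 0" "p' (Suc n) = q" "x \<in> p' 1"
    using Suc.IH[of "p(Suc n := q)"] q(4) by (metis fun_upd_apply nat.distinct(1))
  define r where "r = p'(Suc (Suc n) := p (Suc (Suc n)))"
  have "prime_chain R (Suc (Suc n)) r"
    using p' q Suc(2) unfolding prime_chain_def r_def by (auto simp: less_Suc_eq le_Suc_eq)
  moreover have "r 0 = p 0" "r (Suc (Suc n)) = p (Suc (Suc n))" "x \<in> r 1" using p' unfolding r_def by auto
  ultimately show ?case by blast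
qed

text \<open>Krull's height theorem relative to the bottom prime: the last assumption makes
  \<open>p n\<close> minimal over \<open>p 0\<close> together with \<open>S\<close>. This form lets
  the induction run: one generator is pulled into the second prime of the chain, and the chain
  without its bottom needs only the remaining generators.\<close>

lemma prime_chain_length_le:
  assumes "finite S" "prime_chain R n p" "S \<subseteq> p n"
    and "\<And>q. primeideal q R \<Longrightarrow> p 0 \<union> S \<subseteq> q \<Longrightarrow> p n \<subseteq> q"
  shows "n \<le> card S"
  using assms
proof (induction S arbitrary: n p rule: finite_induct)
  case empty
  have "p n \<subseteq> p 0" using empty(3)[of "p 0"] empty(1) unfolding prime_chain_def by auto
  then show ?case
  proof (cases n)
    case (Suc m)
    then have "p 0 \<subset> p 1" "p 1 \<subseteq> p n" using empty(1) prime_chain_mono[of n p 1 n] unfolding prime_chain_def by auto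
    then show ?thesis using \<open>p n \<subseteq> p 0\<close> by auto
  qed simp
next
  case (insert x S)
  show ?case
  proof (cases n)
    case (Suc m)
    then obtain p' where p': "prime_chain R (Suc m) p'" "p' 0 = p 0" "p' (Suc m) = p (Suc m)" "x \<in> p' 1"
      using prime_chain_through[of m p x] insert by auto
    have "m \<le> card S"
    proof (rule insert.IH[of m "\<lambda>i. p' (Suc i)"])
      show "prime_chain R m (\<lambda>i. p' (Suc i))" using p'(1) unfolding prime_chain_def by auto
      show "S \<subseteq> p' (Suc m)" using insert p' Suc by auto
      fix q assume q: "primeideal q R" "p' (Suc 0) \<union> S \<subseteq> q"
      have "p' 0 \<subseteq> p' 1" using prime_chain_mono[OF p'(1), of 0 1] by auto
      then show "p' (Suc m) \<subseteq> q" using insert(6)[OF q(1)] q(2) p' Suc by auto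
    qed
    then show ?thesis using Suc insert by auto
  qed simp
qed

end

section \<open>Noetherian local rings\<close>

locale noetherian_local_ring = noetherian_cring R for R (structure) +
  assumes unique_maximal: "\<exists>!I. maximalideal I R"

lemma local_ring_iff_locale: "local_ring R \<longleftrightarrow> noetherian_local_ring R"
  unfolding local_ring_def noetherian_local_ring_def noetherian_local_ring_axioms_def noetherian_cring_def
  by auto

text \<open>The sequence itself is forgotten; its ideal and its length \<open>t\<close> are kept,
  the length for the final comparison of dimensions. Staying outside \<open>I + \<mm>^2\<close> at
  each step is linear independence modulo \<open>\<mm>^2\<close>, stated one element at a
  time.\<close>

inductive independent_regular :: "('a, 'm) ring_scheme \<Rightarrow> nat \<Rightarrow> 'a set \<Rightarrow> bool" for R where
  zero: "independent_regular R 0 {\<zero>\<^bsub>R\<^esub>}"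
| adjoin: "independent_regular R t I \<Longrightarrow> x \<in> max_ideal R \<Longrightarrow>
    x \<notin> set_add R I (ideal_prod R (max_ideal R) (max_ideal R)) \<Longrightarrow>
    (\<And>y. y \<in> carrier R \<Longrightarrow> x \<otimes>\<^bsub>R\<^esub> y \<in> I \<Longrightarrow> y \<in> I) \<Longrightarrow>
    independent_regular R (Suc t) (adjoin R I x)"

context noetherian_local_ring
begin

lemma maximalideal_max_ideal: "maximalideal (max_ideal R) R"
  unfolding max_ideal_def using theI'[OF unique_maximal] .

lemma prime_max_ideal: "primeideal (max_ideal R) R"
  using maximalideal_prime[OF maximalideal_max_ideal] .

lemma ideal_max_ideal: "ideal (max_ideal R) R"
  using primeD(1)[OF prime_max_ideal] .

lemma proper_ideal_subset:
  assumes "ideal I R" "\<one> \<notin> I"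
  shows "I \<subseteq> max_ideal R"
proof -
  define S where "S = {J. ideal J R \<and> I \<subseteq> J \<and> \<one> \<notin> J}"
  have "I \<in> S" using assms by (auto simp: S_def)
  then have "\<exists>M\<in>S. \<forall>Z\<in>S. M \<subseteq> Z \<longrightarrow> Z = M"
    by (intro ideal_maximal_element) (auto simp: S_def)
  then obtain M where M: "M \<in> S" "\<And>Z. Z \<in> S \<Longrightarrow> M \<subseteq> Z \<Longrightarrow> Z = M" by blast
  have "maximalideal M R"
  proof (rule maximalidealI)
    show "ideal M R" "carrier R \<noteq> M" using M(1) by (auto simp: S_def)
    fix J assume J: "ideal J R" "M \<subseteq> J" "J \<subseteq> carrier R"
    show "J = M \<or> J = carrier R"
    proof (cases "\<one> \<in> J")
      case True
      then show ?thesis using ideal.one_imp_carrier J by auto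
    next
      case False
      then have "J \<in> S" using J M(1) by (auto simp: S_def)
      then show ?thesis using M(2) J by auto
    qed
  qed
  then have "M = max_ideal R" using unique_maximal maximalideal_max_ideal by auto
  then show ?thesis using M(1) by (auto simp: S_def)
qed

lemma unit_outside:
  assumes "x \<in> carrier R" "x \<notin> max_ideal R"
  obtains y where "y \<in> carrier R" "y \<otimes> x = \<one>"
proof -
  have i: "ideal (adjoin R {\<zero>} x) R" using adjoin_ideal[OF zeroideal assms(1)] .
  have "x \<in> adjoin R {\<zero>} x" using adjoin_superset(2)[OF zeroideal assms(1)] .
  then have "\<one> \<in> adjoin R {\<zero>} x" using proper_ideal_subset[OF i] assms by auto
  then show ?thesis using that assms(1) unfolding adjoin_def by auto
qed

text \<open>Elements outside the maximal ideal are units, so localizing there changes nothing, and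
  statements about saturated ideals become statements about all ideals.\<close>

lemma sat_max_ideal:
  assumes "ideal I R"
  shows "sat R (max_ideal R) I \<subseteq> I"
proof
  fix z assume "z \<in> sat R (max_ideal R) I"
  then obtain u where u: "z \<in> carrier R" "u \<in> carrier R" "u \<notin> max_ideal R" "u \<otimes> z \<in> I" by (auto simp: sat_def)
  then obtain v where v: "v \<in> carrier R" "v \<otimes> u = \<one>" using unit_outside by blast
  have "v \<otimes> (u \<otimes> z) = z" using u v by (simp flip: m_assoc)
  then show "z \<in> I" using idealD(4)[OF assms u(4) v(1)] by simp
qed

lemma nakayama:
  assumes "ideal W R" "ideal I R" "I \<subseteq> W" "W \<subseteq> set_add R I (ideal_prod R (max_ideal R) W)"
  shows "W \<subseteq> I"
proof (rule saturated_nakayama[OF prime_max_ideal assms(1-3) sat_max_ideal[OF assms(2)]])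
  fix z assume z: "z \<in> W"
  then obtain i p where "i \<in> I" "p \<in> ideal_prod R (max_ideal R) W" "z = i \<oplus> p"
    using assms(4) unfolding set_add_def' by blast
  moreover have "\<one> \<in> carrier R - max_ideal R" "\<one> \<otimes> z = z"
    using primeD(3)[OF prime_max_ideal] idealD(6)[OF assms(1) z] by auto
  ultimately show "\<exists>u\<in>carrier R - max_ideal R. \<exists>i\<in>I. \<exists>p\<in>max_ideal R \<cdot> W. u \<otimes> z = i \<oplus> p" by metis
qed

text \<open>Without a socle element no maximal colon \<open>(I : y)\<close> equals
  \<open>\<mm>\<close>, and then none contains \<open>I + \<mm>^2\<close>; that ideal is itself
  proper in \<open>\<mm>\<close> by Nakayama. Prime avoidance supplies \<open>x\<close> outside all
  of these finitely many ideals, and being outside the maximal colons means being regular modulo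
  \<open>I\<close>.\<close>

lemma socle_or_regular_element:
  assumes I: "ideal I R" "I \<subseteq> max_ideal R" "I \<noteq> max_ideal R"
  shows "(\<exists>s \<in> max_ideal R. s \<notin> I \<and> (\<forall>a \<in> max_ideal R. a \<otimes> s \<in> I)) \<or>
    (\<exists>x \<in> max_ideal R. x \<notin> set_add R I (ideal_prod R (max_ideal R) (max_ideal R)) \<and>
      (\<forall>y \<in> carrier R. x \<otimes> y \<in> I \<longrightarrow> y \<in> I))"
proof (rule disjCI)
  let ?m = "max_ideal R"
  assume neg: "\<not> (\<exists>x \<in> ?m. x \<notin> set_add R I (ideal_prod R ?m ?m) \<and> (\<forall>y \<in> carrier R. x \<otimes> y \<in> I \<longrightarrow> y \<in> I))"
  define J where "J = set_add R I (ideal_prod R ?m ?m)"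
  note mi = ideal_max_ideal
  have mmi: "ideal (ideal_prod R ?m ?m) R" "ideal_prod R ?m ?m \<subseteq> ?m"
    using ideal_prod_is_ideal[OF mi mi] ideal_prod_inter[OF mi mi] by auto
  have Ji: "ideal J R" unfolding J_def using add_ideals I mmi by auto
  have IJ: "I \<subseteq> J" "ideal_prod R ?m ?m \<subseteq> J" unfolding J_def using set_add_superset I mmi by auto
  have Jm: "J \<subseteq> ?m" unfolding J_def set_add_def' using I mmi idealD(3)[OF mi] by blast
  have "J \<noteq> ?m"
  proof
    assume "J = ?m"
    then have "?m \<subseteq> I" using nakayama[OF mi I(1,2)] unfolding J_def by auto
    then show False using I by auto
  qed
  define Y where "Y = {y \<in> carrier R - I. \<forall>z \<in> carrier R - I. colon R I y \<subseteq> colon R I z \<longrightarrow> colon R I z = colon R I y}"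
  show "\<exists>s \<in> ?m. s \<notin> I \<and> (\<forall>a \<in> ?m. a \<otimes> s \<in> I)"
  proof (rule ccontr)
    assume ns: "\<not> ?thesis"
    have Yprime: "primeideal (colon R I y) R" if "y \<in> Y" for y
      by (rule colon_maximal_prime[OF I(1)]) (use that Y_def in auto)
    have "\<exists>x \<in> ?m - J. \<forall>P \<in> colon R I ` Y. x \<notin> P"
    proof (rule prime_avoidance[OF Ji mi Jm \<open>J \<noteq> ?m\<close>])
      show "finite (colon R I ` Y)" unfolding Y_def using finite_maximal_colons[OF I(1)] .
      show "primeideal P R" if "P \<in> colon R I ` Y" for P using that Yprime by auto
      show "P = Q" if "P \<in> colon R I ` Y" "Q \<in> colon R I ` Y" "P \<subseteq> Q" for P Q
        using that unfolding Y_def by auto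
      fix P assume "P \<in> colon R I ` Y"
      then obtain y where y: "y \<in> Y" "P = colon R I y" by auto
      have P: "primeideal P R" using Yprime y by auto
      show "\<not> J \<subseteq> P"
      proof
        assume "J \<subseteq> P"
        have "a \<in> P" if "a \<in> ?m" for a
        proof -
          have "a \<otimes> a \<in> P" using ideal_prod.prod[OF that that] IJ \<open>J \<subseteq> P\<close> by auto
          then show ?thesis using primeD(4)[OF P] idealD(6)[OF mi that] by auto
        qed
        then have my: "a \<otimes> y \<in> I" if "a \<in> ?m" for a using that y unfolding colon_def by auto
        have yc: "y \<in> carrier R" "y \<notin> I" using y unfolding Y_def by auto
        \<comment> \<open>Here \<open>\<mm> y\<close> lies in \<open>I\<close>. A \<open>y\<close>
          inside \<open>\<mm>\<close> would be a socle element; a unit \<open>y\<close> would put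
          \<open>\<mm>\<close> inside \<open>I\<close>.\<close>
        have "y \<notin> ?m" using ns my yc by auto
        then obtain v where v: "v \<in> carrier R" "v \<otimes> y = \<one>" using unit_outside yc by blast
        have "a \<in> I" if "a \<in> ?m" for a
        proof -
          have ac: "a \<in> carrier R" using idealD(6)[OF mi that] .
          have "v \<otimes> (a \<otimes> y) = a \<otimes> (v \<otimes> y)" using ac v(1) yc(1) by algebra
          then have "v \<otimes> (a \<otimes> y) = a" using v(2) ac by simp
          then show ?thesis using idealD(4)[OF I(1) my[OF that] v(1)] by simp
        qed
        then show False using I by auto
      qed
    qed
    then obtain x where x: "x \<in> ?m" "x \<notin> J" "\<And>y. y \<in> Y \<Longrightarrow> x \<notin> colon R I y" by auto
    have xc: "x \<in> carrier R" using idealD(6)[OF mi x(1)] .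
    have "y \<in> I" if y: "y \<in> carrier R" "x \<otimes> y \<in> I" for y
    proof (rule ccontr)
      assume "y \<notin> I"
      then obtain z where z: "z \<in> carrier R" "z \<notin> I" "colon R I y \<subseteq> colon R I z"
        "\<And>w. w \<in> carrier R \<Longrightarrow> w \<notin> I \<Longrightarrow> colon R I z \<subseteq> colon R I w \<Longrightarrow> colon R I w = colon R I z"
        using exists_colon_maximal[OF I(1) y(1)] by metis
      then have "z \<in> Y" unfolding Y_def by auto
      moreover have "x \<in> colon R I y" using y xc unfolding colon_def by auto
      ultimately show False using x(3) z(3) by auto
    qed
    then show False using neg x(1,2) unfolding J_def by auto
  qed
qed

lemma independent_regular_ideal:
  assumes "independent_regular R t I"
  shows "ideal I R \<and> I \<subseteq> max_ideal R"
  using assms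
proof induction
  case zero
  then show ?case using zeroideal idealD(2)[OF ideal_max_ideal] by auto
next
  case (adjoin t I x)
  then show ?case using adjoin_ideal adjoin_minimal[OF ideal_max_ideal] idealD(6)[OF ideal_max_ideal] by auto
qed

text \<open>By Nakayama, a nontrivial annihilator \<open>(I : b)\<close> cannot lie inside \<open>I + (x)\<close>.\<close>

lemma prime_of_prime_adjoin:
  assumes I: "ideal I R" and x: "x \<in> max_ideal R" and reg: "\<And>y. y \<in> carrier R \<Longrightarrow> x \<otimes> y \<in> I \<Longrightarrow> y \<in> I"
    and Q: "primeideal (adjoin R I x) R"
  shows "primeideal I R"
proof (rule primeidealI[OF I is_cring])
  let ?Q = "adjoin R I x"
  have xc: "x \<in> carrier R" using idealD(6)[OF ideal_max_ideal x] .
  note IQ = adjoin_superset[OF I xc]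
  show "carrier R \<noteq> I" using primeD(3)[OF Q] IQ by auto
  note Ir = idealD[OF I]
  have small: "colon R I b \<subseteq> I" if b: "b \<in> carrier R" and sub: "colon R I b \<subseteq> ?Q" for b
  proof (rule nakayama[OF colon_ideal[OF I b] I colon_superset[OF I b]])
    show "colon R I b \<subseteq> set_add R I (ideal_prod R (max_ideal R) (colon R I b))"
    proof
      fix a assume a: "a \<in> colon R I b"
      then obtain i c where ic: "i \<in> I" "c \<in> carrier R" "a = i \<oplus> c \<otimes> x"
        using sub unfolding adjoin_def by blast
      have "a \<otimes> b \<in> I" using a unfolding colon_def by auto
      moreover have "a \<otimes> b = i \<otimes> b \<oplus> x \<otimes> (c \<otimes> b)" 
        unfolding ic(3) using ic(1,2) xc b Ir(6) by algebra
      ultimately have "x \<otimes> (c \<otimes> b) \<in> I"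
        using ideal_add_cancel[OF I, of "x \<otimes> (c \<otimes> b)" "i \<otimes> b"] Ir(5)[OF ic(1) b] ic(2) b xc by auto
      then have "c \<in> colon R I b" using reg ic(2) b unfolding colon_def by auto
      then have "x \<otimes> c \<in> ideal_prod R (max_ideal R) (colon R I b)" using ideal_prod.prod[OF x] by auto
      moreover have "a = i \<oplus> x \<otimes> c" using ic m_comm xc by auto
      ultimately show "a \<in> set_add R I (ideal_prod R (max_ideal R) (colon R I b))"
        using ic(1) unfolding set_add_def' by blast
    qed
  qed
  fix a b assume ab: "a \<in> carrier R" "b \<in> carrier R" "a \<otimes> b \<in> I"
  show "a \<in> I \<or> b \<in> I"
  proof (rule ccontr)
    assume n: "\<not> (a \<in> I \<or> b \<in> I)"
    have aW: "a \<in> colon R I b" using ab by (auto simp: colon_def)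
    \<comment> \<open>\<open>colon R I b\<close> is not inside \<open>I\<close>, hence not inside
      \<open>?Q\<close>. An element \<open>a'\<close> of it outside the prime \<open>?Q\<close> has
      its own annihilator modulo \<open>I\<close> inside \<open>?Q\<close>, so inside
      \<open>I\<close>; but that annihilator contains \<open>b\<close>.\<close>
    then obtain a' where a': "a' \<in> colon R I b" "a' \<notin> ?Q" using small[OF ab(2)] n by auto
    then have a'c: "a' \<in> carrier R" "a' \<otimes> b \<in> I" by (auto simp: colon_def)
    have "colon R I a' \<subseteq> ?Q"
      using primeD(4)[OF Q] a' a'c(1) IQ(1) by (auto simp: colon_def)
    then have "colon R I a' \<subseteq> I" using small a'c by auto
    moreover have "b \<in> colon R I a'" using a'c ab m_comm[of a' b] by (auto simp: colon_def)
    ultimately show False using n by auto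
  qed
qed

text \<open>Primality of the top ideal descends through the tower by
  \<open>prime_of_prime_adjoin\<close>. The inclusions are strict because an element regular modulo
  a proper ideal lies outside it. This yields the lower bound on the Krull dimension.\<close>

lemma independent_regular_chain:
  assumes "independent_regular R t I" "primeideal I R"
  shows "\<exists>p. prime_chain R t p \<and> p t = I"
  using assms
proof induction
  case zero
  then show ?case by (intro exI[of _ "\<lambda>_. {\<zero>}"]) (auto simp: prime_chain_def)
next
  case (adjoin t I x)
  have I: "ideal I R" "I \<subseteq> max_ideal R" using independent_regular_ideal adjoin by auto
  have xc: "x \<in> carrier R" using idealD(6)[OF ideal_max_ideal adjoin(2)] .
  have pI: "primeideal I R" using prime_of_prime_adjoin[OF I(1) adjoin(2,4,6)] .
  then obtain p where p: "prime_chain R t p" "p t = I" using adjoin by auto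
  have "x \<notin> I" using adjoin(4)[OF one_closed] xc primeD(3)[OF pI] by auto
  then have "I \<subset> adjoin R I x" using adjoin_superset[OF I(1) xc] by auto
  moreover define r where "r = p(Suc t := adjoin R I x)"
  ultimately have "prime_chain R (Suc t) r" "r (Suc t) = adjoin R I x"
    using p adjoin(6) unfolding prime_chain_def by (auto simp: less_Suc_eq le_Suc_eq)
  then show ?case by blast
qed

lemma independent_regular_generators:
  assumes "independent_regular R t I"
  shows "\<exists>S. finite S \<and> card S \<le> t \<and> S \<subseteq> carrier R \<and> Idl S = I"
  using assms
proof induction
  case zero
  show ?case using genideal_empty by (intro exI[of _ "{}"]) auto
next
  case (adjoin t I x)
  then obtain S where S: "finite S" "card S \<le> t" "S \<subseteq> carrier R" "Idl S = I" by auto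
  have I: "ideal I R" using independent_regular_ideal adjoin by auto
  have xc: "x \<in> carrier R" using idealD(6)[OF ideal_max_ideal adjoin(2)] .
  have c: "insert x S \<subseteq> carrier R" using S xc by auto
  have "Idl (insert x S) = adjoin R I x"
  proof
    show "Idl (insert x S) \<subseteq> adjoin R I x"
      using adjoin_superset[OF I xc] genideal_self[OF S(3)] S(4)
      by (intro genideal_minimal adjoin_ideal I xc) auto
    show "adjoin R I x \<subseteq> Idl (insert x S)"
      using genideal_self[OF c] subset_Idl_subset[OF c, of S] S(4)
      by (intro adjoin_minimal genideal_ideal c) auto
  qed
  then show ?case using S c card_insert_le_m1[of "Suc t" S x] 
    by (intro exI[of _ "insert x S"]) auto
qed

text \<open>The inequalities close up in a circle: the tower gives a chain of length
  \<open>t\<close>, its generators bound the embedding dimension by \<open>t\<close>, and the height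
  theorem bounds every chain by the embedding dimension.\<close>

lemma regular_of_independent_regular:
  assumes "independent_regular R t (max_ideal R)"
  shows "regular_local_ring R"
proof -
  let ?m = "max_ideal R"
  let ?G = "\<lambda>n S. finite S \<and> card S = n \<and> S \<subseteq> carrier R \<and> Idl S = ?m"
  obtain S where S: "finite S" "card S \<le> t" "S \<subseteq> carrier R" "Idl S = ?m"
    using independent_regular_generators[OF assms] by auto
  then have "\<exists>S'. ?G (card S) S'" by blast
  then have "\<exists>S. ?G (embedding_dim R) S"
    unfolding embedding_dim_def by (rule LeastI[where P = "\<lambda>n. \<exists>S. ?G n S"])
  then obtain S' where S': "finite S'" "card S' = embedding_dim R" "S' \<subseteq> carrier R" "Idl S' = ?m" by blast
  have "embedding_dim R \<le> card S" unfolding embedding_dim_def using S by (intro Least_le) auto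
  then have et: "embedding_dim R \<le> t" using S by auto
  have upper: "n \<le> embedding_dim R" if p: "prime_chain R n p" for n p
  proof -
    have pn: "primeideal (p n) R" using p unfolding prime_chain_def by auto
    have pm: "p n \<subseteq> ?m" using proper_ideal_subset primeD[OF pn] by auto
    \<comment> \<open>Raising the top prime to \<open>?m\<close> keeps the length and makes the
      generators \<open>S'\<close> of \<open>?m\<close> admissible in
      \<open>prime_chain_length_le\<close>.\<close>
    define r where "r = p(n := ?m)"
    have "prime_chain R n r" using p pm prime_max_ideal unfolding prime_chain_def r_def by auto
    moreover have "S' \<subseteq> r n" using genideal_self[OF S'(3)] S'(4) unfolding r_def by auto
    moreover have "r n \<subseteq> q" if "primeideal q R" "r 0 \<union> S' \<subseteq> q" for q
      using genideal_minimal[OF primeD(1)[OF that(1)], of S'] that(2) S'(4) unfolding r_def by auto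
    ultimately have "n \<le> card S'" using prime_chain_length_le[OF S'(1)] by blast
    then show ?thesis using S' by simp
  qed
  obtain p where p: "prime_chain R t p" using independent_regular_chain[OF assms prime_max_ideal] by auto
  have dim: "krull_dim R = Sup {enat n | n. \<exists>p. prime_chain R n p}"
    unfolding krull_dim_def prime_chain_def ..
  have "krull_dim R \<le> enat (embedding_dim R)"
    unfolding dim using upper by (intro Sup_least) auto
  moreover have "enat t \<le> krull_dim R" unfolding dim using p by (intro Sup_upper) auto
  ultimately have "krull_dim R = enat (embedding_dim R)"
    using et by (metis enat_ord_simps(1) order_antisym order_trans)
  then show ?thesis
    unfolding regular_local_ring_def local_ring_iff_locale using noetherian_local_ring_axioms by auto
qed

end

section \<open>Quotients by an element, realized on the original types\<close>

text \<open>Stated for surjections because the quotients used later are copies on the original type.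
  Ideals pull back along \<open>h\<close>, and a proper ideal pulls back into
  \<open>max_ideal A\<close>, so the image of \<open>max_ideal A\<close> absorbs every proper ideal
  of \<open>B\<close>.\<close>

lemma noetherian_local_ring_image:
  assumes A: "noetherian_local_ring A" and B: "cring B" and h: "h \<in> ring_hom A B"
    and surj: "h ` carrier A = carrier B" and nz: "\<one>\<^bsub>B\<^esub> \<noteq> \<zero>\<^bsub>B\<^esub>"
  shows "noetherian_local_ring B" "max_ideal B = h ` max_ideal A"
proof -
  interpret A: noetherian_local_ring A by fact
  interpret B: cring B by fact
  interpret ring_hom_cring A B h
    by (intro ring_hom_cring.intro A.is_cring B ring_hom_cring_axioms.intro h)
  have pre: "ideal {a \<in> carrier A. h a \<in> J} A" if "ideal J B" for J
    unfolding A.ideal_iff using B.idealD[OF that] by auto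
  have noeth: "noetherian_ring B"
  proof (rule B.noetherian_ringI)
    fix J assume J: "ideal J B"
    obtain S where S: "S \<subseteq> carrier A" "finite S" "{a \<in> carrier A. h a \<in> J} = Idl\<^bsub>A\<^esub> S"
      using A.finetely_gen[OF pre[OF J]] by blast
    have hS: "h ` S \<subseteq> carrier B" using S by auto
    have Ji: "ideal (Idl\<^bsub>B\<^esub> (h ` S)) B" using B.genideal_ideal[OF hS] .
    have "Idl\<^bsub>A\<^esub> S \<subseteq> {a \<in> carrier A. h a \<in> Idl\<^bsub>B\<^esub> (h ` S)}"
      using B.genideal_self[OF hS] S(1) by (intro A.genideal_minimal pre Ji) auto
    then have "J \<subseteq> Idl\<^bsub>B\<^esub> (h ` S)"
      using S(3) surj B.idealD(1)[OF J] by (smt (verit) image_iff mem_Collect_eq subset_eq)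
    moreover have "h ` S \<subseteq> J" using S(3) A.genideal_self[OF S(1)] by auto
    then have "Idl\<^bsub>B\<^esub> (h ` S) \<subseteq> J" using B.genideal_minimal[OF J] by auto
    ultimately show "\<exists>T\<subseteq>carrier B. finite T \<and> J = Idl\<^bsub>B\<^esub> T" using hS S(2) by blast
  qed
  let ?m = "max_ideal A" and ?N = "h ` max_ideal A"
  note mA = A.idealD[OF A.ideal_max_ideal]
  have Ni: "ideal ?N B"
    unfolding B.ideal_iff
  proof (intro conjI ballI)
    show "?N \<subseteq> carrier B" using mA by auto
    show "\<zero>\<^bsub>B\<^esub> \<in> ?N" using mA(2) by (metis hom_zero imageI)
    show "a \<oplus>\<^bsub>B\<^esub> b \<in> ?N" if "a \<in> ?N" "b \<in> ?N" for a b
    proof -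
      obtain u v where "u \<in> ?m" "v \<in> ?m" "a = h u" "b = h v" using \<open>a \<in> ?N\<close> \<open>b \<in> ?N\<close> by auto
      then have "a \<oplus>\<^bsub>B\<^esub> b = h (u \<oplus>\<^bsub>A\<^esub> v)" "u \<oplus>\<^bsub>A\<^esub> v \<in> ?m" using mA(3,6) by auto
      then show ?thesis by auto
    qed
    show "x \<otimes>\<^bsub>B\<^esub> a \<in> ?N" if ax: "a \<in> ?N" "x \<in> carrier B" for a x
    proof -
      obtain u v where "u \<in> ?m" "v \<in> carrier A" "a = h u" "x = h v"
        using ax surj by (metis imageE)
      then have "x \<otimes>\<^bsub>B\<^esub> a = h (v \<otimes>\<^bsub>A\<^esub> u)" "v \<otimes>\<^bsub>A\<^esub> u \<in> ?m" using mA(4,6) by auto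
      then show ?thesis by auto
    qed
  qed
  have sub: "J \<subseteq> ?N" if J: "ideal J B" "\<one>\<^bsub>B\<^esub> \<notin> J" for J
  proof
    fix b assume b: "b \<in> J"
    then obtain a where a: "a \<in> carrier A" "b = h a" using B.idealD(6)[OF J(1) b] surj by blast
    have "{a \<in> carrier A. h a \<in> J} \<subseteq> ?m" using A.proper_ideal_subset[OF pre] J by auto
    then show "b \<in> ?N" using a b by auto
  qed
  have one: "\<one>\<^bsub>B\<^esub> \<notin> ?N"
  proof
    assume "\<one>\<^bsub>B\<^esub> \<in> ?N"
    \<comment> \<open>If an \<open>a\<close> in the maximal ideal mapped to one, the unit
      \<open>1 - a\<close> would map to zero and \<open>B\<close> would be trivial.\<close>
    then obtain a where a: "a \<in> ?m" "h a = \<one>\<^bsub>B\<^esub>" by auto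
    then have ac: "a \<in> carrier A" using mA(6) by auto
    have "\<one>\<^bsub>A\<^esub> \<ominus>\<^bsub>A\<^esub> a \<notin> ?m"
    proof
      assume "\<one>\<^bsub>A\<^esub> \<ominus>\<^bsub>A\<^esub> a \<in> ?m"
      then have "\<one>\<^bsub>A\<^esub> \<ominus>\<^bsub>A\<^esub> a \<oplus>\<^bsub>A\<^esub> a \<in> ?m" using mA(3) a by auto
      moreover have "\<one>\<^bsub>A\<^esub> \<ominus>\<^bsub>A\<^esub> a \<oplus>\<^bsub>A\<^esub> a = \<one>\<^bsub>A\<^esub>" using ac by algebra
      ultimately show False using A.primeD(3)[OF A.prime_max_ideal] by auto
    qed
    then obtain v where v: "v \<in> carrier A" "v \<otimes>\<^bsub>A\<^esub> (\<one>\<^bsub>A\<^esub> \<ominus>\<^bsub>A\<^esub> a) = \<one>\<^bsub>A\<^esub>"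
      using A.unit_outside[of "\<one>\<^bsub>A\<^esub> \<ominus>\<^bsub>A\<^esub> a"] ac by auto
    have "\<one>\<^bsub>B\<^esub> = h (v \<otimes>\<^bsub>A\<^esub> (\<one>\<^bsub>A\<^esub> \<ominus>\<^bsub>A\<^esub> a))" using v by simp
    also have "\<dots> = \<zero>\<^bsub>B\<^esub>" using v(1) ac a(2) by (simp add: a_minus_def B.r_neg)
    finally show False using nz by simp
  qed
  have max: "maximalideal ?N B"
  proof (rule maximalidealI[OF Ni])
    show "carrier B \<noteq> ?N" using one by auto
    show "J = ?N \<or> J = carrier B" if J: "ideal J B" "?N \<subseteq> J" "J \<subseteq> carrier B" for J
    proof (cases "\<one>\<^bsub>B\<^esub> \<in> J")
      case True
      then show ?thesis using ideal.one_imp_carrier[OF J(1)] by simp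
    next
      case False
      then show ?thesis using sub[OF J(1)] J(2) by simp
    qed
  qed
  have uniq: "M = ?N" if M: "maximalideal M B" for M
  proof -
    have Mi: "ideal M B" "carrier B \<noteq> M" using maximalideal.axioms(1)[OF M] maximalideal.I_notcarr[OF M] by auto
    then have "M \<subseteq> ?N" using sub ideal.one_imp_carrier by blast
    then show ?thesis using maximalideal.I_maximal[OF M Ni] B.idealD(1)[OF Ni] one by auto
  qed
  show "noetherian_local_ring B"
    unfolding noetherian_local_ring_def noetherian_local_ring_axioms_def noetherian_cring_def
    using B noeth max uniq by blast
  show "max_ideal B = ?N" unfolding max_ideal_def[of B] using max uniq by (rule the_equality)
qed

lemma (in abelian_group) minus_telescope:
  assumes "a \<in> carrier G" "b \<in> carrier G" "c \<in> carrier G"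
  shows "(a \<ominus> b) \<oplus> (b \<ominus> c) = a \<ominus> c"
  using assms by (simp add: minus_eq a_assoc r_neg1)

text \<open>Every law of \<open>M'\<close> is checked on preimages under \<open>g\<close> and
  \<open>h\<close>. \<open>g_zero\<close> is an assumption of its own, since preservation of sums
  determines the zero field of \<open>M'\<close> only once \<open>M'\<close> is known to be a
  group.\<close>

lemma module_image:
  assumes M: "module B M" and B': "cring B'" and h: "h \<in> ring_hom B B'" "h ` carrier B = carrier B'"
    and g: "g ` carrier M = carrier M'"
    and add: "\<And>u v. u \<in> carrier M \<Longrightarrow> v \<in> carrier M \<Longrightarrow> g (u \<oplus>\<^bsub>M\<^esub> v) = g u \<oplus>\<^bsub>M'\<^esub> g v"
    and smult: "\<And>r u. r \<in> carrier B \<Longrightarrow> u \<in> carrier M \<Longrightarrow> g (r \<odot>\<^bsub>M\<^esub> u) = h r \<odot>\<^bsub>M'\<^esub> g u"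
    and g_zero: "g \<zero>\<^bsub>M\<^esub> = \<zero>\<^bsub>M'\<^esub>"
  shows "module B' M'"
proof -
  interpret M: module B M by fact
  interpret ring_hom_cring B B' h
    by (intro ring_hom_cring.intro M.is_cring B' ring_hom_cring_axioms.intro h(1))
  have gc: "g u \<in> carrier M'" if "u \<in> carrier M" for u using g that by auto
  have exM: "\<exists>u\<in>carrier M. x = g u" if "x \<in> carrier M'" for x using that g by auto
  have exB: "\<exists>r\<in>carrier B. x = h r" if "x \<in> carrier B'" for x using that h(2) by auto
  have "abelian_group M'"
  proof (rule abelian_groupI)
    fix x y assume "x \<in> carrier M'" "y \<in> carrier M'"
    then obtain u v where "u \<in> carrier M" "v \<in> carrier M" "x = g u" "y = g v" using exM by metis
    then show "x \<oplus>\<^bsub>M'\<^esub> y \<in> carrier M'" "x \<oplus>\<^bsub>M'\<^esub> y = y \<oplus>\<^bsub>M'\<^esub> x"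
      using gc by (simp_all flip: add add: M.a_comm)
  next
    show "\<zero>\<^bsub>M'\<^esub> \<in> carrier M'" using gc g_zero M.zero_closed by metis
  next
    fix x y z assume "x \<in> carrier M'" "y \<in> carrier M'" "z \<in> carrier M'"
    then obtain u v w where "u \<in> carrier M" "v \<in> carrier M" "w \<in> carrier M" "x = g u" "y = g v" "z = g w" 
      using exM by metis
    then show "x \<oplus>\<^bsub>M'\<^esub> y \<oplus>\<^bsub>M'\<^esub> z = x \<oplus>\<^bsub>M'\<^esub> (y \<oplus>\<^bsub>M'\<^esub> z)"
      by (simp flip: add add: M.a_assoc)
  next
    fix x assume "x \<in> carrier M'"
    then obtain u where u: "u \<in> carrier M" "x = g u" using exM by metis
    then show "\<zero>\<^bsub>M'\<^esub> \<oplus>\<^bsub>M'\<^esub> x = x" by (simp flip: add g_zero)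
    have "g (\<ominus>\<^bsub>M\<^esub> u) \<oplus>\<^bsub>M'\<^esub> x = \<zero>\<^bsub>M'\<^esub>" using u by (simp flip: add g_zero add: M.l_neg)
    then show "\<exists>y\<in>carrier M'. y \<oplus>\<^bsub>M'\<^esub> x = \<zero>\<^bsub>M'\<^esub>" using gc u by auto
  qed
  then show ?thesis
  proof (rule moduleI[OF B'])
    fix a x assume "a \<in> carrier B'" "x \<in> carrier M'"
    then obtain r u where "r \<in> carrier B" "u \<in> carrier M" "a = h r" "x = g u" using exB exM by metis
    then show "a \<odot>\<^bsub>M'\<^esub> x \<in> carrier M'" using gc by (simp flip: smult)
  next
    fix a b x assume "a \<in> carrier B'" "b \<in> carrier B'" "x \<in> carrier M'"
    then obtain r s u where "r \<in> carrier B" "s \<in> carrier B" "u \<in> carrier M" "a = h r" "b = h s" "x = g u"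
      using exB exM by metis
    then show "(a \<oplus>\<^bsub>B'\<^esub> b) \<odot>\<^bsub>M'\<^esub> x = a \<odot>\<^bsub>M'\<^esub> x \<oplus>\<^bsub>M'\<^esub> b \<odot>\<^bsub>M'\<^esub> x"
      "(a \<otimes>\<^bsub>B'\<^esub> b) \<odot>\<^bsub>M'\<^esub> x = a \<odot>\<^bsub>M'\<^esub> (b \<odot>\<^bsub>M'\<^esub> x)"
      by (simp_all flip: smult add hom_add hom_mult add: M.smult_l_distr M.smult_assoc1)
  next
    fix a x y assume "a \<in> carrier B'" "x \<in> carrier M'" "y \<in> carrier M'"
    then obtain r u v where "r \<in> carrier B" "u \<in> carrier M" "v \<in> carrier M" "a = h r" "x = g u" "y = g v"
      using exB exM by metis
    then show "a \<odot>\<^bsub>M'\<^esub> (x \<oplus>\<^bsub>M'\<^esub> y) = a \<odot>\<^bsub>M'\<^esub> x \<oplus>\<^bsub>M'\<^esub> a \<odot>\<^bsub>M'\<^esub> y"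
      by (simp flip: smult add add: M.smult_r_distr)
  next
    fix x assume "x \<in> carrier M'"
    then obtain u where "u \<in> carrier M" "x = g u" using exM by metis
    then show "\<one>\<^bsub>B'\<^esub> \<odot>\<^bsub>M'\<^esub> x = x" by (simp flip: smult hom_one)
  qed
qed

text \<open>A map choosing one representative of each coset carries \<open>R/I\<close> back to the
  type of \<open>R\<close>, where a property over fixed types can be applied. The map is constant on
  cosets, so \<open>the_elem\<close> of the image of a coset is its value at any element.\<close>

lemma (in cring) exists_quotient_ring:
  assumes I: "ideal I R"
  obtains R' :: "'a ring" and h where "cring R'" "h \<in> ring_hom R R'" "h ` carrier R = carrier R'"
    "\<And>a b. a \<in> carrier R \<Longrightarrow> b \<in> carrier R \<Longrightarrow> h a = h b \<longleftrightarrow> a \<ominus> b \<in> I"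
    "(\<lambda>C. the_elem (h ` C)) \<in> ring_iso (R Quot I) R'"
    "\<And>a. a \<in> carrier R \<Longrightarrow> the_elem (h ` (I +> a)) = h a"
proof -
  interpret I: ideal I R by fact
  define h where "h a = (SOME b. b \<in> I +> a)" for a
  have eq: "h a = h b \<longleftrightarrow> a \<ominus> b \<in> I" if ab: "a \<in> carrier R" "b \<in> carrier R" for a b
  proof -
    have sm: "h c \<in> I +> c" if "c \<in> carrier R" for c
      unfolding h_def using someI[of "\<lambda>b. b \<in> I +> c", OF I.a_rcos_self[OF that]] .
    have "I +> a = I +> b" if "h a = h b"
      using I.a_repr_independence' sm ab that by metis
    then have "h a = h b \<longleftrightarrow> I +> a = I +> b" unfolding h_def by auto
    then show ?thesis using quotient_eq_iff_same_a_r_cos[OF I ab] by simp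
  qed
  have w: "weak_ring_morphism h I R" by (rule weak_ring_morphismI[OF I eq])
  let ?R = "image_ring h R"
  interpret R': ring ?R using image_ring_is_ring[OF w] .
  have hom: "h \<in> ring_hom R ?R" using weak_ring_morphism_is_hom[OF w] .
  have surj: "h ` carrier R = carrier ?R" by (simp add: image_ring_carrier)
  have cr: "cring ?R"
  proof (intro cring.intro comm_monoid.intro comm_monoid_axioms.intro R'.ring_axioms R'.is_monoid)
    fix x y assume "x \<in> carrier ?R" "y \<in> carrier ?R"
    then obtain a b where ab: "a \<in> carrier R" "b \<in> carrier R" "x = h a" "y = h b" using surj by (metis imageE)
    then show "x \<otimes>\<^bsub>?R\<^esub> y = y \<otimes>\<^bsub>?R\<^esub> x" using ring_hom_mult[OF hom] m_comm[of a b] by metis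
  qed
  have elem: "the_elem (h ` (I +> a)) = h a" if "a \<in> carrier R" for a
    using weak_ring_morphism_range[OF w that] by simp
  show ?thesis by (rule that[OF cr hom surj eq weak_ring_morphism_is_iso[OF w] elem])
qed


section \<open>Cosets of the submodule \<open>x M\<close>\<close>

context module
begin

lemma smult_image_coset_mem:
  assumes "x \<in> carrier R" "u \<in> carrier M"
  shows "w \<in> (\<odot>\<^bsub>M\<^esub>) x ` carrier M +>\<^bsub>M\<^esub> u \<longleftrightarrow> w \<in> carrier M \<and> w \<ominus>\<^bsub>M\<^esub> u \<in> (\<odot>\<^bsub>M\<^esub>) x ` carrier M"
proof
  assume "w \<in> (\<odot>\<^bsub>M\<^esub>) x ` carrier M +>\<^bsub>M\<^esub> u"
  then obtain v where v: "v \<in> carrier M" "w = x \<odot>\<^bsub>M\<^esub> v \<oplus>\<^bsub>M\<^esub> u" unfolding a_r_coset_def' by auto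
  then have "w \<ominus>\<^bsub>M\<^esub> u = x \<odot>\<^bsub>M\<^esub> v" using assms by (simp add: M.minus_eq M.a_assoc M.r_neg)
  then show "w \<in> carrier M \<and> w \<ominus>\<^bsub>M\<^esub> u \<in> (\<odot>\<^bsub>M\<^esub>) x ` carrier M" using v assms by auto
next
  assume "w \<in> carrier M \<and> w \<ominus>\<^bsub>M\<^esub> u \<in> (\<odot>\<^bsub>M\<^esub>) x ` carrier M"
  moreover from this have "w = (w \<ominus>\<^bsub>M\<^esub> u) \<oplus>\<^bsub>M\<^esub> u" using assms by (simp add: M.minus_eq M.a_assoc M.l_neg)
  ultimately show "w \<in> (\<odot>\<^bsub>M\<^esub>) x ` carrier M +>\<^bsub>M\<^esub> u" unfolding a_r_coset_def' by blast
qed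

lemma smult_image_diff:
  assumes "x \<in> carrier R"
  shows "\<zero>\<^bsub>M\<^esub> \<in> (\<odot>\<^bsub>M\<^esub>) x ` carrier M"
    "\<And>a b. a \<in> (\<odot>\<^bsub>M\<^esub>) x ` carrier M \<Longrightarrow> b \<in> (\<odot>\<^bsub>M\<^esub>) x ` carrier M \<Longrightarrow> a \<oplus>\<^bsub>M\<^esub> b \<in> (\<odot>\<^bsub>M\<^esub>) x ` carrier M"
    "\<And>a. a \<in> (\<odot>\<^bsub>M\<^esub>) x ` carrier M \<Longrightarrow> \<ominus>\<^bsub>M\<^esub> a \<in> (\<odot>\<^bsub>M\<^esub>) x ` carrier M"
    "\<And>a r. r \<in> carrier R \<Longrightarrow> a \<in> (\<odot>\<^bsub>M\<^esub>) x ` carrier M \<Longrightarrow> r \<odot>\<^bsub>M\<^esub> a \<in> (\<odot>\<^bsub>M\<^esub>) x ` carrier M"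
proof -
  let ?N = "(\<odot>\<^bsub>M\<^esub>) x ` carrier M"
  have "\<zero>\<^bsub>M\<^esub> = x \<odot>\<^bsub>M\<^esub> \<zero>\<^bsub>M\<^esub>" using assms by simp
  then show "\<zero>\<^bsub>M\<^esub> \<in> ?N" by blast
  show "a \<oplus>\<^bsub>M\<^esub> b \<in> ?N" if ab: "a \<in> ?N" "b \<in> ?N" for a b
  proof -
    obtain u v where "u \<in> carrier M" "v \<in> carrier M" "a = x \<odot>\<^bsub>M\<^esub> u" "b = x \<odot>\<^bsub>M\<^esub> v" using ab by auto
    then have "a \<oplus>\<^bsub>M\<^esub> b = x \<odot>\<^bsub>M\<^esub> (u \<oplus>\<^bsub>M\<^esub> v)" "u \<oplus>\<^bsub>M\<^esub> v \<in> carrier M" using assms by (auto simp: smult_r_distr)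
    then show ?thesis by blast
  qed
  show "\<ominus>\<^bsub>M\<^esub> a \<in> ?N" if a: "a \<in> ?N" for a
  proof -
    obtain u where "u \<in> carrier M" "a = x \<odot>\<^bsub>M\<^esub> u" using a by auto
    then have "\<ominus>\<^bsub>M\<^esub> a = x \<odot>\<^bsub>M\<^esub> (\<ominus>\<^bsub>M\<^esub> u)" "\<ominus>\<^bsub>M\<^esub> u \<in> carrier M" using assms by (auto simp: smult_r_minus)
    then show ?thesis by blast
  qed
  show "r \<odot>\<^bsub>M\<^esub> a \<in> ?N" if ra: "r \<in> carrier R" "a \<in> ?N" for a r
  proof -
    obtain u where u: "u \<in> carrier M" "a = x \<odot>\<^bsub>M\<^esub> u" using ra by auto
    have "r \<odot>\<^bsub>M\<^esub> (x \<odot>\<^bsub>M\<^esub> u) = x \<odot>\<^bsub>M\<^esub> (r \<odot>\<^bsub>M\<^esub> u)"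
      using u(1) ra(1) assms by (simp flip: smult_assoc1 add: R.m_comm)
    then show ?thesis using u ra(1) by auto
  qed
qed

lemma smult_image_coset_eq:
  assumes x: "x \<in> carrier R" and uv: "u \<in> carrier M" "v \<in> carrier M"
  shows "(\<odot>\<^bsub>M\<^esub>) x ` carrier M +>\<^bsub>M\<^esub> u = (\<odot>\<^bsub>M\<^esub>) x ` carrier M +>\<^bsub>M\<^esub> v \<longleftrightarrow> u \<ominus>\<^bsub>M\<^esub> v \<in> (\<odot>\<^bsub>M\<^esub>) x ` carrier M"
proof
  let ?N = "(\<odot>\<^bsub>M\<^esub>) x ` carrier M"
  note N = smult_image_diff[OF x]
  have "u \<ominus>\<^bsub>M\<^esub> u \<in> ?N" using uv N(1) by (simp add: M.minus_eq M.r_neg)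
  moreover assume "?N +>\<^bsub>M\<^esub> u = ?N +>\<^bsub>M\<^esub> v"
  ultimately show "u \<ominus>\<^bsub>M\<^esub> v \<in> ?N" 
    using smult_image_coset_mem[OF x uv(1), of u] smult_image_coset_mem[OF x uv(2), of u] uv by auto
next
  let ?N = "(\<odot>\<^bsub>M\<^esub>) x ` carrier M"
  note N = smult_image_diff[OF x]
  assume d: "u \<ominus>\<^bsub>M\<^esub> v \<in> ?N"
  have iff: "w \<ominus>\<^bsub>M\<^esub> u \<in> ?N \<longleftrightarrow> w \<ominus>\<^bsub>M\<^esub> v \<in> ?N" if w: "w \<in> carrier M" for w
  proof -
    note tele = M.minus_telescope
    have "v \<ominus>\<^bsub>M\<^esub> u = \<ominus>\<^bsub>M\<^esub> (u \<ominus>\<^bsub>M\<^esub> v)" using uv by (simp add: M.minus_eq M.minus_add M.a_comm)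
    then have "v \<ominus>\<^bsub>M\<^esub> u \<in> ?N" using N(3)[OF d] by simp
    then show ?thesis
      using N(2)[of "w \<ominus>\<^bsub>M\<^esub> u", OF _ d] N(2)[of "w \<ominus>\<^bsub>M\<^esub> v" "v \<ominus>\<^bsub>M\<^esub> u"] tele[OF w uv] tele[OF w uv(2,1)]
      by (intro iffI) (simp_all only:)
  qed
  show "?N +>\<^bsub>M\<^esub> u = ?N +>\<^bsub>M\<^esub> v"
  proof (rule Set.set_eqI)
    fix w
    show "w \<in> ?N +>\<^bsub>M\<^esub> u \<longleftrightarrow> w \<in> ?N +>\<^bsub>M\<^esub> v"
      unfolding smult_image_coset_mem[OF x uv(1)] smult_image_coset_mem[OF x uv(2)]
      using iff[of w] by (rule conj_cong[OF refl])
  qed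
qed

end

text \<open>The module analogue of \<open>exists_quotient_ring\<close>, and tied to it:
  \<open>g\<close> replaces vectors by coset representatives, while a scalar of \<open>R'\<close>
  acts through a lift to \<open>R\<close>. The last conclusion is exactly the isomorphism over which
  \<open>star_property\<close> quantifies.\<close>

lemma exists_quotient_module:
  fixes R :: "'a ring" and M :: "('a, 'b) module"
  assumes mod: "module R M" and x: "x \<in> carrier R"
  obtains R' :: "'a ring" and M' :: "('a, 'b) module" and h g where
    "cring R'" "h \<in> ring_hom R R'" "h ` carrier R = carrier R'"
    "\<And>a. a \<in> carrier R \<Longrightarrow> h a = \<zero>\<^bsub>R'\<^esub> \<longleftrightarrow> a \<in> PIdl\<^bsub>R\<^esub> x"
    "module R' M'" "g ` carrier M = carrier M'"
    "\<And>u v. u \<in> carrier M \<Longrightarrow> v \<in> carrier M \<Longrightarrow> g (u \<oplus>\<^bsub>M\<^esub> v) = g u \<oplus>\<^bsub>M'\<^esub> g v"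
    "\<And>r u. r \<in> carrier R \<Longrightarrow> u \<in> carrier M \<Longrightarrow> g (r \<odot>\<^bsub>M\<^esub> u) = h r \<odot>\<^bsub>M'\<^esub> g u"
    "\<And>u. u \<in> carrier M \<Longrightarrow> g u = \<zero>\<^bsub>M'\<^esub> \<longleftrightarrow> u \<in> (\<odot>\<^bsub>M\<^esub>) x ` carrier M"
    "ring_module_isomorphic (R Quot (PIdl\<^bsub>R\<^esub> x)) (quotient_module R M x) R' M'"
proof -
  interpret module R M by fact
  let ?I = "PIdl\<^bsub>R\<^esub> x" and ?N = "(\<odot>\<^bsub>M\<^esub>) x ` carrier M"
  have I: "ideal ?I R" using R.cgenideal_ideal[OF x] .
  note N = smult_image_diff[OF x]
  have Nsub: "?N \<subseteq> carrier M" using x by auto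
  obtain R' :: "'a ring" and h where R': "cring R'" "h \<in> ring_hom R R'" "h ` carrier R = carrier R'"
    and h_eq: "\<And>a b. a \<in> carrier R \<Longrightarrow> b \<in> carrier R \<Longrightarrow> h a = h b \<longleftrightarrow> a \<ominus>\<^bsub>R\<^esub> b \<in> ?I"
    and iso: "(\<lambda>C. the_elem (h ` C)) \<in> ring_iso (R Quot ?I) R'"
    and h_coset: "\<And>a. a \<in> carrier R \<Longrightarrow> the_elem (h ` (?I +>\<^bsub>R\<^esub> a)) = h a"
    by (rule R.exists_quotient_ring[OF I]) (rule that; assumption)
  interpret ring_hom_cring R R' h
    by (intro ring_hom_cring.intro R.is_cring R' ring_hom_cring_axioms.intro)
  have h0: "h a = \<zero>\<^bsub>R'\<^esub> \<longleftrightarrow> a \<in> ?I" if "a \<in> carrier R" for a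
    using h_eq[OF that R.zero_closed] that hom_zero by (simp add: R.minus_eq)
  define g where "g u = (SOME w. w \<in> ?N +>\<^bsub>M\<^esub> u)" for u
  have g_in: "g u \<in> ?N +>\<^bsub>M\<^esub> u" if "u \<in> carrier M" for u
  proof -
    have "u \<in> ?N +>\<^bsub>M\<^esub> u" using smult_image_coset_mem[OF x that] N(1) that by (simp add: M.minus_eq M.r_neg)
    then show ?thesis unfolding g_def by (rule someI)
  qed
  then have g_mem: "g u \<in> carrier M" "g u \<ominus>\<^bsub>M\<^esub> u \<in> ?N" if "u \<in> carrier M" for u
    using smult_image_coset_mem[OF x that] that by auto
  have g_coset: "?N +>\<^bsub>M\<^esub> g u = ?N +>\<^bsub>M\<^esub> u" if "u \<in> carrier M" for u
    using smult_image_coset_eq[OF x g_mem(1) that] g_mem(2) that by simp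
  have g_eq: "g u = g v \<longleftrightarrow> u \<ominus>\<^bsub>M\<^esub> v \<in> ?N" if "u \<in> carrier M" "v \<in> carrier M" for u v
  proof -
    have "?N +>\<^bsub>M\<^esub> u = ?N +>\<^bsub>M\<^esub> v" if "g u = g v"
      using g_coset[OF \<open>u \<in> carrier M\<close>] g_coset[OF \<open>v \<in> carrier M\<close>] that by simp
    moreover have "g u = g v" if "?N +>\<^bsub>M\<^esub> u = ?N +>\<^bsub>M\<^esub> v" unfolding g_def that ..
    ultimately show ?thesis using smult_image_coset_eq[OF x that] by blast
  qed
  \<comment> \<open>A section of \<open>h\<close>. Two lifts of a scalar differ by a multiple of
    \<open>x\<close>, so the choice does not matter modulo \<open>?N\<close>.\<close>
  define s where "s a = (SOME b. b \<in> carrier R \<and> h b = a)" for a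
  have s: "s a \<in> carrier R" "h (s a) = a" if "a \<in> carrier R'" for a
  proof -
    have "a \<in> h ` carrier R" using that R'(3) by simp
    then have "\<exists>b. b \<in> carrier R \<and> h b = a" by blast
    then have "s a \<in> carrier R \<and> h (s a) = a" unfolding s_def by (rule someI_ex)
    then show "s a \<in> carrier R" "h (s a) = a" by auto
  qed
  define M' :: "('a, 'b) module" where "M' = \<lparr>carrier = g ` carrier M, monoid.mult = undefined, monoid.one = undefined,
    ring.zero = g \<zero>\<^bsub>M\<^esub>, ring.add = (\<lambda>u v. g (u \<oplus>\<^bsub>M\<^esub> v)), smult = (\<lambda>r u. g (s r \<odot>\<^bsub>M\<^esub> u))\<rparr>"
  have surj: "g ` carrier M = carrier M'" unfolding M'_def by simp
  have add: "g (u \<oplus>\<^bsub>M\<^esub> v) = g u \<oplus>\<^bsub>M'\<^esub> g v" if uv: "u \<in> carrier M" "v \<in> carrier M" for u v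
  proof -
    note c = g_mem(1)[OF uv(1)] g_mem(1)[OF uv(2)]
    have "(g u \<oplus>\<^bsub>M\<^esub> g v) \<ominus>\<^bsub>M\<^esub> (u \<oplus>\<^bsub>M\<^esub> v) = (g u \<ominus>\<^bsub>M\<^esub> u) \<oplus>\<^bsub>M\<^esub> (g v \<ominus>\<^bsub>M\<^esub> v)"
      using c uv by (simp add: M.minus_eq M.minus_add M.a_ac)
    then have "(g u \<oplus>\<^bsub>M\<^esub> g v) \<ominus>\<^bsub>M\<^esub> (u \<oplus>\<^bsub>M\<^esub> v) \<in> ?N" using N(2) g_mem(2) uv by simp
    then have "g (g u \<oplus>\<^bsub>M\<^esub> g v) = g (u \<oplus>\<^bsub>M\<^esub> v)"
      by (rule g_eq[THEN iffD2, rotated 2]) (use c uv in auto)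
    then show ?thesis unfolding M'_def by simp
  qed
  have smult: "g (r \<odot>\<^bsub>M\<^esub> u) = h r \<odot>\<^bsub>M'\<^esub> g u" if ru: "r \<in> carrier R" "u \<in> carrier M" for r u
  proof -
    let ?r = "s (h r)"
    have r: "?r \<in> carrier R" "h ?r = h r" using s[of "h r"] ru by auto
    then have "?r \<ominus>\<^bsub>R\<^esub> r \<in> ?I" using h_eq ru by simp
    then obtain b where b: "b \<in> carrier R" "?r \<ominus>\<^bsub>R\<^esub> r = b \<otimes>\<^bsub>R\<^esub> x" unfolding cgenideal_def by auto
    \<comment> \<open>The error \<open>?r (g u) - r u\<close> splits into
      \<open>?r (g u - u)\<close> and \<open>(?r - r) u\<close>. Both lie in \<open>?N\<close>, one
      because \<open>g u\<close> represents the coset of \<open>u\<close>, the other because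
      \<open>?r\<close> and \<open>r\<close> have the same image under \<open>h\<close>.\<close>
    note c = g_mem(1)[OF ru(2)]
    have "(?r \<ominus>\<^bsub>R\<^esub> r) \<odot>\<^bsub>M\<^esub> u = x \<odot>\<^bsub>M\<^esub> (b \<odot>\<^bsub>M\<^esub> u)"
      unfolding b(2) using b(1) x ru(2) R.m_comm[of b x] by (simp flip: smult_assoc1)
    then have 1: "(?r \<ominus>\<^bsub>R\<^esub> r) \<odot>\<^bsub>M\<^esub> u \<in> ?N" using b(1) ru(2) by auto
    have 2: "?r \<odot>\<^bsub>M\<^esub> (g u \<ominus>\<^bsub>M\<^esub> u) \<in> ?N" using N(4)[OF r(1)] g_mem(2)[OF ru(2)] by auto
    have "?r \<odot>\<^bsub>M\<^esub> g u \<ominus>\<^bsub>M\<^esub> r \<odot>\<^bsub>M\<^esub> u = ?r \<odot>\<^bsub>M\<^esub> (g u \<ominus>\<^bsub>M\<^esub> u) \<oplus>\<^bsub>M\<^esub> (?r \<ominus>\<^bsub>R\<^esub> r) \<odot>\<^bsub>M\<^esub> u"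
    proof -
      have "?r \<odot>\<^bsub>M\<^esub> (g u \<ominus>\<^bsub>M\<^esub> u) = ?r \<odot>\<^bsub>M\<^esub> g u \<ominus>\<^bsub>M\<^esub> ?r \<odot>\<^bsub>M\<^esub> u"
        using r(1) ru c by (simp add: M.minus_eq smult_r_distr smult_r_minus)
      moreover have "(?r \<ominus>\<^bsub>R\<^esub> r) \<odot>\<^bsub>M\<^esub> u = ?r \<odot>\<^bsub>M\<^esub> u \<ominus>\<^bsub>M\<^esub> r \<odot>\<^bsub>M\<^esub> u"
        using r(1) ru by (simp add: M.minus_eq R.minus_eq smult_l_distr smult_l_minus)
      ultimately show ?thesis using M.minus_telescope[of "?r \<odot>\<^bsub>M\<^esub> g u" "?r \<odot>\<^bsub>M\<^esub> u" "r \<odot>\<^bsub>M\<^esub> u"] r(1) ru c by simp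
    qed
    then have "?r \<odot>\<^bsub>M\<^esub> g u \<ominus>\<^bsub>M\<^esub> r \<odot>\<^bsub>M\<^esub> u \<in> ?N" using N(2)[OF 2 1] by simp
    then have "g (?r \<odot>\<^bsub>M\<^esub> g u) = g (r \<odot>\<^bsub>M\<^esub> u)"
      by (rule g_eq[THEN iffD2, rotated 2]) (use c ru r(1) in auto)
    then show ?thesis unfolding M'_def by simp
  qed
  have modM': "module R' M'"
    by (rule module_image[OF mod R'(1-3) surj add smult]) (simp_all add: M'_def)
  have g0: "g u = \<zero>\<^bsub>M'\<^esub> \<longleftrightarrow> u \<in> ?N" if "u \<in> carrier M" for u
  proof -
    have "\<ominus>\<^bsub>M\<^esub> \<zero>\<^bsub>M\<^esub> = \<zero>\<^bsub>M\<^esub>" using M.r_neg[OF M.zero_closed] by simp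
    then have "u \<ominus>\<^bsub>M\<^esub> \<zero>\<^bsub>M\<^esub> = u" using that by (simp add: M.minus_eq)
    then show ?thesis using g_eq[OF that M.zero_closed] unfolding M'_def by simp
  qed
  define \<psi> where "\<psi> C = the_elem (g ` C)" for C
  have \<psi>: "\<psi> (?N +>\<^bsub>M\<^esub> u) = g u" if u: "u \<in> carrier M" for u
  proof -
    have "g w = g u" if "w \<in> ?N +>\<^bsub>M\<^esub> u" for w
    proof -
      have "w \<in> carrier M" "w \<ominus>\<^bsub>M\<^esub> u \<in> ?N" using smult_image_coset_mem[OF x u] that by simp_all
      then show ?thesis using g_eq[OF _ u] by simp
    qed
    moreover have "g u \<in> ?N +>\<^bsub>M\<^esub> u" using g_in[OF u] .
    ultimately have "g ` (?N +>\<^bsub>M\<^esub> u) = {g u}" by auto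
    then show ?thesis unfolding \<psi>_def by simp
  qed
  let ?Q = "quotient_module R M x"
  have Qc: "carrier ?Q = (\<lambda>u. ?N +>\<^bsub>M\<^esub> u) ` carrier M"
    unfolding quotient_module_def Let_def A_RCOSETS_def' by auto
  have Qadd: "(?N +>\<^bsub>M\<^esub> u) \<oplus>\<^bsub>?Q\<^esub> (?N +>\<^bsub>M\<^esub> v) = ?N +>\<^bsub>M\<^esub> (u \<oplus>\<^bsub>M\<^esub> v)"
    if uv: "u \<in> carrier M" "v \<in> carrier M" for u v
  proof -
    have "(?N +>\<^bsub>M\<^esub> u) \<oplus>\<^bsub>?Q\<^esub> (?N +>\<^bsub>M\<^esub> v) = set_add M (?N +>\<^bsub>M\<^esub> u) (?N +>\<^bsub>M\<^esub> v)"
      unfolding quotient_module_def Let_def by simp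
    also have "\<dots> = ?N +>\<^bsub>M\<^esub> (u \<oplus>\<^bsub>M\<^esub> v)"
    proof
      show "set_add M (?N +>\<^bsub>M\<^esub> u) (?N +>\<^bsub>M\<^esub> v) \<subseteq> ?N +>\<^bsub>M\<^esub> (u \<oplus>\<^bsub>M\<^esub> v)"
      proof
        fix w assume "w \<in> set_add M (?N +>\<^bsub>M\<^esub> u) (?N +>\<^bsub>M\<^esub> v)"
        then obtain a b where ab: "a \<in> ?N" "b \<in> ?N" "w = (a \<oplus>\<^bsub>M\<^esub> u) \<oplus>\<^bsub>M\<^esub> (b \<oplus>\<^bsub>M\<^esub> v)"
          unfolding set_add_def' a_r_coset_def' by blast
        then have "a \<in> carrier M" "b \<in> carrier M" using Nsub by auto
        then have "w = (a \<oplus>\<^bsub>M\<^esub> b) \<oplus>\<^bsub>M\<^esub> (u \<oplus>\<^bsub>M\<^esub> v)" using ab(3) uv by (simp add: M.a_ac)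
        then show "w \<in> ?N +>\<^bsub>M\<^esub> (u \<oplus>\<^bsub>M\<^esub> v)" using N(2)[OF ab(1,2)] unfolding a_r_coset_def' by blast
      qed
      show "?N +>\<^bsub>M\<^esub> (u \<oplus>\<^bsub>M\<^esub> v) \<subseteq> set_add M (?N +>\<^bsub>M\<^esub> u) (?N +>\<^bsub>M\<^esub> v)"
      proof
        fix w assume "w \<in> ?N +>\<^bsub>M\<^esub> (u \<oplus>\<^bsub>M\<^esub> v)"
        then obtain a where a: "a \<in> ?N" "w = a \<oplus>\<^bsub>M\<^esub> (u \<oplus>\<^bsub>M\<^esub> v)" unfolding a_r_coset_def' by blast
        then have "a \<in> carrier M" using Nsub by auto
        then have "w = (a \<oplus>\<^bsub>M\<^esub> u) \<oplus>\<^bsub>M\<^esub> (\<zero>\<^bsub>M\<^esub> \<oplus>\<^bsub>M\<^esub> v)" using a(2) uv by (simp add: M.a_assoc)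
        then show "w \<in> set_add M (?N +>\<^bsub>M\<^esub> u) (?N +>\<^bsub>M\<^esub> v)"
          using a(1) N(1) unfolding set_add_def' a_r_coset_def' by blast
      qed
    qed
    finally show ?thesis .
  qed
  have Qsmult: "(?I +>\<^bsub>R\<^esub> r) \<odot>\<^bsub>?Q\<^esub> (?N +>\<^bsub>M\<^esub> u) = ?N +>\<^bsub>M\<^esub> (r \<odot>\<^bsub>M\<^esub> u)"
    if ru: "r \<in> carrier R" "u \<in> carrier M" for r u
  proof -
    interpret I: ideal ?I R by fact
    have eq: "?N +>\<^bsub>M\<^esub> (a \<odot>\<^bsub>M\<^esub> w) = ?N +>\<^bsub>M\<^esub> (r \<odot>\<^bsub>M\<^esub> u)"
      if aw: "a \<in> ?I +>\<^bsub>R\<^esub> r" "w \<in> ?N +>\<^bsub>M\<^esub> u" for a w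
    proof -
      have ac: "a \<in> carrier R" using aw(1) ru I.a_subset R.a_r_coset_subset_G by blast
      have "?I +>\<^bsub>R\<^esub> a = ?I +>\<^bsub>R\<^esub> r" using I.a_repr_independence'[OF aw(1) ru(1)] by simp
      then have ha: "h a = h r" using h_coset[OF ac] h_coset[OF ru(1)] by simp
      have w: "w \<in> carrier M" "w \<ominus>\<^bsub>M\<^esub> u \<in> ?N" using smult_image_coset_mem[OF x ru(2)] aw(2) by auto
      have c: "a \<odot>\<^bsub>M\<^esub> w \<in> carrier M" "r \<odot>\<^bsub>M\<^esub> u \<in> carrier M" using ac w ru by auto
      have "g w = g u" using g_eq[OF w(1) ru(2)] w(2) by simp
      then have "g (a \<odot>\<^bsub>M\<^esub> w) = g (r \<odot>\<^bsub>M\<^esub> u)" using smult[OF ac w(1)] smult[OF ru] ha by simp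
      then show ?thesis using g_eq[OF c] smult_image_coset_eq[OF x c] by simp
    qed
    have r: "r \<in> ?I +>\<^bsub>R\<^esub> r" using I.a_rcos_self ru(1) .
    have u: "u \<in> ?N +>\<^bsub>M\<^esub> u" using smult_image_coset_mem[OF x ru(2)] N(1) ru(2) by (simp add: M.minus_eq M.r_neg)
    \<comment> \<open>All sets in the union of \<open>quotient_module\<close> are the same coset, so
      over nonempty index sets the union collapses to it.\<close>
    have const: "(\<Union>a\<in>S. \<Union>w\<in>T. Z) = Z" if "b \<in> S" "c \<in> T" for b c S T Z
      using that by auto
    have "(?I +>\<^bsub>R\<^esub> r) \<odot>\<^bsub>?Q\<^esub> (?N +>\<^bsub>M\<^esub> u) = (\<Union>a\<in>?I +>\<^bsub>R\<^esub> r. \<Union>w\<in>?N +>\<^bsub>M\<^esub> u. ?N +>\<^bsub>M\<^esub> (a \<odot>\<^bsub>M\<^esub> w))"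
      unfolding quotient_module_def Let_def by simp
    also have "\<dots> = (\<Union>a\<in>?I +>\<^bsub>R\<^esub> r. \<Union>w\<in>?N +>\<^bsub>M\<^esub> u. ?N +>\<^bsub>M\<^esub> (r \<odot>\<^bsub>M\<^esub> u))"
      by (intro SUP_cong refl eq)
    also have "\<dots> = ?N +>\<^bsub>M\<^esub> (r \<odot>\<^bsub>M\<^esub> u)" by (rule const[OF r u])
    finally show ?thesis .
  qed
  have "ring_module_isomorphic (R Quot ?I) ?Q R' M'"
    unfolding ring_module_isomorphic_def
  proof (intro bexI[OF _ iso] exI[of _ \<psi>] conjI ballI)
    show "bij_betw \<psi> (carrier ?Q) (carrier M')"
      unfolding bij_betw_def
    proof
      show "inj_on \<psi> (carrier ?Q)"
      proof (rule inj_onI)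
        fix C D assume CD: "C \<in> carrier ?Q" "D \<in> carrier ?Q" "\<psi> C = \<psi> D"
        then obtain u v where uv: "u \<in> carrier M" "v \<in> carrier M" "C = ?N +>\<^bsub>M\<^esub> u" "D = ?N +>\<^bsub>M\<^esub> v"
          unfolding Qc by blast
        then have "g u = g v" using CD(3) \<psi>[OF uv(1)] \<psi>[OF uv(2)] by simp
        then show "C = D" using g_eq[OF uv(1,2)] smult_image_coset_eq[OF x uv(1,2)] uv(3,4) by simp
      qed
      have "\<psi> ` carrier ?Q = (\<lambda>u. \<psi> (?N +>\<^bsub>M\<^esub> u)) ` carrier M" unfolding Qc image_image ..
      also have "\<dots> = g ` carrier M" by (rule image_cong[OF refl \<psi>])
      finally show "\<psi> ` carrier ?Q = carrier M'" unfolding surj .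
    qed
  next
    fix C D assume "C \<in> carrier ?Q" "D \<in> carrier ?Q"
    then obtain u v where uv: "u \<in> carrier M" "v \<in> carrier M" "C = ?N +>\<^bsub>M\<^esub> u" "D = ?N +>\<^bsub>M\<^esub> v"
      unfolding Qc by blast
    then show "\<psi> (C \<oplus>\<^bsub>?Q\<^esub> D) = \<psi> C \<oplus>\<^bsub>M'\<^esub> \<psi> D"
      using Qadd[OF uv(1,2)] \<psi>[OF uv(1)] \<psi>[OF uv(2)] \<psi>[OF M.a_closed[OF uv(1,2)]] add[OF uv(1,2)] by simp
  next
    fix r C assume r: "r \<in> carrier (R Quot ?I)" and C: "C \<in> carrier ?Q"
    obtain a where a: "a \<in> carrier R" "r = ?I +>\<^bsub>R\<^esub> a" using r unfolding FactRing_def A_RCOSETS_def' by auto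
    obtain u where u: "u \<in> carrier M" "C = ?N +>\<^bsub>M\<^esub> u" using C unfolding Qc by auto
    show "\<psi> (r \<odot>\<^bsub>?Q\<^esub> C) = the_elem (h ` r) \<odot>\<^bsub>M'\<^esub> \<psi> C"
      using Qsmult[OF a(1) u(1)] \<psi>[OF u(1)] \<psi>[OF smult_closed[OF a(1) u(1)]] smult[OF a(1) u(1)] h_coset[OF a(1)] a(2) u(2)
      by simp
  qed
  from that[OF R' h0 modM' surj add smult g0 this] show thesis .
qed

section \<open>Submodules spanned by an ideal, and coordinates of free modules\<close>

text \<open>The subgroup \<open>I U\<close> for a subset \<open>U\<close>, taken both for the whole
  carrier and for \<open>syz n\<close> inside \<open>F n\<close>. Generation by rules turns
  arguments about indexed sums into inductions; negation comes for free when \<open>I\<close> is an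
  ideal.\<close>

inductive_set ideal_span :: "'a set \<Rightarrow> ('a, 'b, 'm) module_scheme \<Rightarrow> 'b set \<Rightarrow> 'b set" for I M U where
  zero: "\<zero>\<^bsub>M\<^esub> \<in> ideal_span I M U"
| smult: "r \<in> I \<Longrightarrow> u \<in> U \<Longrightarrow> r \<odot>\<^bsub>M\<^esub> u \<in> ideal_span I M U"
| add: "v \<in> ideal_span I M U \<Longrightarrow> w \<in> ideal_span I M U \<Longrightarrow> v \<oplus>\<^bsub>M\<^esub> w \<in> ideal_span I M U"

lemma ideal_span_mono:
  assumes "I \<subseteq> J" "U \<subseteq> Y"
  shows "ideal_span I M U \<subseteq> ideal_span J M Y"
proof
  fix w assume "w \<in> ideal_span I M U"
  then show "w \<in> ideal_span J M Y"
    by induction (use assms in \<open>auto intro: ideal_span.intros\<close>)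
qed

text \<open>Syzygies are records \<open>F n\<close> with a smaller carrier, and the span reads only
  zero, addition and scalar multiplication.\<close>

lemma ideal_span_carrier_update: "ideal_span I (M\<lparr>carrier := Y\<rparr>) U = ideal_span I M U"
proof (intro equalityI subsetI)
  fix w assume "w \<in> ideal_span I (M\<lparr>carrier := Y\<rparr>) U"
  then show "w \<in> ideal_span I M U" by induction (auto intro: ideal_span.intros)
next
  fix w assume "w \<in> ideal_span I M U"
  then show "w \<in> ideal_span I (M\<lparr>carrier := Y\<rparr>) U"
  proof induction
    case zero
    show ?case using ideal_span.zero[of "M\<lparr>carrier := Y\<rparr>" I U] by simp
  next
    case (smult r u)
    then show ?case using ideal_span.smult[of r I u U "M\<lparr>carrier := Y\<rparr>"] by simp
  next
    case (add v w)
    then show ?case using ideal_span.add[of v I "M\<lparr>carrier := Y\<rparr>" U w] by simp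
  qed
qed

lemma module_HomD:
  assumes "f \<in> module_Hom R M N"
  shows "\<And>u. u \<in> carrier M \<Longrightarrow> f u \<in> carrier N"
    "\<And>u v. u \<in> carrier M \<Longrightarrow> v \<in> carrier M \<Longrightarrow> f (u \<oplus>\<^bsub>M\<^esub> v) = f u \<oplus>\<^bsub>N\<^esub> f v"
    "\<And>r u. r \<in> carrier R \<Longrightarrow> u \<in> carrier M \<Longrightarrow> f (r \<odot>\<^bsub>M\<^esub> u) = r \<odot>\<^bsub>N\<^esub> f u"
  using assms unfolding module_Hom_def by auto

context module
begin

lemma ideal_span_subset:
  assumes "ideal I R" "U \<subseteq> carrier M"
  shows "ideal_span I M U \<subseteq> carrier M"
proof
  fix w assume "w \<in> ideal_span I M U"
  then show "w \<in> carrier M"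
    by induction (use assms R.idealD(6)[OF assms(1)] in auto)
qed

lemma ideal_span_smult:
  assumes "ideal I R" "U \<subseteq> carrier M" "w \<in> ideal_span I M U" "a \<in> carrier R"
  shows "a \<odot>\<^bsub>M\<^esub> w \<in> ideal_span I M U"
  using assms(3)
proof induction
  case zero
  then show ?case using assms(4) ideal_span.zero by simp
next
  case (smult r u)
  then have "r \<in> carrier R" "u \<in> carrier M" using assms R.idealD(6) by auto
  then have "a \<odot>\<^bsub>M\<^esub> (r \<odot>\<^bsub>M\<^esub> u) = (a \<otimes> r) \<odot>\<^bsub>M\<^esub> u" using assms(4) by (simp add: smult_assoc1)
  then show ?case using ideal_span.smult[of "a \<otimes> r" I u U M] R.idealD(4)[OF assms(1) smult(1) assms(4)] smult(2) by simp
next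
  case (add v w)
  then show ?case
    using ideal_span_subset[OF assms(1,2)] assms(4) ideal_span.add by (simp add: smult_r_distr subset_iff)
qed

lemma ideal_span_uminus:
  assumes "ideal I R" "U \<subseteq> carrier M" "w \<in> ideal_span I M U"
  shows "\<ominus>\<^bsub>M\<^esub> w \<in> ideal_span I M U"
proof -
  have "w \<in> carrier M" using ideal_span_subset assms by auto
  then have "(\<ominus> \<one>) \<odot>\<^bsub>M\<^esub> w = \<ominus>\<^bsub>M\<^esub> w" by (simp add: smult_l_minus)
  then show ?thesis using ideal_span_smult[OF assms, of "\<ominus> \<one>"] by simp
qed

lemma ideal_span_zero:
  assumes "U \<subseteq> carrier M" "w \<in> ideal_span {\<zero>} M U"
  shows "w = \<zero>\<^bsub>M\<^esub>"
  using assms(2) by induction (use assms(1) in auto)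

end

lemma ideal_times_module_subset:
  fixes M :: "('a, 'b) module"
  assumes "module R M" "ideal I R"
  shows "ideal_times_module I M \<subseteq> ideal_span I M (carrier M)"
proof
  interpret module R M by fact
  fix w assume "w \<in> ideal_times_module I M"
  then obtain n :: nat and r u where w: "w = (\<Oplus>\<^bsub>M\<^esub> i \<in> {..<n}. r i \<odot>\<^bsub>M\<^esub> u i)" 
    "r \<in> {..<n} \<rightarrow> I" "u \<in> {..<n} \<rightarrow> carrier M"
    unfolding ideal_times_module_def by auto
  have "(\<Oplus>\<^bsub>M\<^esub> i \<in> {..<k}. r i \<odot>\<^bsub>M\<^esub> u i) \<in> ideal_span I M (carrier M)" if "k \<le> n" for k
    using that
  proof (induction k)
    case 0
    then show ?case using ideal_span.zero by simp
  next
    case (Suc k)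
    have c: "r i \<odot>\<^bsub>M\<^esub> u i \<in> carrier M" if "i \<le> k" for i
      using that Suc.prems w(2,3) R.idealD(6)[OF assms(2)] by (auto simp: Pi_iff)
    have "(\<Oplus>\<^bsub>M\<^esub> i \<in> {..<Suc k}. r i \<odot>\<^bsub>M\<^esub> u i) = r k \<odot>\<^bsub>M\<^esub> u k \<oplus>\<^bsub>M\<^esub> (\<Oplus>\<^bsub>M\<^esub> i \<in> {..<k}. r i \<odot>\<^bsub>M\<^esub> u i)"
      unfolding lessThan_Suc using c by (intro M.finsum_insert) auto
    moreover have "r k \<odot>\<^bsub>M\<^esub> u k \<in> ideal_span I M (carrier M)"
      using w(2,3) Suc.prems by (intro ideal_span.smult) auto
    ultimately show ?case using Suc by (auto intro: ideal_span.add)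
  qed
  then show "w \<in> ideal_span I M (carrier M)" using w(1) by simp
qed

lemma module_Hom_zero:
  assumes "module R M" "module R N" "f \<in> module_Hom R M N"
  shows "f \<zero>\<^bsub>M\<^esub> = \<zero>\<^bsub>N\<^esub>"
proof -
  interpret M: module R M by fact
  interpret N: module R N by fact
  have "f (\<zero>\<^bsub>R\<^esub> \<odot>\<^bsub>M\<^esub> \<zero>\<^bsub>M\<^esub>) = \<zero>\<^bsub>R\<^esub> \<odot>\<^bsub>N\<^esub> f \<zero>\<^bsub>M\<^esub>"
    using module_HomD(3)[OF assms(3) M.R.zero_closed M.zero_closed] .
  then show ?thesis using module_HomD(1)[OF assms(3) M.zero_closed] by simp
qed

text \<open>\<open>M\<close> will also be a direct sum for which only closure is established, so the
  assumptions ask for preservation of zero and closure of the span in place of module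
  structure.\<close>

lemma ideal_span_hom_image:
  assumes f: "f \<in> module_Hom R M N" "f \<zero>\<^bsub>M\<^esub> = \<zero>\<^bsub>N\<^esub>" and I: "I \<subseteq> carrier R"
    and U: "U \<subseteq> carrier M" "ideal_span I M U \<subseteq> carrier M"
  shows "w \<in> ideal_span I M U \<Longrightarrow> f w \<in> ideal_span I N (f ` U)"
proof (induction rule: ideal_span.induct)
  case zero
  then show ?case using f ideal_span.zero by simp
next
  case (smult r u)
  then have "f (r \<odot>\<^bsub>M\<^esub> u) = r \<odot>\<^bsub>N\<^esub> f u" using module_HomD(3)[OF f(1)] I U by auto
  then show ?case using smult ideal_span.smult[of r I "f u" "f ` U" N] by auto
next
  case (add v w)
  then have "f (v \<oplus>\<^bsub>M\<^esub> w) = f v \<oplus>\<^bsub>N\<^esub> f w" using module_HomD(2)[OF f(1)] U by auto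
  then show ?case using add ideal_span.add by auto
qed

text \<open>Applied to a differential with \<open>U\<close> the whole carrier of \<open>F n\<close>:
  an element of \<open>I\<close> times the image is hit from \<open>I F n\<close>. This produces the
  correcting element in \<open>span_intersection\<close>.\<close>

lemma ideal_span_hom_lift:
  assumes f: "f \<in> module_Hom R M N" "f \<zero>\<^bsub>M\<^esub> = \<zero>\<^bsub>N\<^esub>" and I: "I \<subseteq> carrier R"
    and U: "U \<subseteq> carrier M" "ideal_span I M U \<subseteq> carrier M"
  shows "w \<in> ideal_span I N (f ` U) \<Longrightarrow> \<exists>v \<in> ideal_span I M U. f v = w"
proof (induction rule: ideal_span.induct)
  case zero
  then show ?case using f ideal_span.zero by blast
next
  case (smult r u)
  then obtain v where v: "v \<in> U" "u = f v" by auto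
  then have "f (r \<odot>\<^bsub>M\<^esub> v) = r \<odot>\<^bsub>N\<^esub> u" using module_HomD(3)[OF f(1)] I U smult by auto
  then show ?case using ideal_span.smult[OF smult(1) v(1)] by blast
next
  case (add v w)
  then obtain v' w' where *: "v' \<in> ideal_span I M U" "w' \<in> ideal_span I M U" "f v' = v" "f w' = w" by blast
  then have "f (v' \<oplus>\<^bsub>M\<^esub> w') = v \<oplus>\<^bsub>N\<^esub> w" using module_HomD(2)[OF f(1)] U by auto
  then show ?case using ideal_span.add[OF *(1,2)] by blast
qed

text \<open>An element is the sum of its coordinates, each placed alone (\<open>sg\<close>), and
  there are finitely many. The induction runs over a set \<open>E\<close> outside which all
  coordinates vanish.\<close>

lemma ideal_span_direct_sum:
  assumes D: "finite D" and mod: "\<And>i. i \<in> D \<Longrightarrow> module R (Mo i)"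
    and w: "w \<in> carrier (direct_sum D Mo)" "\<And>i. i \<in> D \<Longrightarrow> w i \<in> ideal_span I (Mo i) (carrier (Mo i))"
    and I: "ideal I R"
  shows "w \<in> ideal_span I (direct_sum D Mo) (carrier (direct_sum D Mo))"
proof -
  let ?S = "direct_sum D Mo"
  have carrier_iff: "v \<in> carrier ?S \<longleftrightarrow> v \<in> (\<Pi>\<^sub>E i \<in> D. carrier (Mo i))" for v
    using D unfolding direct_sum_def by auto
  have z: "\<zero>\<^bsub>Mo i\<^esub> \<in> carrier (Mo i)" if "i \<in> D" for i
  proof -
    interpret module R "Mo i" using mod[OF that] .
    show ?thesis by simp
  qed
  have zadd: "a \<oplus>\<^bsub>Mo i\<^esub> \<zero>\<^bsub>Mo i\<^esub> = a" "\<zero>\<^bsub>Mo i\<^esub> \<oplus>\<^bsub>Mo i\<^esub> a = a" if "i \<in> D" "a \<in> carrier (Mo i)" for i a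
  proof -
    interpret module R "Mo i" using mod[OF that(1)] .
    show "a \<oplus>\<^bsub>Mo i\<^esub> \<zero>\<^bsub>Mo i\<^esub> = a" "\<zero>\<^bsub>Mo i\<^esub> \<oplus>\<^bsub>Mo i\<^esub> a = a" using that by auto
  qed
  have szero: "r \<odot>\<^bsub>Mo i\<^esub> \<zero>\<^bsub>Mo i\<^esub> = \<zero>\<^bsub>Mo i\<^esub>" if "i \<in> D" "r \<in> I" for i r
  proof -
    interpret module R "Mo i" using mod[OF that(1)] .
    show ?thesis using R.idealD(6)[OF I that(2)] by simp
  qed
  define sg where "sg i a = (\<lambda>k\<in>D. if k = i then a else \<zero>\<^bsub>Mo k\<^esub>)" for i a
  have sgc: "sg i a \<in> carrier ?S" if "i \<in> D" "a \<in> carrier (Mo i)" for i a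
    unfolding carrier_iff sg_def using that z by auto
  have single: "sg i a \<in> ideal_span I ?S (carrier ?S)"
    if i: "i \<in> D" and a: "a \<in> ideal_span I (Mo i) (carrier (Mo i))" for i a
    using a
  proof induction
    case zero
    have "sg i \<zero>\<^bsub>Mo i\<^esub> = \<zero>\<^bsub>?S\<^esub>" unfolding sg_def direct_sum_def by (auto simp: fun_eq_iff restrict_def)
    then show ?case using ideal_span.zero[of ?S] by simp
  next
    case (smult r u)
    have "sg i (r \<odot>\<^bsub>Mo i\<^esub> u) = r \<odot>\<^bsub>?S\<^esub> sg i u"
      unfolding sg_def direct_sum_def using szero smult(1) by (auto simp: fun_eq_iff restrict_def)
    then show ?case using ideal_span.smult[OF smult(1) sgc[OF i smult(2)], of ?S] by simp
  next
    case (add u v)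
    interpret module R "Mo i" using mod[OF i] .
    have "u \<in> carrier (Mo i)" "v \<in> carrier (Mo i)"
      using add(1,2) ideal_span_subset[OF I] by auto
    then have "sg i (u \<oplus>\<^bsub>Mo i\<^esub> v) = sg i u \<oplus>\<^bsub>?S\<^esub> sg i v"
      unfolding sg_def direct_sum_def using zadd z by (auto simp: fun_eq_iff restrict_def)
    then show ?case using ideal_span.add[OF add(3,4)] by simp
  qed
  have "v \<in> ideal_span I ?S (carrier ?S)"
    if "finite E" "E \<subseteq> D" "v \<in> carrier ?S" "\<And>i. i \<in> D \<Longrightarrow> v i \<in> ideal_span I (Mo i) (carrier (Mo i))"
      "\<And>i. i \<in> D - E \<Longrightarrow> v i = \<zero>\<^bsub>Mo i\<^esub>" for E v
    using that
  proof (induction E arbitrary: v)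
    case empty
    have "v i = (\<lambda>i\<in>D. \<zero>\<^bsub>Mo i\<^esub>) i" for i
      using empty(2,4) unfolding carrier_iff by (cases "i \<in> D") (auto simp: PiE_def extensional_def)
    then have "v = \<zero>\<^bsub>?S\<^esub>" unfolding direct_sum_def by (simp add: fun_eq_iff)
    then show ?case using ideal_span.zero[of ?S] by simp
  next
    case (insert i E)
    have i: "i \<in> D" using insert by auto
    have vc: "v \<in> (\<Pi>\<^sub>E i \<in> D. carrier (Mo i))" using insert(5) unfolding carrier_iff .
    define v' where "v' = v(i := \<zero>\<^bsub>Mo i\<^esub>)"
    have "v' \<in> carrier ?S" unfolding carrier_iff v'_def using vc i z by (auto simp: PiE_iff extensional_def)
    moreover have "v' k \<in> ideal_span I (Mo k) (carrier (Mo k))" if "k \<in> D" for k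
      using insert(6)[OF that] ideal_span.zero unfolding v'_def by auto
    moreover have "v' k = \<zero>\<^bsub>Mo k\<^esub>" if "k \<in> D - E" for k using insert(7)[of k] that unfolding v'_def by auto
    ultimately have 1: "v' \<in> ideal_span I ?S (carrier ?S)" using insert.IH insert(4) by auto
    have "(v' \<oplus>\<^bsub>?S\<^esub> sg i (v i)) k = v k" for k
    proof (cases "k \<in> D")
      case True
      then show ?thesis using vc zadd i unfolding direct_sum_def sg_def v'_def by (auto simp: PiE_iff)
    next
      case False
      then show ?thesis using vc unfolding direct_sum_def by (auto simp: PiE_iff extensional_def)
    qed
    then have eq: "v' \<oplus>\<^bsub>?S\<^esub> sg i (v i) = v" by (rule ext)
    show ?case using ideal_span.add[OF 1 single[OF i insert(6)[OF i]]] unfolding eq .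
  qed
  from this[of D w] show ?thesis using D w by auto
qed

text \<open>An isomorphism of \<open>M\<close> with \<open>R^n\<close>, recorded as coordinate
  functions. Values at indices from \<open>n\<close> on are left free, so no extensional functions
  have to be handled.\<close>

definition coordinates :: "('a, 'm) ring_scheme \<Rightarrow> ('a, 'b) module \<Rightarrow> nat \<Rightarrow> ('b \<Rightarrow> nat \<Rightarrow> 'a) \<Rightarrow> bool" where
  "coordinates R M n c \<longleftrightarrow>
    (\<forall>u \<in> carrier M. \<forall>i<n. c u i \<in> carrier R) \<and>
    (\<forall>u \<in> carrier M. \<forall>v \<in> carrier M. \<forall>i<n. c (u \<oplus>\<^bsub>M\<^esub> v) i = c u i \<oplus>\<^bsub>R\<^esub> c v i) \<and>
    (\<forall>r \<in> carrier R. \<forall>u \<in> carrier M. \<forall>i<n. c (r \<odot>\<^bsub>M\<^esub> u) i = r \<otimes>\<^bsub>R\<^esub> c u i) \<and>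
    (\<forall>u \<in> carrier M. \<forall>v \<in> carrier M. (\<forall>i<n. c u i = c v i) \<longrightarrow> u = v) \<and>
    (\<forall>a. (\<forall>i<n. a i \<in> carrier R) \<longrightarrow> (\<exists>u \<in> carrier M. \<forall>i<n. c u i = a i))"

lemma coordinatesD:
  assumes "coordinates R M n c"
  shows "\<And>u i. u \<in> carrier M \<Longrightarrow> i < n \<Longrightarrow> c u i \<in> carrier R"
    "\<And>u v i. u \<in> carrier M \<Longrightarrow> v \<in> carrier M \<Longrightarrow> i < n \<Longrightarrow> c (u \<oplus>\<^bsub>M\<^esub> v) i = c u i \<oplus>\<^bsub>R\<^esub> c v i"
    "\<And>r u i. r \<in> carrier R \<Longrightarrow> u \<in> carrier M \<Longrightarrow> i < n \<Longrightarrow> c (r \<odot>\<^bsub>M\<^esub> u) i = r \<otimes>\<^bsub>R\<^esub> c u i"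
    "\<And>u v. u \<in> carrier M \<Longrightarrow> v \<in> carrier M \<Longrightarrow> (\<And>i. i < n \<Longrightarrow> c u i = c v i) \<Longrightarrow> u = v"
    "\<And>a. (\<And>i. i < n \<Longrightarrow> a i \<in> carrier R) \<Longrightarrow> \<exists>u \<in> carrier M. \<forall>i<n. c u i = a i"
  using assms unfolding coordinates_def by auto

lemma (in cring) finite_free_coordinates:
  assumes "finite_free_module R M"
  shows "\<exists>n c. coordinates R M n c"
proof -
  obtain n :: nat where n: "module_isomorphic R (direct_sum {..<n} (\<lambda>_. self_module R)) M"
    using assms unfolding finite_free_module_def by auto
  let ?S = "direct_sum {..<n} (\<lambda>_. self_module R)"
  obtain g where g: "g \<in> module_Hom R ?S M" "bij_betw g (carrier ?S) (carrier M)"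
    using n unfolding module_isomorphic_def by auto
  have Sc: "carrier ?S = (\<Pi>\<^sub>E i \<in> {..<n}. carrier R)" unfolding direct_sum_def self_module_def by auto
  have Sadd: "u \<oplus>\<^bsub>?S\<^esub> v = (\<lambda>i\<in>{..<n}. u i \<oplus> v i)" for u v unfolding direct_sum_def self_module_def by simp
  have Ssm: "r \<odot>\<^bsub>?S\<^esub> u = (\<lambda>i\<in>{..<n}. r \<otimes> u i)" for r u unfolding direct_sum_def self_module_def by simp
  define c where "c = inv_into (carrier ?S) g"
  have cS: "c u \<in> carrier ?S" "g (c u) = u" if "u \<in> carrier M" for u
    using that bij_betw_imp_surj_on[OF g(2)] inv_into_into[of u g "carrier ?S"] f_inv_into_f[of u g "carrier ?S"]
    unfolding c_def by auto
  have cg: "c (g a) = a" if "a \<in> carrier ?S" for a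
    using that g(2) unfolding c_def bij_betw_def by simp
  have c: "c u i \<in> carrier R" if "u \<in> carrier M" "i < n" for u i
    using cS(1)[OF that(1)] that(2) unfolding Sc by auto
  have "c (u \<oplus>\<^bsub>M\<^esub> v) i = c u i \<oplus> c v i" if uv: "u \<in> carrier M" "v \<in> carrier M" "i < n" for u v i
  proof -
    have "g (c u \<oplus>\<^bsub>?S\<^esub> c v) = u \<oplus>\<^bsub>M\<^esub> v" using module_HomD(2)[OF g(1) cS(1)[OF uv(1)] cS(1)[OF uv(2)]] cS(2) uv by simp
    moreover have "c u \<oplus>\<^bsub>?S\<^esub> c v \<in> carrier ?S" unfolding Sadd Sc using c uv by auto
    ultimately have "c (u \<oplus>\<^bsub>M\<^esub> v) = c u \<oplus>\<^bsub>?S\<^esub> c v" using cg by metis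
    then show ?thesis unfolding Sadd using uv by simp
  qed
  moreover have "c (r \<odot>\<^bsub>M\<^esub> u) i = r \<otimes> c u i" if ru: "r \<in> carrier R" "u \<in> carrier M" "i < n" for r u i
  proof -
    have "g (r \<odot>\<^bsub>?S\<^esub> c u) = r \<odot>\<^bsub>M\<^esub> u" using module_HomD(3)[OF g(1) ru(1) cS(1)[OF ru(2)]] cS(2) ru by simp
    moreover have "r \<odot>\<^bsub>?S\<^esub> c u \<in> carrier ?S" unfolding Ssm Sc using c ru by auto
    ultimately have "c (r \<odot>\<^bsub>M\<^esub> u) = r \<odot>\<^bsub>?S\<^esub> c u" using cg by metis
    then show ?thesis unfolding Ssm using ru by simp
  qed
  moreover have "u = v" if uv: "u \<in> carrier M" "v \<in> carrier M" "\<forall>i<n. c u i = c v i" for u v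
  proof -
    have "c u = c v" using cS(1)[OF uv(1)] cS(1)[OF uv(2)] uv(3) unfolding Sc by (intro PiE_ext) auto
    then show ?thesis using cS(2) uv by metis
  qed
  moreover have "\<exists>u \<in> carrier M. \<forall>i<n. c u i = a i" if a: "\<forall>i<n. a i \<in> carrier R" for a
  proof -
    have r: "restrict a {..<n} \<in> carrier ?S" unfolding Sc using a by auto
    then have "g (restrict a {..<n}) \<in> carrier M" using module_HomD(1)[OF g(1)] by auto
    then show ?thesis using cg[OF r] by (intro bexI[of _ "g (restrict a {..<n})"]) auto
  qed
  ultimately have "coordinates R M n c" unfolding coordinates_def using c by simp
  then show ?thesis by blast
qed

text \<open>From right to left, the induction bounds the number \<open>k\<close> of leading
  coordinates that may be nonzero and splits off the last of them along a unit vector.\<close>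

lemma ideal_span_coordinates_iff:
  assumes M: "module R M" and c: "coordinates R M n c" and I: "ideal I R" and u: "u \<in> carrier M"
  shows "u \<in> ideal_span I M (carrier M) \<longleftrightarrow> (\<forall>i<n. c u i \<in> I)"
proof
  interpret module R M by fact
  note c = coordinatesD[OF c]
  have c0: "c \<zero>\<^bsub>M\<^esub> i = \<zero>\<^bsub>R\<^esub>" if "i < n" for i
    using c(3)[OF R.zero_closed M.zero_closed that] c(1)[OF M.zero_closed that] by simp
  show "\<forall>i<n. c u i \<in> I" if "u \<in> ideal_span I M (carrier M)"
    using that
  proof induction
    case zero
    then show ?case using c0 R.idealD(2)[OF I] by simp
  next
    case (smult r u)
    then show ?case using c(3)[OF R.idealD(6)[OF I smult(1)] smult(2)] R.idealD(5)[OF I smult(1)] c(1) by simp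
  next
    case (add v w)
    then have "v \<in> carrier M" "w \<in> carrier M" using ideal_span_subset[OF I] by auto
    then show ?case using c(2) add R.idealD(3)[OF I] by simp
  qed
  have "v \<in> ideal_span I M (carrier M)"
    if "k \<le> n" "v \<in> carrier M" "\<And>i. i < n \<Longrightarrow> c v i \<in> I" "\<And>i. k \<le> i \<Longrightarrow> i < n \<Longrightarrow> c v i = \<zero>\<^bsub>R\<^esub>" for k v
    using that
  proof (induction k arbitrary: v)
    case 0
    then have "v = \<zero>\<^bsub>M\<^esub>" using c0 by (intro c(4)) auto
    then show ?case using ideal_span.zero by simp
  next
    case (Suc k)
    have "\<exists>e\<in>carrier M. \<forall>i<n. c e i = (if i = k then \<one>\<^bsub>R\<^esub> else \<zero>\<^bsub>R\<^esub>)" by (rule c(5)) simp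
    then obtain e where e: "e \<in> carrier M" "\<And>i. i < n \<Longrightarrow> c e i = (if i = k then \<one>\<^bsub>R\<^esub> else \<zero>\<^bsub>R\<^esub>)" by blast
    have "\<exists>w\<in>carrier M. \<forall>i<n. c w i = (if i = k then \<zero>\<^bsub>R\<^esub> else c v i)" by (rule c(5)) (simp add: c(1) Suc)
    then obtain w where w: "w \<in> carrier M" "\<And>i. i < n \<Longrightarrow> c w i = (if i = k then \<zero>\<^bsub>R\<^esub> else c v i)" by blast
    have "c w i = \<zero>\<^bsub>R\<^esub>" if "k \<le> i" "i < n" for i
      using w(2)[OF that(2)] Suc.prems(4)[of i] that by (cases "i = k") auto
    then have ws: "w \<in> ideal_span I M (carrier M)"
      using Suc.prems w R.idealD(2)[OF I] by (intro Suc.IH) auto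
    have k: "c v k \<in> I" "c v k \<in> carrier R" using Suc.prems R.idealD(6)[OF I] by auto
    have "v = w \<oplus>\<^bsub>M\<^esub> c v k \<odot>\<^bsub>M\<^esub> e"
    proof (rule c(4)[OF Suc.prems(2)])
      show "w \<oplus>\<^bsub>M\<^esub> c v k \<odot>\<^bsub>M\<^esub> e \<in> carrier M" using w e k by simp
      fix i assume i: "i < n"
      show "c v i = c (w \<oplus>\<^bsub>M\<^esub> c v k \<odot>\<^bsub>M\<^esub> e) i"
        using c(2)[OF w(1) smult_closed[OF k(2) e(1)] i] c(3)[OF k(2) e(1) i] w(2)[OF i] e(2)[OF i] k(2) c(1)[OF Suc.prems(2) i]
        by simp
    qed
    then show ?case using ideal_span.add[OF ws ideal_span.smult[OF k(1) e(1)]] by simp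
  qed
  from this[of n u] show "u \<in> ideal_span I M (carrier M)" if "\<forall>i<n. c u i \<in> I" using u that by simp
qed

section \<open>Syzygies of the residue field\<close>

text \<open>The one fact about \<open>K\<close> that is used besides its resolution; the locale
  below assumes it in place of the isomorphism with the residue field.\<close>

lemma residue_module_annihilated:
  assumes A: "noetherian_local_ring A" and iso: "module_isomorphic A (residue_module A) K" and K: "module A K"
    and a: "a \<in> max_ideal A" and u: "u \<in> carrier K"
  shows "a \<odot>\<^bsub>K\<^esub> u = \<zero>\<^bsub>K\<^esub>"
proof -
  interpret A: noetherian_local_ring A by fact
  interpret K: module A K by fact
  let ?m = "max_ideal A" and ?k = "residue_module A"
  interpret m: ideal ?m A using A.ideal_max_ideal .
  interpret k: ring "A Quot ?m" using m.quotient_is_ring .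
  have k: "carrier ?k = carrier (A Quot ?m)" "\<zero>\<^bsub>?k\<^esub> = \<zero>\<^bsub>A Quot ?m\<^esub>" 
    "r \<odot>\<^bsub>?k\<^esub> c = (?m +>\<^bsub>A\<^esub> r) \<otimes>\<^bsub>A Quot ?m\<^esub> c" for r c
    unfolding residue_module_def Let_def by simp_all
  have kill: "b \<odot>\<^bsub>?k\<^esub> c = \<zero>\<^bsub>?k\<^esub>" if "b \<in> ?m" "c \<in> carrier ?k" for b c
  proof -
    have "?m +>\<^bsub>A\<^esub> b = \<zero>\<^bsub>A Quot ?m\<^esub>"
      using m.a_rcos_const[OF that(1)] by (simp add: FactRing_def)
    then show ?thesis using that(2) unfolding k by simp
  qed
  obtain g where g: "g \<in> module_Hom A ?k K" "bij_betw g (carrier ?k) (carrier K)"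
    using iso unfolding module_isomorphic_def by auto
  have zk: "\<zero>\<^bsub>?k\<^esub> \<in> carrier ?k" unfolding k by simp
  have "g \<zero>\<^bsub>?k\<^esub> = \<zero>\<^bsub>A\<^esub> \<odot>\<^bsub>K\<^esub> g \<zero>\<^bsub>?k\<^esub>"
    using module_HomD(3)[OF g(1) A.zero_closed zk] kill[OF A.idealD(2)[OF A.ideal_max_ideal] zk] by simp
  then have g0: "g \<zero>\<^bsub>?k\<^esub> = \<zero>\<^bsub>K\<^esub>" using module_HomD(1)[OF g(1) zk] by simp
  obtain c where c: "c \<in> carrier ?k" "u = g c" using u g(2) by (auto simp: bij_betw_def)
  have "a \<odot>\<^bsub>K\<^esub> u = g (a \<odot>\<^bsub>?k\<^esub> c)"
    using module_HomD(3)[OF g(1) A.idealD(6)[OF A.ideal_max_ideal a] c(1)] c(2) by simp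
  then show ?thesis using kill[OF a c(1)] g0 by simp
qed

locale residue_field_resolution = noetherian_local_ring R for R (structure) +
  fixes K :: "('a, 'c) module" and F :: "nat \<Rightarrow> ('a, 'c) module" and d :: "nat \<Rightarrow> 'c \<Rightarrow> 'c"
  assumes resolution: "minimal_free_resolution R K F d"
    and residue: "\<And>a u. a \<in> max_ideal R \<Longrightarrow> u \<in> carrier K \<Longrightarrow> a \<odot>\<^bsub>K\<^esub> u = \<zero>\<^bsub>K\<^esub>"
begin

abbreviation "\<mm> \<equiv> max_ideal R"

text \<open>The set \<open>syz n\<close> is the submodule \<open>\<Omega>\<^sub>n\<^sub>+\<^sub>1\<close> of \<open>F n\<close>.\<close>

definition "syz n = d (Suc n) ` carrier (F (Suc n))"

lemma module_K: "module R K"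
  using resolution unfolding minimal_free_resolution_def by simp

lemma free_F: "finite_free_module R (F n)"
  using resolution unfolding minimal_free_resolution_def by simp

lemma module_F: "module R (F n)"
  using free_F unfolding finite_free_module_def by simp

lemma hom_d0: "d 0 \<in> module_Hom R (F 0) K"
  using resolution unfolding minimal_free_resolution_def by simp

lemma hom_d: "d (Suc n) \<in> module_Hom R (F (Suc n)) (F n)"
  using resolution unfolding minimal_free_resolution_def by simp

lemma syz_0: "syz 0 = {u \<in> carrier (F 0). d 0 u = \<zero>\<^bsub>K\<^esub>}"
  using resolution unfolding minimal_free_resolution_def syz_def by simp

lemma syz_Suc: "syz (Suc n) = {u \<in> carrier (F (Suc n)). d (Suc n) u = \<zero>\<^bsub>F n\<^esub>}"
  using resolution unfolding minimal_free_resolution_def syz_def by simp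

lemma syz_subset: "syz n \<subseteq> carrier (F n)"
  using module_HomD(1)[OF hom_d] unfolding syz_def by auto

lemma syz_minimal: "syz n \<subseteq> ideal_span \<mm> (F n) (carrier (F n))"
proof -
  have "syz n \<subseteq> ideal_times_module \<mm> (F n)"
    using resolution unfolding minimal_free_resolution_def syz_def by simp
  then show ?thesis using ideal_times_module_subset[OF module_F ideal_max_ideal] by blast
qed

lemma submodule_syz: "submodule (syz n) R (F n)"
proof -
  interpret F: module R "F n" using module_F .
  interpret G: module R "F (Suc n)" using module_F .
  note h = module_HomD[OF hom_d[of n]]
  have add: "a \<oplus>\<^bsub>F n\<^esub> b \<in> syz n" if ab: "a \<in> syz n" "b \<in> syz n" for a b
  proof -
    obtain u v where uv: "u \<in> carrier (F (Suc n))" "v \<in> carrier (F (Suc n))" "a = d (Suc n) u" "b = d (Suc n) v"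
      using ab unfolding syz_def by auto
    then have "a \<oplus>\<^bsub>F n\<^esub> b = d (Suc n) (u \<oplus>\<^bsub>F (Suc n)\<^esub> v)" using h(2) by simp
    then show ?thesis unfolding syz_def using uv by auto
  qed
  have smult: "r \<odot>\<^bsub>F n\<^esub> a \<in> syz n" if ra: "r \<in> carrier R" "a \<in> syz n" for r a
  proof -
    obtain u where u: "u \<in> carrier (F (Suc n))" "a = d (Suc n) u" using ra unfolding syz_def by auto
    then have "r \<odot>\<^bsub>F n\<^esub> a = d (Suc n) (r \<odot>\<^bsub>F (Suc n)\<^esub> u)" using h(3) ra by simp
    then show ?thesis unfolding syz_def using u ra by auto
  qed
  show ?thesis
  proof (rule F.submoduleI[OF syz_subset _ _ add smult])
    show "\<zero>\<^bsub>F n\<^esub> \<in> syz n"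
      using module_Hom_zero[OF module_F module_F hom_d] G.zero_closed unfolding syz_def by (metis imageI)
    fix a assume a: "a \<in> syz n"
    then have "(\<ominus> \<one>) \<odot>\<^bsub>F n\<^esub> a = \<ominus>\<^bsub>F n\<^esub> a" using syz_subset[of n] F.smult_l_minus[OF one_closed, of a] by auto
    then show "\<ominus>\<^bsub>F n\<^esub> a \<in> syz n" using smult[OF _ a, of "\<ominus> \<one>"] by simp
  qed
qed

lemma ideal_span_carrier:
  assumes "ideal I R"
  shows "ideal_span I (F n) (carrier (F n)) \<subseteq> carrier (F n)" "ideal_span I (F n) (syz n) \<subseteq> carrier (F n)"
proof -
  interpret module R "F n" using module_F .
  show "ideal_span I (F n) (carrier (F n)) \<subseteq> carrier (F n)" "ideal_span I (F n) (syz n) \<subseteq> carrier (F n)"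
    using ideal_span_subset[OF assms] syz_subset by auto
qed

lemma ideal_prod_max_ideal: "ideal (ideal_prod R \<mm> \<mm>) R"
  using ideal_prod_is_ideal[OF ideal_max_ideal ideal_max_ideal] .

text \<open>Minimality contributes a second factor of the maximal ideal. This brings the elements of
  \<open>\<mm> syz n\<close> into the range of the independence condition modulo
  \<open>\<mm>^2\<close>.\<close>

lemma span_syz_square:
  "ideal_span \<mm> (F n) (syz n) \<subseteq> ideal_span (ideal_prod R \<mm> \<mm>) (F n) (carrier (F n))"
proof
  interpret module R "F n" using module_F .
  have *: "r \<odot>\<^bsub>F n\<^esub> u \<in> ideal_span (ideal_prod R \<mm> \<mm>) (F n) (carrier (F n))"
    if r: "r \<in> \<mm>" and u: "u \<in> ideal_span \<mm> (F n) (carrier (F n))" for r u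
  proof -
    have rc: "r \<in> carrier R" using idealD(6)[OF ideal_max_ideal r] .
    show ?thesis using u
    proof induction
      case zero
      then show ?case using ideal_span.zero rc by simp
    next
      case (smult a v)
      then have "r \<odot>\<^bsub>F n\<^esub> (a \<odot>\<^bsub>F n\<^esub> v) = (r \<otimes> a) \<odot>\<^bsub>F n\<^esub> v"
        using rc idealD(6)[OF ideal_max_ideal] by (simp add: smult_assoc1)
      then show ?case using ideal_span.smult[OF ideal_prod.prod[OF r smult(1)] smult(2)] by simp
    next
      case (add v w)
      then have "v \<in> carrier (F n)" "w \<in> carrier (F n)" using ideal_span_subset[OF ideal_max_ideal] by auto
      then show ?case using rc add by (simp add: smult_r_distr ideal_span.add)
    qed
  qed
  fix z assume "z \<in> ideal_span \<mm> (F n) (syz n)"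
  then show "z \<in> ideal_span (ideal_prod R \<mm> \<mm>) (F n) (carrier (F n))"
    by induction (use * syz_minimal in \<open>auto intro: ideal_span.zero ideal_span.add\<close>)
qed

text \<open>In each coordinate \<open>z = b + a x\<close> with \<open>b\<close> in \<open>I\<close>.
  A unit \<open>a\<close> would solve for \<open>x\<close> inside \<open>I + \<mm>^2\<close>, so
  every \<open>a\<close> lies in \<open>\<mm>\<close>: here the independence condition is
  spent.\<close>

lemma decompose_adjoin:
  assumes I: "ideal I R" and x: "x \<in> \<mm>" "x \<notin> set_add R I (ideal_prod R \<mm> \<mm>)"
    and z: "z \<in> ideal_span (ideal_prod R \<mm> \<mm>) (F n) (carrier (F n))"
      "z \<in> ideal_span (adjoin R I x) (F n) (carrier (F n))"
  obtains u v where "u \<in> ideal_span \<mm> (F n) (carrier (F n))" "v \<in> ideal_span I (F n) (carrier (F n))"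
    "z = x \<odot>\<^bsub>F n\<^esub> u \<oplus>\<^bsub>F n\<^esub> v"
proof -
  interpret M: module R "F n" using module_F .
  have xc: "x \<in> carrier R" using idealD(6)[OF ideal_max_ideal x(1)] .
  have zc: "z \<in> carrier (F n)" using ideal_span_carrier[OF ideal_prod_max_ideal] z(1) by auto
  obtain k c where c: "coordinates R (F n) k c" using finite_free_coordinates[OF free_F] by blast
  note c1 = coordinatesD(1)[OF c] and c2 = coordinatesD(2)[OF c] and c3 = coordinatesD(3)[OF c]
    and c4 = coordinatesD(4)[OF c] and c5 = coordinatesD(5)[OF c]
    and c6 = ideal_span_coordinates_iff[OF module_F c]
  have "\<forall>i<k. c z i \<in> adjoin R I x" using c6[OF adjoin_ideal[OF I xc] zc] z(2) by simp
  then have "\<forall>i. \<exists>b a. i < k \<longrightarrow> b \<in> I \<and> a \<in> carrier R \<and> c z i = b \<oplus> a \<otimes> x" unfolding adjoin_def by blast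
  then obtain b a where ba: "\<And>i. i < k \<Longrightarrow> b i \<in> I" "\<And>i. i < k \<Longrightarrow> a i \<in> carrier R"
    "\<And>i. i < k \<Longrightarrow> c z i = b i \<oplus> a i \<otimes> x" by metis
  have bc: "b i \<in> carrier R" if "i < k" for i using ba(1)[OF that] idealD(6)[OF I] by simp
  have zm: "c z i \<in> ideal_prod R \<mm> \<mm>" if "i < k" for i
    using c6[OF ideal_prod_max_ideal zc] z(1) that by simp
  have am: "a i \<in> \<mm>" if i: "i < k" for i
  proof (rule ccontr)
    assume "a i \<notin> \<mm>"
    then obtain e where e: "e \<in> carrier R" "e \<otimes> a i = \<one>" using unit_outside ba(2)[OF i] by blast
    note cc = ba(2)[OF i] bc[OF i] e(1) xc
    have "e \<otimes> c z i = e \<otimes> b i \<oplus> (e \<otimes> a i) \<otimes> x" unfolding ba(3)[OF i] using cc by algebra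
    then have "e \<otimes> c z i = e \<otimes> b i \<oplus> x" using e(2) xc by simp
    then have "\<ominus> (e \<otimes> b i) \<oplus> e \<otimes> c z i = x" using cc by (simp add: r_neg1 r_neg2)
    moreover have "\<ominus> (e \<otimes> b i) \<in> I" using idealD(4,7)[OF I] ba(1)[OF i] e(1) by simp
    moreover have "e \<otimes> c z i \<in> ideal_prod R \<mm> \<mm>" using idealD(4)[OF ideal_prod_max_ideal zm[OF i] e(1)] .
    ultimately show False using x(2) unfolding set_add_def' by blast
  qed
  obtain u where u: "u \<in> carrier (F n)" "\<And>i. i < k \<Longrightarrow> c u i = a i" using c5[of a] ba(2) by blast
  obtain v where v: "v \<in> carrier (F n)" "\<And>i. i < k \<Longrightarrow> c v i = b i" using c5[of b] bc by blast
  have "z = x \<odot>\<^bsub>F n\<^esub> u \<oplus>\<^bsub>F n\<^esub> v"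
  proof (rule c4[OF zc])
    show "x \<odot>\<^bsub>F n\<^esub> u \<oplus>\<^bsub>F n\<^esub> v \<in> carrier (F n)" using xc u v by simp
    fix i assume i: "i < k"
    have "c (x \<odot>\<^bsub>F n\<^esub> u \<oplus>\<^bsub>F n\<^esub> v) i = x \<otimes> a i \<oplus> b i"
      using c2[OF M.smult_closed[OF xc u(1)] v(1) i] c3[OF xc u(1) i] u(2)[OF i] v(2)[OF i] by simp
    also have "\<dots> = b i \<oplus> a i \<otimes> x" using ba(2)[OF i] bc[OF i] xc by algebra
    finally show "c z i = c (x \<odot>\<^bsub>F n\<^esub> u \<oplus>\<^bsub>F n\<^esub> v) i" using ba(3)[OF i] by simp
  qed
  moreover have "u \<in> ideal_span \<mm> (F n) (carrier (F n))" using c6[OF ideal_max_ideal u(1)] u(2) am by simp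
  moreover have "v \<in> ideal_span I (F n) (carrier (F n))" using c6[OF I v(1)] v(2) ba(1) by simp
  ultimately show ?thesis using that by blast
qed

text \<open>Freeness reduces the claim to coordinates, where regularity of \<open>x\<close> modulo
  \<open>I\<close> applies directly.\<close>

lemma ideal_span_regular:
  assumes I: "ideal I R" and x: "x \<in> carrier R" and reg: "\<And>y. y \<in> carrier R \<Longrightarrow> x \<otimes> y \<in> I \<Longrightarrow> y \<in> I"
    and u: "u \<in> carrier (F n)" "x \<odot>\<^bsub>F n\<^esub> u \<in> ideal_span I (F n) (carrier (F n))"
  shows "u \<in> ideal_span I (F n) (carrier (F n))"
proof -
  interpret M: module R "F n" using module_F .
  obtain k c where c: "coordinates R (F n) k c" using finite_free_coordinates[OF free_F] by blast
  note c1 = coordinatesD(1)[OF c] and c2 = coordinatesD(2)[OF c] and c3 = coordinatesD(3)[OF c]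
    and c4 = coordinatesD(4)[OF c] and c5 = coordinatesD(5)[OF c]
    and c6 = ideal_span_coordinates_iff[OF module_F c]
  have "c u i \<in> I" if i: "i < k" for i
  proof (rule reg[OF c1[OF u(1) i]])
    have "c (x \<odot>\<^bsub>F n\<^esub> u) i \<in> I" using c6[OF I M.smult_closed[OF x u(1)]] u(2) i by simp
    then show "x \<otimes> c u i \<in> I" using c3[OF x u(1) i] by simp
  qed
  then show ?thesis using c6[OF I u(1)] by simp
qed

text \<open>
  This is the injectivity of \<open>Tor(R/I, k) \<rightarrow> Tor(k, k)\<close>. In the step write \<open>z = x u + v\<close> with \<open>v \<in> I F n\<close>.
  Since \<open>z \<in> \<mm>\<^sup>2 F n\<close>, also \<open>u \<in> \<mm> F n\<close>, and regularity of \<open>x\<close> modulo \<open>I\<close> yields \<open>d u \<in> I F (n - 1)\<close>; the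
  induction hypothesis one step lower then corrects \<open>u\<close> by some \<open>w \<in> I F n\<close> to an element of \<open>syz n\<close>.
\<close>

lemma span_intersection:
  assumes "independent_regular R t I" "z \<in> ideal_span \<mm> (F n) (syz n)" "z \<in> ideal_span I (F n) (carrier (F n))"
  shows "z \<in> ideal_span I (F n) (syz n)"
  using assms
proof (induction arbitrary: n z)
  case zero
  interpret module R "F n" using module_F .
  have "z = \<zero>\<^bsub>F n\<^esub>" using ideal_span_zero zero(2) by blast
  then show ?case using ideal_span.zero by simp
next
  case (adjoin t I x)
  note x = adjoin(2,3) and reg = adjoin(4) and IH = adjoin.IH and z = adjoin.prems
  have I: "ideal I R" using independent_regular_ideal adjoin(1) by simp
  have xc: "x \<in> carrier R" using idealD(6)[OF ideal_max_ideal x(1)] .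
  have xI: "I \<subseteq> adjoin R I x" "x \<in> adjoin R I x" using adjoin_superset[OF I xc] by auto
  interpret M: module R "F n" using module_F .
  obtain u v where u: "u \<in> ideal_span \<mm> (F n) (carrier (F n))" and v: "v \<in> ideal_span I (F n) (carrier (F n))"
    and zuv: "z = x \<odot>\<^bsub>F n\<^esub> u \<oplus>\<^bsub>F n\<^esub> v"
    using decompose_adjoin[OF I x _ z(2)] span_syz_square z(1) by blast
  have uc: "u \<in> carrier (F n)" and vc: "v \<in> carrier (F n)" and zc: "z \<in> carrier (F n)"
    using ideal_span_carrier ideal_max_ideal I u v z(1) by blast+
  have "\<exists>w \<in> ideal_span I (F n) (carrier (F n)). u \<ominus>\<^bsub>F n\<^esub> w \<in> syz n"
  proof (cases n)
    \<comment> \<open>There is no lower syzygy to work in: \<open>d 0 u\<close> lies in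
      \<open>\<mm> K\<close>, which vanishes, so \<open>u\<close> is itself a syzygy and
      \<open>w\<close> is zero.\<close>
    case 0
    interpret K: module R K using module_K .
    have "u \<in> carrier (F 0) \<and> d 0 u = \<zero>\<^bsub>K\<^esub>" using u unfolding 0
    proof induction
      case zero
      then show ?case using M.zero_closed module_Hom_zero[OF module_F module_K hom_d0] 0 by simp
    next
      case (smult r v)
      then show ?case
        using module_HomD(3)[OF hom_d0, of r v] module_HomD(1)[OF hom_d0, of v] residue idealD(6)[OF ideal_max_ideal smult(1)] M.smult_closed 0 by simp
    next
      case (add v w)
      then show ?case using module_HomD(2)[OF hom_d0, of v w] M.a_closed 0 by simp
    qed
    then have "u \<in> syz n" unfolding 0 syz_0 by simp
    moreover have m0: "\<ominus>\<^bsub>F n\<^esub> \<zero>\<^bsub>F n\<^esub> = \<zero>\<^bsub>F n\<^esub>" using M.r_neg[OF M.zero_closed] by simp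
    have "u \<ominus>\<^bsub>F n\<^esub> \<zero>\<^bsub>F n\<^esub> = u" unfolding a_minus_def m0 using uc by simp
    ultimately have "u \<ominus>\<^bsub>F n\<^esub> \<zero>\<^bsub>F n\<^esub> \<in> syz n" by simp
    then show ?thesis using ideal_span.zero by blast
  next
    case (Suc k)
    interpret N: module R "F k" using module_F .
    have dh: "d n \<in> module_Hom R (F n) (F k)" unfolding Suc using hom_d .
    have ds: "d n ` carrier (F n) = syz k" unfolding syz_def Suc ..
    have d0: "d n \<zero>\<^bsub>F n\<^esub> = \<zero>\<^bsub>F k\<^esub>" using module_Hom_zero[OF module_F module_F dh] .
    have hI: "d n w \<in> ideal_span J (F k) (syz k)" if "ideal J R" "w \<in> ideal_span J (F n) (carrier (F n))" for J w
      using ideal_span_hom_image[OF dh d0 idealD(1)[OF that(1)] subset_refl ideal_span_carrier(1)[OF that(1)] that(2)]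
      unfolding ds .
    have mono: "ideal_span I (F k) (syz k) \<subseteq> ideal_span I (F k) (carrier (F k))"
      using ideal_span_mono[OF subset_refl syz_subset] .
    have du: "d n u \<in> carrier (F k)" and dv: "d n v \<in> carrier (F k)" using module_HomD(1)[OF dh] uc vc by auto
    have "z \<in> syz n"
      using z(1)
    proof induction
      case zero
      show ?case using subgroup.one_closed[OF submodule.axioms(1)[OF submodule_syz]] by simp
    next
      case (smult r w)
      then show ?case using submodule.smult_closed[OF submodule_syz] idealD(6)[OF ideal_max_ideal] by blast
    next
      case (add v w)
      then show ?case using subgroup.m_closed[OF submodule.axioms(1)[OF submodule_syz]] by simp
    qed
    \<comment> \<open>This yields \<open>x d u = - d v\<close>, with \<open>d v\<close> in
      \<open>I\<close> times the lower syzygies; cancelling \<open>x\<close>, which is regular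
      modulo \<open>I\<close>, leaves \<open>d u\<close> in \<open>I F k\<close>.\<close>
    then have "d n z = \<zero>\<^bsub>F k\<^esub>" unfolding Suc syz_Suc by simp
    then have "x \<odot>\<^bsub>F k\<^esub> d n u \<oplus>\<^bsub>F k\<^esub> d n v = \<zero>\<^bsub>F k\<^esub>"
      unfolding zuv using module_HomD(2)[OF dh M.smult_closed[OF xc uc] vc] module_HomD(3)[OF dh xc uc] by simp
    then have "x \<odot>\<^bsub>F k\<^esub> d n u = \<ominus>\<^bsub>F k\<^esub> d n v" using N.minus_equality[of "x \<odot>\<^bsub>F k\<^esub> d n u" "d n v"] du dv xc by simp
    then have "x \<odot>\<^bsub>F k\<^esub> d n u \<in> ideal_span I (F k) (carrier (F k))"
      using N.ideal_span_uminus[OF I subset_refl] hI[OF I v] mono by auto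
    then have "d n u \<in> ideal_span I (F k) (carrier (F k))"
      using ideal_span_regular[OF I xc reg du] by simp
    \<comment> \<open>The induction is on the sequence, not on the degree, so the hypothesis for
      \<open>I\<close> is available at \<open>k\<close> here and again at \<open>n\<close> for the
      remainder \<open>y\<close>.\<close>
    then have "d n u \<in> ideal_span I (F k) (syz k)" using IH[OF hI[OF ideal_max_ideal u]] by simp
    then obtain w where w: "w \<in> ideal_span I (F n) (carrier (F n))" "d n w = d n u"
      using ideal_span_hom_lift[OF dh d0 idealD(1)[OF I] subset_refl ideal_span_carrier(1)[OF I]] unfolding ds by blast
    have wc: "w \<in> carrier (F n)" using ideal_span_carrier[OF I] w by auto
    have "d n (u \<ominus>\<^bsub>F n\<^esub> w) \<oplus>\<^bsub>F k\<^esub> d n w = d n u"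
    proof -
      have "(u \<ominus>\<^bsub>F n\<^esub> w) \<oplus>\<^bsub>F n\<^esub> w = u" using uc wc by (simp add: M.minus_eq M.a_assoc M.l_neg)
      then show ?thesis using module_HomD(2)[OF dh, of "u \<ominus>\<^bsub>F n\<^esub> w" w] uc wc by simp
    qed
    then have "d n (u \<ominus>\<^bsub>F n\<^esub> w) = \<zero>\<^bsub>F k\<^esub>"
      using w(2) N.add.r_cancel_one[of "d n u" "d n (u \<ominus>\<^bsub>F n\<^esub> w)"] du module_HomD(1)[OF dh, of "u \<ominus>\<^bsub>F n\<^esub> w"] uc wc by simp
    then have "u \<ominus>\<^bsub>F n\<^esub> w \<in> syz n" unfolding Suc syz_Suc using uc wc M.minus_closed Suc by simp
    then show ?thesis using w by blast
  qed
  then obtain w where w: "w \<in> ideal_span I (F n) (carrier (F n))" and uw: "u \<ominus>\<^bsub>F n\<^esub> w \<in> syz n" by blast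
  have wc: "w \<in> carrier (F n)" using ideal_span_carrier[OF I] w by auto
  \<comment> \<open>This is \<open>z - x (u - w)\<close>. It lies in \<open>I F n\<close> by
    construction and in \<open>\<mm> syz n\<close> as a difference of two such elements, so the
    shorter sequence handles it.\<close>
  define y where "y = x \<odot>\<^bsub>F n\<^esub> w \<oplus>\<^bsub>F n\<^esub> v"
  have yI: "y \<in> ideal_span I (F n) (carrier (F n))"
    unfolding y_def using ideal_span.add[OF M.ideal_span_smult[OF I subset_refl w xc] v] .
  have yc: "y \<in> carrier (F n)" unfolding y_def using xc wc vc by simp
  let ?a = "x \<odot>\<^bsub>F n\<^esub> (u \<ominus>\<^bsub>F n\<^esub> w)"
  have ac: "?a \<in> carrier (F n)" using xc uc wc by simp
  have zy: "z = ?a \<oplus>\<^bsub>F n\<^esub> y"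
  proof -
    have "?a = x \<odot>\<^bsub>F n\<^esub> u \<ominus>\<^bsub>F n\<^esub> x \<odot>\<^bsub>F n\<^esub> w" using xc uc wc by (simp add: M.minus_eq M.smult_r_distr M.smult_r_minus)
    then show ?thesis unfolding zuv y_def using xc uc wc vc by (simp add: M.minus_eq M.a_assoc M.r_neg1)
  qed
  have am: "?a \<in> ideal_span \<mm> (F n) (syz n)" using ideal_span.smult[OF x(1) uw] .
  have "y = \<ominus>\<^bsub>F n\<^esub> ?a \<oplus>\<^bsub>F n\<^esub> z" unfolding zy using ac yc by (simp add: M.r_neg1)
  then have "y \<in> ideal_span \<mm> (F n) (syz n)"
    using ideal_span.add[OF M.ideal_span_uminus[OF ideal_max_ideal syz_subset am] z(1)] by simp
  then have "y \<in> ideal_span I (F n) (syz n)" using IH yI by simp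
  then have "y \<in> ideal_span (adjoin R I x) (F n) (syz n)" using ideal_span_mono[OF xI(1) subset_refl] by (rule subsetD[rotated])
  from ideal_span.add[OF ideal_span.smult[OF xI(2) uw] this] show ?case unfolding zy .
qed

lemma module_syzygy: "module R (syzygy K F d n)"
proof (cases n)
  case 0
  then show ?thesis using module_K by simp
next
  case (Suc k)
  then show ?thesis using submodule.submodule_is_module[OF submodule_syz module_F, of k] by (simp add: syz_def)
qed

lemma socle_smult_syzygy:
  assumes I: "independent_regular R t I" and s: "s \<in> \<mm>" "\<And>a. a \<in> \<mm> \<Longrightarrow> a \<otimes> s \<in> I"
    and w: "w \<in> carrier (syzygy K F d n)"
  shows "s \<odot>\<^bsub>syzygy K F d n\<^esub> w \<in> ideal_span I (syzygy K F d n) (carrier (syzygy K F d n))"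
proof (cases n)
  case 0
  \<comment> \<open>The zeroth syzygy is \<open>K\<close> itself, killed by \<open>s\<close> because
    \<open>s\<close> lies in the maximal ideal.\<close>
  then show ?thesis using residue[OF s(1)] w ideal_span.zero[of K I] by simp
next
  case (Suc k)
  interpret module R "F k" using module_F .
  have Ii: "ideal I R" using independent_regular_ideal I by simp
  have sc: "s \<in> carrier R" using idealD(6)[OF ideal_max_ideal s(1)] .
  have wk: "w \<in> syz k" using w unfolding Suc by (simp add: syz_def)
  have 1: "s \<odot>\<^bsub>F k\<^esub> w \<in> ideal_span \<mm> (F k) (syz k)" using ideal_span.smult[OF s(1) wk] .
  have "w \<in> ideal_span \<mm> (F k) (carrier (F k))" using wk syz_minimal by blast
  then have 2: "s \<odot>\<^bsub>F k\<^esub> w \<in> ideal_span I (F k) (carrier (F k))"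
  proof induction
    case zero
    then show ?case using sc ideal_span.zero by simp
  next
    case (smult r u)
    have rc: "r \<in> carrier R" using idealD(6)[OF ideal_max_ideal smult(1)] .
    then have "s \<odot>\<^bsub>F k\<^esub> (r \<odot>\<^bsub>F k\<^esub> u) = (r \<otimes> s) \<odot>\<^bsub>F k\<^esub> u"
      using sc smult(2) m_comm[of r s] by (simp add: smult_assoc1)
    then show ?case using ideal_span.smult[OF s(2)[OF smult(1)] smult(2)] by simp
  next
    case (add v w)
    then have "v \<in> carrier (F k)" "w \<in> carrier (F k)" using ideal_span_carrier[OF ideal_max_ideal] by blast+
    then show ?case using sc add by (simp add: smult_r_distr ideal_span.add)
  qed
  show ?thesis using span_intersection[OF I 1 2] unfolding Suc by (simp add: ideal_span_carrier_update syz_def)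
qed

end

section \<open>Reduction of the module along a regular sequence\<close>

text \<open>These facts stand in for the module structure of the direct sum; the last one makes
  \<open>f\<close> preserve zero by homogeneity.\<close>

lemma direct_sum_closed:
  assumes D: "finite D" and mod: "\<And>i. i \<in> D \<Longrightarrow> module R (Mo i)"
  shows "\<zero>\<^bsub>direct_sum D Mo\<^esub> \<in> carrier (direct_sum D Mo)"
    "\<And>r u. r \<in> carrier R \<Longrightarrow> u \<in> carrier (direct_sum D Mo) \<Longrightarrow> r \<odot>\<^bsub>direct_sum D Mo\<^esub> u \<in> carrier (direct_sum D Mo)"
    "\<And>u v. u \<in> carrier (direct_sum D Mo) \<Longrightarrow> v \<in> carrier (direct_sum D Mo) \<Longrightarrow>
      u \<oplus>\<^bsub>direct_sum D Mo\<^esub> v \<in> carrier (direct_sum D Mo)"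
    "\<And>u. u \<in> carrier (direct_sum D Mo) \<Longrightarrow> \<zero>\<^bsub>R\<^esub> \<odot>\<^bsub>direct_sum D Mo\<^esub> u = \<zero>\<^bsub>direct_sum D Mo\<^esub>"
proof -
  have m: "\<zero>\<^bsub>Mo i\<^esub> \<in> carrier (Mo i)"
    "\<And>r u. r \<in> carrier R \<Longrightarrow> u \<in> carrier (Mo i) \<Longrightarrow> r \<odot>\<^bsub>Mo i\<^esub> u \<in> carrier (Mo i)"
    "\<And>u v. u \<in> carrier (Mo i) \<Longrightarrow> v \<in> carrier (Mo i) \<Longrightarrow> u \<oplus>\<^bsub>Mo i\<^esub> v \<in> carrier (Mo i)"
    "\<And>u. u \<in> carrier (Mo i) \<Longrightarrow> \<zero>\<^bsub>R\<^esub> \<odot>\<^bsub>Mo i\<^esub> u = \<zero>\<^bsub>Mo i\<^esub>" if "i \<in> D" for i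
  proof -
    interpret module R "Mo i" using mod[OF that] .
    show "\<zero>\<^bsub>Mo i\<^esub> \<in> carrier (Mo i)"
      "\<And>r u. r \<in> carrier R \<Longrightarrow> u \<in> carrier (Mo i) \<Longrightarrow> r \<odot>\<^bsub>Mo i\<^esub> u \<in> carrier (Mo i)"
      "\<And>u v. u \<in> carrier (Mo i) \<Longrightarrow> v \<in> carrier (Mo i) \<Longrightarrow> u \<oplus>\<^bsub>Mo i\<^esub> v \<in> carrier (Mo i)"
      "\<And>u. u \<in> carrier (Mo i) \<Longrightarrow> \<zero>\<^bsub>R\<^esub> \<odot>\<^bsub>Mo i\<^esub> u = \<zero>\<^bsub>Mo i\<^esub>" by simp_all
  qed
  have c: "u \<in> carrier (direct_sum D Mo) \<longleftrightarrow> u \<in> (\<Pi>\<^sub>E i \<in> D. carrier (Mo i))" for u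
    using D unfolding direct_sum_def by simp
  show "\<zero>\<^bsub>direct_sum D Mo\<^esub> \<in> carrier (direct_sum D Mo)"
    unfolding c using m(1) by (simp add: direct_sum_def restrict_PiE_iff)
  fix u assume u: "u \<in> carrier (direct_sum D Mo)"
  show "r \<odot>\<^bsub>direct_sum D Mo\<^esub> u \<in> carrier (direct_sum D Mo)" if "r \<in> carrier R" for r
    using u m(2) that unfolding c by (simp add: direct_sum_def restrict_PiE_iff PiE_iff)
  show "\<zero>\<^bsub>R\<^esub> \<odot>\<^bsub>direct_sum D Mo\<^esub> u = \<zero>\<^bsub>direct_sum D Mo\<^esub>"
    using u m(4) unfolding c by (auto simp: direct_sum_def PiE_iff intro: restrict_ext)
  fix v assume v: "v \<in> carrier (direct_sum D Mo)"
  show "u \<oplus>\<^bsub>direct_sum D Mo\<^esub> v \<in> carrier (direct_sum D Mo)"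
    using u v m(3) unfolding c by (simp add: direct_sum_def restrict_PiE_iff PiE_iff)
qed

text \<open>\<open>(B, M)\<close> is a copy of \<open>(A/I, L/IL)\<close> on the original types that
  satisfies \<open>P\<close>. For \<open>\<psi>\<close> only the inclusion of the kernel in
  \<open>I L\<close> is recorded; the converse follows since \<open>\<phi>\<close> vanishes on
  \<open>I\<close>.\<close>

definition star_reduction ::
    "('a ring \<Rightarrow> ('a, 'b) module \<Rightarrow> bool) \<Rightarrow> 'a ring \<Rightarrow> ('a, 'b) module \<Rightarrow> 'a set \<Rightarrow>
      'a ring \<Rightarrow> ('a, 'b) module \<Rightarrow> ('a \<Rightarrow> 'a) \<Rightarrow> ('b \<Rightarrow> 'b) \<Rightarrow> bool" where
  "star_reduction P A L I B M \<phi> \<psi> \<longleftrightarrow>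
    noetherian_local_ring B \<and> module B M \<and> P B M \<and>
    \<phi> \<in> ring_hom A B \<and> \<phi> ` carrier A = carrier B \<and>
    (\<forall>a \<in> carrier A. \<phi> a = \<zero>\<^bsub>B\<^esub> \<longleftrightarrow> a \<in> I) \<and>
    \<psi> ` carrier L = carrier M \<and>
    (\<forall>u \<in> carrier L. \<forall>v \<in> carrier L. \<psi> (u \<oplus>\<^bsub>L\<^esub> v) = \<psi> u \<oplus>\<^bsub>M\<^esub> \<psi> v) \<and>
    (\<forall>a \<in> carrier A. \<forall>u \<in> carrier L. \<psi> (a \<odot>\<^bsub>L\<^esub> u) = \<phi> a \<odot>\<^bsub>M\<^esub> \<psi> u) \<and>
    (\<forall>u \<in> carrier L. \<psi> u = \<zero>\<^bsub>M\<^esub> \<longrightarrow> u \<in> ideal_span I L (carrier L))"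

lemma star_reductionD:
  assumes "star_reduction P A L I B M \<phi> \<psi>"
  shows "noetherian_local_ring B" "module B M" "P B M"
    "\<phi> \<in> ring_hom A B" "\<phi> ` carrier A = carrier B"
    "\<And>a. a \<in> carrier A \<Longrightarrow> \<phi> a = \<zero>\<^bsub>B\<^esub> \<longleftrightarrow> a \<in> I"
    "\<psi> ` carrier L = carrier M"
    "\<And>u v. u \<in> carrier L \<Longrightarrow> v \<in> carrier L \<Longrightarrow> \<psi> (u \<oplus>\<^bsub>L\<^esub> v) = \<psi> u \<oplus>\<^bsub>M\<^esub> \<psi> v"
    "\<And>a u. a \<in> carrier A \<Longrightarrow> u \<in> carrier L \<Longrightarrow> \<psi> (a \<odot>\<^bsub>L\<^esub> u) = \<phi> a \<odot>\<^bsub>M\<^esub> \<psi> u"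
    "\<And>u. u \<in> carrier L \<Longrightarrow> \<psi> u = \<zero>\<^bsub>M\<^esub> \<Longrightarrow> u \<in> ideal_span I L (carrier L)"
  using assms unfolding star_reduction_def by simp_all

lemma star_reduction_zero:
  assumes "noetherian_local_ring A" "module A L" "P A L"
  shows "star_reduction P A L {\<zero>\<^bsub>A\<^esub>} A L (\<lambda>a. a) (\<lambda>u. u)"
  using assms unfolding star_reduction_def by (auto simp: ring_hom_def intro: ideal_span.zero)

text \<open>One application of property (i): regularity of \<open>x\<close> modulo \<open>I\<close>
  is regularity of \<open>\<phi> x\<close> in \<open>B\<close>. The reductions are composed, so the
  new pair is again compared with \<open>(A, L)\<close> directly, and the kernel of the ring map
  grows from \<open>I\<close> to \<open>I + (x)\<close>.\<close>

lemma star_reduction_adjoin: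
  assumes star: "star_property P" and A: "noetherian_local_ring A" and L: "module A L"
    and red: "star_reduction P A L I B M \<phi> \<psi>" and I: "ideal I A" "I \<subseteq> max_ideal A"
    and x: "x \<in> max_ideal A" and reg: "\<And>y. y \<in> carrier A \<Longrightarrow> x \<otimes>\<^bsub>A\<^esub> y \<in> I \<Longrightarrow> y \<in> I"
  shows "\<exists>B' M' \<phi>' \<psi>'. star_reduction P A L (adjoin A I x) B' M' \<phi>' \<psi>'"
proof -
  interpret A: noetherian_local_ring A by fact
  interpret L: module A L by fact
  note B = star_reductionD(1)[OF red] and M = star_reductionD(2)[OF red] and PB = star_reductionD(3)[OF red]
    and \<phi> = star_reductionD(4,5)[OF red] and ker\<phi> = star_reductionD(6)[OF red] and \<psi> = star_reductionD(7)[OF red]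
    and \<psi>_add = star_reductionD(8)[OF red] and \<psi>_smult = star_reductionD(9)[OF red]
    and ker\<psi> = star_reductionD(10)[OF red]
  interpret B: noetherian_local_ring B by (rule B)
  interpret M: module B M by (rule M)
  interpret \<phi>: ring_hom_cring A B \<phi>
    by (intro ring_hom_cring.intro A.is_cring B.is_cring ring_hom_cring_axioms.intro \<phi>)
  have xc: "x \<in> carrier A" using A.idealD(6)[OF A.ideal_max_ideal x] .
  have "\<one>\<^bsub>A\<^esub> \<notin> I" using I A.primeD(3)[OF A.prime_max_ideal] by auto
  then have "\<one>\<^bsub>B\<^esub> \<noteq> \<zero>\<^bsub>B\<^esub>" using ker\<phi>[OF A.one_closed] by simp
  then have mB: "max_ideal B = \<phi> ` max_ideal A"
    using noetherian_local_ring_image(2)[OF A B.is_cring \<phi>] by simp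
  have \<phi>x: "\<phi> x \<in> max_ideal B" unfolding mB using x by blast
  have \<phi>xc: "\<phi> x \<in> carrier B" using \<phi>.hom_closed[OF xc] .
  have "y = \<zero>\<^bsub>B\<^esub>" if y: "y \<in> carrier B" "\<phi> x \<otimes>\<^bsub>B\<^esub> y = \<zero>\<^bsub>B\<^esub>" for y
  proof -
    obtain b where b: "b \<in> carrier A" "y = \<phi> b" using y(1) \<phi>(2) by (metis imageE)
    then have "\<phi> (x \<otimes>\<^bsub>A\<^esub> b) = \<zero>\<^bsub>B\<^esub>" using y(2) \<phi>.hom_mult[OF xc b(1)] by simp
    then have "b \<in> I" using ker\<phi>[OF A.m_closed[OF xc b(1)]] reg[OF b(1)] by simp
    then show ?thesis using ker\<phi>[OF b(1)] b(2) by simp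
  qed
  then have reg_B: "regular_element B (\<phi> x)" unfolding regular_element_def using \<phi>xc by auto
  obtain B' :: "'a ring" and M' :: "('a, 'b) module" and h g where B': "cring B'"
    and h: "h \<in> ring_hom B B'" "h ` carrier B = carrier B'"
    and kerh: "\<And>a. a \<in> carrier B \<Longrightarrow> h a = \<zero>\<^bsub>B'\<^esub> \<longleftrightarrow> a \<in> PIdl\<^bsub>B\<^esub> \<phi> x"
    and M': "module B' M'" and g: "g ` carrier M = carrier M'"
    and g_add: "\<And>u v. u \<in> carrier M \<Longrightarrow> v \<in> carrier M \<Longrightarrow> g (u \<oplus>\<^bsub>M\<^esub> v) = g u \<oplus>\<^bsub>M'\<^esub> g v"
    and g_smult: "\<And>r u. r \<in> carrier B \<Longrightarrow> u \<in> carrier M \<Longrightarrow> g (r \<odot>\<^bsub>M\<^esub> u) = h r \<odot>\<^bsub>M'\<^esub> g u"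
    and kerg: "\<And>u. u \<in> carrier M \<Longrightarrow> g u = \<zero>\<^bsub>M'\<^esub> \<longleftrightarrow> u \<in> (\<odot>\<^bsub>M\<^esub>) (\<phi> x) ` carrier M"
    and iso: "ring_module_isomorphic (B Quot (PIdl\<^bsub>B\<^esub> \<phi> x)) (quotient_module B M (\<phi> x)) B' M'"
    by (rule exists_quotient_module[OF M \<phi>xc]) (rule that; assumption)
  interpret B': cring B' by fact
  have "\<one>\<^bsub>B\<^esub> \<notin> PIdl\<^bsub>B\<^esub> \<phi> x"
  proof
    assume "\<one>\<^bsub>B\<^esub> \<in> PIdl\<^bsub>B\<^esub> \<phi> x"
    then obtain c where "c \<in> carrier B" "\<one>\<^bsub>B\<^esub> = c \<otimes>\<^bsub>B\<^esub> \<phi> x" unfolding cgenideal_def by auto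
    then show False using B.idealD(4)[OF B.ideal_max_ideal \<phi>x] B.primeD(3)[OF B.prime_max_ideal] by metis
  qed
  then have "\<one>\<^bsub>B'\<^esub> \<noteq> \<zero>\<^bsub>B'\<^esub>" using kerh[OF B.one_closed] ring_hom_one[OF h(1)] by simp
  then have local: "noetherian_local_ring B'" using noetherian_local_ring_image(1)[OF B B' h] by simp
  have P': "P B' M'"
    using star B M PB \<phi>x reg_B local M' iso unfolding star_property_def local_ring_iff_locale by blast
  have ker': "h (\<phi> a) = \<zero>\<^bsub>B'\<^esub> \<longleftrightarrow> a \<in> adjoin A I x" if a: "a \<in> carrier A" for a
  proof -
    have "\<phi> a = \<phi> b \<otimes>\<^bsub>B\<^esub> \<phi> x \<longleftrightarrow> a \<ominus>\<^bsub>A\<^esub> b \<otimes>\<^bsub>A\<^esub> x \<in> I" if b: "b \<in> carrier A" for b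
    proof -
      have "\<phi> (a \<ominus>\<^bsub>A\<^esub> b \<otimes>\<^bsub>A\<^esub> x) = \<phi> a \<ominus>\<^bsub>B\<^esub> \<phi> b \<otimes>\<^bsub>B\<^esub> \<phi> x" using a b xc by (simp add: a_minus_def)
      then show ?thesis
        using ker\<phi>[of "a \<ominus>\<^bsub>A\<^esub> b \<otimes>\<^bsub>A\<^esub> x"] a b xc B.r_right_minus_eq[of "\<phi> a" "\<phi> b \<otimes>\<^bsub>B\<^esub> \<phi> x"] by simp
    qed
    moreover have "\<phi> a \<in> PIdl\<^bsub>B\<^esub> \<phi> x \<longleftrightarrow> (\<exists>b \<in> carrier A. \<phi> a = \<phi> b \<otimes>\<^bsub>B\<^esub> \<phi> x)"
      unfolding cgenideal_def \<phi>(2)[symmetric] by auto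
    moreover have "(\<exists>b \<in> carrier A. a \<ominus>\<^bsub>A\<^esub> b \<otimes>\<^bsub>A\<^esub> x \<in> I) \<longleftrightarrow> a \<in> adjoin A I x"
    proof
      assume "\<exists>b \<in> carrier A. a \<ominus>\<^bsub>A\<^esub> b \<otimes>\<^bsub>A\<^esub> x \<in> I"
      then obtain b where b: "b \<in> carrier A" "a \<ominus>\<^bsub>A\<^esub> b \<otimes>\<^bsub>A\<^esub> x \<in> I" by auto
      have "a = (a \<ominus>\<^bsub>A\<^esub> b \<otimes>\<^bsub>A\<^esub> x) \<oplus>\<^bsub>A\<^esub> b \<otimes>\<^bsub>A\<^esub> x" using a b(1) xc by algebra
      then show "a \<in> adjoin A I x" unfolding adjoin_def using b by blast
    next
      assume "a \<in> adjoin A I x"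
      then obtain i b where b: "i \<in> I" "b \<in> carrier A" "a = i \<oplus>\<^bsub>A\<^esub> b \<otimes>\<^bsub>A\<^esub> x" unfolding adjoin_def by blast
      have "(i \<oplus>\<^bsub>A\<^esub> b \<otimes>\<^bsub>A\<^esub> x) \<ominus>\<^bsub>A\<^esub> b \<otimes>\<^bsub>A\<^esub> x = i" using A.idealD(6)[OF I(1) b(1)] b(2) xc by algebra
      then show "\<exists>b \<in> carrier A. a \<ominus>\<^bsub>A\<^esub> b \<otimes>\<^bsub>A\<^esub> x \<in> I" using b by (intro bexI[of _ b]) simp_all
    qed
    ultimately show ?thesis using kerh[OF \<phi>.hom_closed[OF a]] by auto
  qed
  have xI: "I \<subseteq> adjoin A I x" "x \<in> adjoin A I x" using A.adjoin_superset[OF I(1) xc] by auto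
  have \<psi>c: "\<psi> u \<in> carrier M" if "u \<in> carrier L" for u using \<psi> that by blast
  have ker_L: "u \<in> ideal_span (adjoin A I x) L (carrier L)" if u: "u \<in> carrier L" "g (\<psi> u) = \<zero>\<^bsub>M'\<^esub>" for u
  proof -
    obtain m where m: "m \<in> carrier M" "\<psi> u = \<phi> x \<odot>\<^bsub>M\<^esub> m" using kerg[OF \<psi>c[OF u(1)]] u(2) by auto
    \<comment> \<open>Lifting the witness \<open>m\<close> to \<open>L\<close> lets
      \<open>x v\<close> be subtracted from \<open>u\<close>; the difference already dies in
      \<open>M\<close>, where the kernel of \<open>\<psi>\<close> is controlled.\<close>
    obtain v where v: "v \<in> carrier L" "m = \<psi> v" using m(1) \<psi> by (metis imageE)
    have xv: "x \<odot>\<^bsub>L\<^esub> v \<in> carrier L" "\<psi> (x \<odot>\<^bsub>L\<^esub> v) = \<psi> u" using xc v m(2) \<psi>_smult by auto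
    have u_eq: "(u \<ominus>\<^bsub>L\<^esub> x \<odot>\<^bsub>L\<^esub> v) \<oplus>\<^bsub>L\<^esub> x \<odot>\<^bsub>L\<^esub> v = u"
      using u(1) xv(1) by (simp add: L.M.minus_eq L.M.a_assoc L.M.l_neg)
    have c: "u \<ominus>\<^bsub>L\<^esub> x \<odot>\<^bsub>L\<^esub> v \<in> carrier L" using u(1) xv(1) by simp
    have "\<psi> (u \<ominus>\<^bsub>L\<^esub> x \<odot>\<^bsub>L\<^esub> v) \<oplus>\<^bsub>M\<^esub> \<psi> u = \<psi> u" using \<psi>_add[OF c xv(1)] unfolding u_eq xv(2) by simp
    then have "\<psi> (u \<ominus>\<^bsub>L\<^esub> x \<odot>\<^bsub>L\<^esub> v) = \<zero>\<^bsub>M\<^esub>"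
      using M.M.add.r_cancel_one[of "\<psi> u" "\<psi> (u \<ominus>\<^bsub>L\<^esub> x \<odot>\<^bsub>L\<^esub> v)"] \<psi>c[OF c] \<psi>c[OF u(1)] by simp
    then have "u \<ominus>\<^bsub>L\<^esub> x \<odot>\<^bsub>L\<^esub> v \<in> ideal_span (adjoin A I x) L (carrier L)"
      using ker\<psi>[OF c] ideal_span_mono[OF xI(1) subset_refl, of L "carrier L"] by auto
    from ideal_span.add[OF this ideal_span.smult[OF xI(2) v(1)]] show ?thesis unfolding u_eq .
  qed
  have "(h \<circ> \<phi>) ` carrier A = carrier B'" "(g \<circ> \<psi>) ` carrier L = carrier M'"
    using \<phi>(2) h(2) \<psi> g by (metis image_comp)+
  moreover have "\<forall>u\<in>carrier L. \<forall>v\<in>carrier L. (g \<circ> \<psi>) (u \<oplus>\<^bsub>L\<^esub> v) = (g \<circ> \<psi>) u \<oplus>\<^bsub>M'\<^esub> (g \<circ> \<psi>) v"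
    using \<psi>_add g_add \<psi>c by simp
  moreover have "\<forall>a\<in>carrier A. \<forall>u\<in>carrier L. (g \<circ> \<psi>) (a \<odot>\<^bsub>L\<^esub> u) = (h \<circ> \<phi>) a \<odot>\<^bsub>M'\<^esub> (g \<circ> \<psi>) u"
    using \<psi>_smult g_smult \<psi>c by simp
  moreover have "\<forall>a\<in>carrier A. (h \<circ> \<phi>) a = \<zero>\<^bsub>B'\<^esub> \<longleftrightarrow> a \<in> adjoin A I x" using ker' by simp
  moreover have "\<forall>u\<in>carrier L. (g \<circ> \<psi>) u = \<zero>\<^bsub>M'\<^esub> \<longrightarrow> u \<in> ideal_span (adjoin A I x) L (carrier L)"
    using ker_L by simp
  ultimately show ?thesis
    unfolding star_reduction_def using local M' P' ring_hom_trans[OF \<phi>(1) h(1)] by blast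
qed

text \<open>If \<open>s\<close> were outside \<open>I\<close>, then \<open>\<phi> s\<close> would be
  a nonzero element of \<open>B\<close> killed by the maximal ideal. No element of that ideal is
  then regular, so the depth is zero, and property (ii) contradicts that \<open>\<phi> s\<close>
  annihilates \<open>M\<close>.\<close>

lemma star_reduction_socle:
  assumes star: "star_property P" and A: "noetherian_local_ring A" and L: "module A L"
    and red: "star_reduction P A L I B M \<phi> \<psi>" and I: "ideal I A" "I \<subseteq> max_ideal A"
    and s: "s \<in> carrier A" "\<And>a. a \<in> max_ideal A \<Longrightarrow> a \<otimes>\<^bsub>A\<^esub> s \<in> I"
    and sL: "\<And>u. u \<in> carrier L \<Longrightarrow> s \<odot>\<^bsub>L\<^esub> u \<in> ideal_span I L (carrier L)"
  shows "s \<in> I"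
proof (rule ccontr)
  assume sI: "s \<notin> I"
  interpret A: noetherian_local_ring A by fact
  interpret L: module A L by fact
  note B = star_reductionD(1)[OF red] and M = star_reductionD(2)[OF red] and PB = star_reductionD(3)[OF red]
    and \<phi> = star_reductionD(4,5)[OF red] and ker\<phi> = star_reductionD(6)[OF red] and \<psi> = star_reductionD(7)[OF red]
    and \<psi>_add = star_reductionD(8)[OF red] and \<psi>_smult = star_reductionD(9)[OF red]
  interpret B: noetherian_local_ring B by (rule B)
  interpret M: module B M by (rule M)
  interpret \<phi>: ring_hom_cring A B \<phi>
    by (intro ring_hom_cring.intro A.is_cring B.is_cring ring_hom_cring_axioms.intro \<phi>)
  have "\<one>\<^bsub>A\<^esub> \<notin> I" using I A.primeD(3)[OF A.prime_max_ideal] by auto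
  then have "\<one>\<^bsub>B\<^esub> \<noteq> \<zero>\<^bsub>B\<^esub>" using ker\<phi>[OF A.one_closed] by simp
  then have mB: "max_ideal B = \<phi> ` max_ideal A"
    using noetherian_local_ring_image(2)[OF A B.is_cring \<phi>] by simp
  have \<phi>s: "\<phi> s \<in> carrier B" "\<phi> s \<noteq> \<zero>\<^bsub>B\<^esub>" using \<phi>.hom_closed[OF s(1)] ker\<phi>[OF s(1)] sI by auto
  have "xs = []" if xs: "set xs \<subseteq> max_ideal B" "regular_sequence B xs" for xs
  proof (cases xs)
    case (Cons b ys)
    then have "b \<in> max_ideal B" using xs(1) by simp
    then obtain a where a: "a \<in> max_ideal A" "b = \<phi> a" unfolding mB by auto
    have ac: "a \<in> carrier A" using A.idealD(6)[OF A.ideal_max_ideal a(1)] .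
    have "\<phi> (a \<otimes>\<^bsub>A\<^esub> s) = \<zero>\<^bsub>B\<^esub>" using ker\<phi>[OF A.m_closed[OF ac s(1)]] s(2)[OF a(1)] by simp
    then have "b \<otimes>\<^bsub>B\<^esub> \<phi> s = \<zero>\<^bsub>B\<^esub>" using \<phi>.hom_mult[OF ac s(1)] a(2) by simp
    \<comment> \<open>At index 0 the preceding entries generate \<open>Idl {}\<close>, the zero
      ideal, so a first entry would have to be a nonzerodivisor of \<open>B\<close>.\<close>
    moreover have "b \<otimes>\<^bsub>B\<^esub> \<phi> s \<in> Idl\<^bsub>B\<^esub> {} \<longrightarrow> \<phi> s \<in> Idl\<^bsub>B\<^esub> {}"
      using xs(2) \<phi>s(1) unfolding regular_sequence_def Cons by force
    ultimately show ?thesis using \<phi>s(2) unfolding B.genideal_empty by simp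
  qed simp
  then have "depth B \<le> 0" unfolding depth_def by (intro Sup_least) (auto simp: zero_enat_def)
  then have "depth B = 0" by simp
  then have ann: "annihilator B M = {\<zero>\<^bsub>B\<^esub>}"
    using star B M PB unfolding star_property_def local_ring_iff_locale by blast
  have \<psi>c: "\<psi> u \<in> carrier M" if "u \<in> carrier L" for u using \<psi> that by blast
  have span0: "\<psi> w = \<zero>\<^bsub>M\<^esub>" if "w \<in> ideal_span I L (carrier L)" for w
    using that
  proof induction
    case zero
    have "\<psi> (\<zero>\<^bsub>A\<^esub> \<odot>\<^bsub>L\<^esub> \<zero>\<^bsub>L\<^esub>) = \<zero>\<^bsub>M\<^esub>" using \<psi>_smult[OF A.zero_closed L.M.zero_closed] \<psi>c by simp
    then show ?case by simp
  next
    case (smult r u)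
    have rc: "r \<in> carrier A" using A.idealD(6)[OF I(1) smult(1)] .
    then show ?case using \<psi>_smult[OF rc smult(2)] ker\<phi>[OF rc] smult(1) \<psi>c[OF smult(2)] by simp
  next
    case (add v w)
    then have "v \<in> carrier L" "w \<in> carrier L" using L.ideal_span_subset[OF I(1) subset_refl] by auto
    then show ?case using \<psi>_add add by simp
  qed
  have "\<phi> s \<odot>\<^bsub>M\<^esub> m = \<zero>\<^bsub>M\<^esub>" if m: "m \<in> carrier M" for m
  proof -
    obtain u where u: "u \<in> carrier L" "m = \<psi> u" using m \<psi> by (metis imageE)
    then show ?thesis using \<psi>_smult[OF s(1) u(1)] span0[OF sL[OF u(1)]] by simp
  qed
  then have "\<phi> s \<in> annihilator B M" unfolding annihilator_def using \<phi>s(1) by simp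
  then show False using ann \<phi>s(2) by simp
qed

theorem theorem1p4p10:
  fixes A :: "'a ring"
    and P :: "'a ring \<Rightarrow> ('a, 'b) module \<Rightarrow> bool"
    and K :: "('a, 'c) module"
    and F :: "nat \<Rightarrow> ('a, 'c) module"
    and d :: "nat \<Rightarrow> 'c \<Rightarrow> 'c"
    and \<Lambda> :: "nat set"
    and j :: "nat \<Rightarrow> nat"
    and L :: "('a, 'b) module"
    and f :: "(nat \<times> nat \<Rightarrow> 'c) \<Rightarrow> 'b"
  assumes "local_ring A"
    and "star_property P"
    and "module_isomorphic A (residue_module A) K"
    and "minimal_free_resolution A K F d"
    and "finite \<Lambda>"
    and "\<And>n. n \<in> \<Lambda> \<Longrightarrow> j n \<ge> 1"
    and "module A L"
    and "carrier L \<noteq> {\<zero>\<^bsub>L\<^esub>}"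
    and "P A L"
    and "f \<in> module_Hom A (direct_sum (SIGMA n:\<Lambda>. {..<j n}) (\<lambda>(n, i). syzygy K F d n)) L"
    and "f ` carrier (direct_sum (SIGMA n:\<Lambda>. {..<j n}) (\<lambda>(n, i). syzygy K F d n)) = carrier L"
  shows "regular_local_ring A"
proof -
  have A: "noetherian_local_ring A" using assms(1) local_ring_iff_locale by blast
  interpret A: noetherian_local_ring A by fact
  interpret L: module A L by fact
  have K: "module A K" using assms(4) unfolding minimal_free_resolution_def by simp
  interpret res: residue_field_resolution A K F d
    by (intro residue_field_resolution.intro A residue_field_resolution_axioms.intro assms(4)
        residue_module_annihilated[OF A assms(3) K])
  let ?m = "max_ideal A"
  let ?D = "SIGMA n:\<Lambda>. {..<j n}" and ?Mo = "\<lambda>(n, i). syzygy K F d n"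
  let ?S = "direct_sum ?D ?Mo"
  have D: "finite ?D" using assms(5) by simp
  have mod: "module A (?Mo p)" for p using res.module_syzygy by (cases p) simp
  note S = direct_sum_closed[where Mo = ?Mo, OF D mod]
  have f0: "f \<zero>\<^bsub>?S\<^esub> = \<zero>\<^bsub>L\<^esub>"
    using module_HomD(3)[OF assms(10) A.zero_closed S(1)] module_HomD(1)[OF assms(10) S(1)] S(4)[OF S(1)] by simp
  \<comment> \<open>The tower and the reduced pair must both exist for \<open>I\<close>; length and
    witnesses stay existential, so that the family is ordered by inclusion of ideals alone.\<close>
  define Good where "Good = {I. \<exists>t. independent_regular A t I \<and> (\<exists>B M \<phi> \<psi>. star_reduction P A L I B M \<phi> \<psi>)}"
  have "{\<zero>\<^bsub>A\<^esub>} \<in> Good"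
    unfolding Good_def using independent_regular.zero star_reduction_zero[of A L P, OF A assms(7,9)] by blast
  moreover have "ideal J A" if "J \<in> Good" for J
    using A.independent_regular_ideal that unfolding Good_def by blast
  ultimately have "\<exists>M\<in>Good. \<forall>Z\<in>Good. M \<subseteq> Z \<longrightarrow> Z = M"
    by (intro A.ideal_maximal_element) auto
  then obtain I where I: "I \<in> Good" and max: "\<And>Z. Z \<in> Good \<Longrightarrow> I \<subseteq> Z \<Longrightarrow> Z = I" by blast
  obtain t B M \<phi> \<psi> where t: "independent_regular A t I" and red: "star_reduction P A L I B M \<phi> \<psi>"
    using I unfolding Good_def by blast
  have Ii: "ideal I A" "I \<subseteq> ?m" using A.independent_regular_ideal[OF t] by auto
  have "I = ?m"
  proof (rule ccontr)
    assume "I \<noteq> ?m"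
    from A.socle_or_regular_element[OF Ii this] show False
    proof (elim disjE bexE conjE)
      fix s assume 1: "s \<in> ?m" "s \<notin> I" and "\<forall>a \<in> ?m. a \<otimes>\<^bsub>A\<^esub> s \<in> I"
      then have soc: "a \<otimes>\<^bsub>A\<^esub> s \<in> I" if "a \<in> ?m" for a using bspec that by metis
      have sc: "s \<in> carrier A" using A.idealD(6)[OF A.ideal_max_ideal 1(1)] .
      have "s \<odot>\<^bsub>L\<^esub> l \<in> ideal_span I L (carrier L)" if l: "l \<in> carrier L" for l
      proof -
        have "l \<in> f ` carrier ?S" unfolding assms(11) by (rule l)
        then obtain w where w: "w \<in> carrier ?S" "l = f w" by (rule imageE) (rule that)
        \<comment> \<open>Multiplication by \<open>s\<close> acts summand by summand, and on each
          syzygy it lands in \<open>I\<close> times that syzygy; \<open>f\<close> then transports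
          this to \<open>L\<close>.\<close>
        have sp: "(s \<odot>\<^bsub>?S\<^esub> w) p \<in> ideal_span I (?Mo p) (carrier (?Mo p))" if p: "p \<in> ?D" for p
        proof -
          have "w p \<in> carrier (?Mo p)" using w(1) p unfolding direct_sum_def by (auto dest: PiE_mem)
          moreover have "(s \<odot>\<^bsub>?S\<^esub> w) p = s \<odot>\<^bsub>?Mo p\<^esub> w p" using p unfolding direct_sum_def by simp
          ultimately show ?thesis using res.socle_smult_syzygy[OF t 1(1) soc] by (cases p) simp
        qed
        have "ideal_span I ?S (carrier ?S) \<subseteq> carrier ?S"
        proof
          fix v assume "v \<in> ideal_span I ?S (carrier ?S)"
          then show "v \<in> carrier ?S" using S(1-3) A.idealD(6)[OF Ii(1)] by induction blast+
        qed
        moreover have "s \<odot>\<^bsub>?S\<^esub> w \<in> ideal_span I ?S (carrier ?S)"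
          by (rule ideal_span_direct_sum[where Mo = ?Mo, OF D mod S(2)[OF sc w(1)] sp Ii(1)])
        ultimately have "f (s \<odot>\<^bsub>?S\<^esub> w) \<in> ideal_span I L (f ` carrier ?S)"
          by (intro ideal_span_hom_image[where M = ?S and R = A] assms(10) f0 A.idealD(1)[OF Ii(1)]) auto
        then show ?thesis using module_HomD(3)[OF assms(10) sc w(1)] w(2) assms(11) by simp
      qed
      then have "s \<in> I" using star_reduction_socle[OF assms(2) A assms(7) red Ii sc soc] by blast
      then show False using 1(2) by simp
    next
      fix x assume 2: "x \<in> ?m" "x \<notin> set_add A I (ideal_prod A ?m ?m)"
        and "\<forall>y \<in> carrier A. x \<otimes>\<^bsub>A\<^esub> y \<in> I \<longrightarrow> y \<in> I"
      then have reg: "y \<in> I" if "y \<in> carrier A" "x \<otimes>\<^bsub>A\<^esub> y \<in> I" for y using that by blast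
      have xc: "x \<in> carrier A" using A.idealD(6)[OF A.ideal_max_ideal 2(1)] .
      have "adjoin A I x \<in> Good"
        unfolding Good_def using independent_regular.adjoin[OF t 2 reg] star_reduction_adjoin[OF assms(2) A assms(7) red Ii 2(1) reg]
        by blast
      \<comment> \<open>The enlarged ideal contains \<open>x\<close>, so maximality puts
        \<open>x\<close> into \<open>I\<close>; regularity modulo \<open>I\<close>, applied to one,
        then makes \<open>I\<close> the unit ideal.\<close>
      then have "x \<in> I" using max A.adjoin_superset[OF Ii(1) xc] by blast
      then have "\<one>\<^bsub>A\<^esub> \<in> I" using reg[OF A.one_closed] xc by simp
      then show False using Ii(2) A.primeD(3)[OF A.prime_max_ideal] by blast
    qed
  qed
  then show ?thesis using A.regular_of_independent_regular t by simp
qed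

end
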